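(* Let $d\ge1$ be an integer, $p>d$ and $q\ge 0$. (i) Suppose $q\ge p-1$. (a) If $u(r)\in Y^*_{rad}$ is a weak solution of $$(|u'|^{p-2}u')'+\frac{d-1}{r}|u'|^{p-2}u'=u^q\ (0<r<\infty),\qquad u(0)=1,\quad \lim_{r\to\infty}u(r)=0, \tag{P}$$ then $u(|x|)$ is a radial non-increasing weak solution of the Thomas–Fermi type equation $$\Delta_p u+a\,\delta(x)=u^q\ \text{ in }\mathcal{D}(\mathbb{R}^d),\qquad u(0)=1,\quad \lim_{|x|\to\infty}u(x)=0. \tag{TF}$$ (b) If $u(|x|)\in W^{1,p}(\mathbb{R}^d)$ is a radial non-increasing weak solution of (TF), then $u(r)$ is a solution of (P) in $Y^*_{rad}$. (ii) Suppose $q<p-1$. (a) If $u(r)\in Y^*_{rad}$ is a solution of the free boundary problem $$(|u'|^{p-2}u')'+\frac{d-1}{r}|u'|^{p-2}u'=u^q\ (0<r<R),\qquad u(0)=1,\quad u(R)=u'(R)=0, \tag{FBP}$$ then $u(|x|)$ is a radial non-increasing weak solution of $$\Delta_p u+a\,\delta(x)=u^q\ \text{ in }\mathcal{D}(B(0,R)),\qquad u(0)=1,\quad u(x)=\frac{\partial u}{\partial\vec n}(x)=0\ \text{ for }|x|=R. \tag{TF$_R$}$$ (b) If $u(|x|)\in W^{1,p}(\mathbb{R}^d)$ is a radial non-increasing weak solution of (TF$_R$), then $u(r)$ is a solution of (FBP) in $Y^*_{rad}$. In particular, for $d=1$ one has $a=2\left(\frac{p}{(q+1)(p-1)}\right)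^{\frac{p-1}{p}}$.
   Context: Throughout, $a:=\|\nabla u\|_{L^p}^p+\|u\|_{L^{q+1}}^{q+1}$, $\delta$ is the Dirac delta at the origin, $\Delta_pu=\nabla\cdot(|\nabla u|^{p-2}\nabla u)$, $\vec n$ is the outward unit normal to $\partial B(0,R)$, and $u(0)=1$ means $\lim_{r\to0^+}u(r)=1$. In (FBP) and (TF$_R$), $R\in(0,\infty)$, $u>0$ on $[0,R)$, and $u$ is extended by $0$ for $r\ge R$. $$Y^*_{rad}=\Big\{u(r)\ge0:\ \lim_{r\to0^+}u(r)=1,\ u'(r)\le0\ \text{a.e.},\ \int_0^\infty(|u|^{q+1}+|u'|^p)r^{d-1}dr<\infty\Big\}.$$ A function $u(|x|)$ is a radial non-increasing weak solution of (TF) if: it is non-increasing in $|x|$ with $\lim_{|x|\to0^+}u=1$ and satisfies the stated condition at infinity; $\nabla u\in L^p$ and $u\in L^{q+1}$; and for every radial $\phi(|x|)\in C_c^\infty(\mathbb{R}^d)$, $$\int\nabla\phi\cdot|\nabla u|^{p-2}\nabla u\,dx+\int\phi\,u^q\,dx=a\,\phi(0).$$ For (TF$_R$) the notion is the same with radial $\phi\in C_c^\infty(B(0,R))$ and the stated boundary conditions on $|x|=R$. *)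

theory Defs
  imports "HOL-Analysis.Analysis"
begin

section \<open>Test functions and weak gradients\<close>

primrec Ck :: "nat \<Rightarrow> ('a::euclidean_space \<Rightarrow> real) \<Rightarrow> bool" where
  "Ck 0 f \<longleftrightarrow> continuous_on UNIV f"
| "Ck (Suc k) f \<longleftrightarrow> f differentiable_on UNIV \<and>
     (\<forall>b\<in>Basis. Ck k (\<lambda>x. frechet_derivative f (at x) b))"

definition test_function :: "'a set \<Rightarrow> ('a::euclidean_space \<Rightarrow> real) \<Rightarrow> bool" where
  "test_function S \<phi> \<longleftrightarrow> (\<forall>k. Ck k \<phi>) \<and>
     compact (closure (support_on UNIV \<phi>)) \<and> closure (support_on UNIV \<phi>) \<subseteq> S"

definition grad :: "('a::euclidean_space \<Rightarrow> real) \<Rightarrow> 'a \<Rightarrow> 'a" where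
  "grad \<phi> x = (\<Sum>b\<in>Basis. frechet_derivative \<phi> (at x) b *\<^sub>R b)"

definition locally_integrable_on ::
    "'a set \<Rightarrow> ('a::euclidean_space \<Rightarrow> 'b::euclidean_space) \<Rightarrow> bool" where
  "locally_integrable_on S f \<longleftrightarrow> (\<forall>K. compact K \<and> K \<subseteq> S \<longrightarrow> f absolutely_integrable_on K)"

text \<open>Vector form of the requirement that, for every coordinate direction, the integral of
  \<open>f \<partial>\<^sub>i\<phi>\<close> equals minus the integral of \<open>g\<^sub>i \<phi>\<close>.\<close>

definition has_weak_gradient ::
    "'a set \<Rightarrow> ('a::euclidean_space \<Rightarrow> real) \<Rightarrow> ('a \<Rightarrow> 'a) \<Rightarrow> bool" where
  "has_weak_gradient S f g \<longleftrightarrow> locally_integrable_on S f \<and> locally_integrable_on S g \<and>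
     (\<forall>\<phi>. test_function S \<phi> \<longrightarrow>
        (LINT x:S|lebesgue. f x *\<^sub>R grad \<phi> x) = - (LINT x:S|lebesgue. \<phi> x *\<^sub>R g x))"

definition weakly_differentiable_on ::
    "'a set \<Rightarrow> ('a::euclidean_space \<Rightarrow> real) \<Rightarrow> bool" where
  "weakly_differentiable_on S f \<longleftrightarrow> (\<exists>g. has_weak_gradient S f g)"

text \<open>A representative of the weak gradient, which is unique up to null subsets of \<open>S\<close>; it is
  meaningful only on \<open>S\<close>, and only if \<open>f\<close> is weakly differentiable there. For functions
  of one real variable it is the weak derivative.\<close>

definition weak_gradient ::
    "'a set \<Rightarrow> ('a::euclidean_space \<Rightarrow> real) \<Rightarrow> 'a \<Rightarrow> 'a" where
  "weak_gradient S f = (SOME g. has_weak_gradient S f g)"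

definition in_Lp :: "real \<Rightarrow> ('a::euclidean_space \<Rightarrow> 'b::euclidean_space) \<Rightarrow> bool" where
  "in_Lp p f \<longleftrightarrow> f \<in> borel_measurable lebesgue \<and> integrable lebesgue (\<lambda>x. norm (f x) powr p)"

definition in_W1p :: "real \<Rightarrow> ('a::euclidean_space \<Rightarrow> real) \<Rightarrow> bool" where
  "in_W1p p f \<longleftrightarrow> in_Lp p f \<and> weakly_differentiable_on UNIV f \<and> in_Lp p (weak_gradient UNIV f)"


section \<open>The radial equations\<close>

text \<open>A profile \<open>u(r)\<close> is a function on the reals of which only the values at \<open>r > 0\<close> matter; its
  value at the origin is always understood as the limit for \<open>r\<close> tending to 0 from the right.\<close>

abbreviation radial_deriv :: "(real \<Rightarrow> real) \<Rightarrow> real \<Rightarrow> real" where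
  "radial_deriv u \<equiv> weak_gradient {0<..} u"

text \<open>Weakly differentiable functions on the half-line are taken in their continuous (hence locally
  absolutely continuous) representative, so that their pointwise values make sense.\<close>

definition Ystar_rad :: "nat \<Rightarrow> real \<Rightarrow> real \<Rightarrow> (real \<Rightarrow> real) set" where
  "Ystar_rad d p q = {u.
     (\<forall>r>0. 0 \<le> u r) \<and>
     continuous_on {0<..} u \<and> weakly_differentiable_on {0<..} u \<and>
     (u \<longlongrightarrow> 1) (at_right 0) \<and>
     (AE r in lebesgue. 0 < r \<longrightarrow> radial_deriv u r \<le> 0) \<and>
     (\<lambda>r. (\<bar>u r\<bar> powr (q + 1) + \<bar>radial_deriv u r\<bar> powr p) * r ^ (d - 1))
       absolutely_integrable_on {0<..}}"

text \<open>The equation \<open>(\<bar>u'\<bar>\<^sup>p\<^sup>-\<^sup>2 u')' + ((d - 1) / r) \<bar>u'\<bar>\<^sup>p\<^sup>-\<^sup>2 u' = u\<^sup>q\<close> in the sense of distributions on \<open>I\<close>,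
  an open subset of the positive half-line. Note that \<open>0 powr a = 0\<close>, so \<open>\<bar>u'\<bar>\<^sup>p\<^sup>-\<^sup>2 u'\<close> is 0 where
  \<open>u' = 0\<close>, also when \<open>p < 2\<close>.\<close>

definition radial_ode_weak :: "nat \<Rightarrow> real \<Rightarrow> real \<Rightarrow> real set \<Rightarrow> (real \<Rightarrow> real) \<Rightarrow> bool" where
  "radial_ode_weak d p q I u \<longleftrightarrow>
     (let w = (\<lambda>r. \<bar>radial_deriv u r\<bar> powr (p - 2) * radial_deriv u r) in
      \<forall>\<phi>. test_function I \<phi> \<longrightarrow>
        - (LINT r:I|lebesgue. w r * deriv \<phi> r)
          + (LINT r:I|lebesgue. (real d - 1) / r * w r * \<phi> r)
        = (LINT r:I|lebesgue. u r powr q * \<phi> r))"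

definition solves_P :: "nat \<Rightarrow> real \<Rightarrow> real \<Rightarrow> (real \<Rightarrow> real) \<Rightarrow> bool" where
  "solves_P d p q u \<longleftrightarrow>
     radial_ode_weak d p q {0<..} u \<and>
     (u \<longlongrightarrow> 1) (at_right 0) \<and> (u \<longlongrightarrow> 0) at_top"

definition solves_FBP :: "nat \<Rightarrow> real \<Rightarrow> real \<Rightarrow> real \<Rightarrow> (real \<Rightarrow> real) \<Rightarrow> bool" where
  "solves_FBP d p q R u \<longleftrightarrow>
     0 < R \<and> (\<forall>r. 0 < r \<and> r < R \<longrightarrow> 0 < u r) \<and> (\<forall>r\<ge>R. u r = 0) \<and>
     radial_ode_weak d p q {0<..<R} u \<and>
     (u \<longlongrightarrow> 1) (at_right 0) \<and> u R = 0 \<and> (u has_real_derivative 0) (at_left R)"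


section \<open>The Thomas--Fermi type equations\<close>

definition radial :: "('a::euclidean_space \<Rightarrow> real) \<Rightarrow> bool" where
  "radial U \<longleftrightarrow> (\<exists>f. \<forall>x. U x = f (norm x))"

definition radial_nonincreasing :: "('a::euclidean_space \<Rightarrow> real) \<Rightarrow> bool" where
  "radial_nonincreasing U \<longleftrightarrow> radial U \<and> (\<forall>x y. x \<noteq> 0 \<and> norm x \<le> norm y \<longrightarrow> U y \<le> U x)"

definition TF_const :: "real \<Rightarrow> real \<Rightarrow> ('a::euclidean_space \<Rightarrow> real) \<Rightarrow> real" where
  "TF_const p q U =
     (LINT x|lebesgue. norm (weak_gradient UNIV U x) powr p) + (LINT x|lebesgue. \<bar>U x\<bar> powr (q + 1))"

definition TF_weak_on :: "real \<Rightarrow> real \<Rightarrow> 'a set \<Rightarrow> ('a::euclidean_space \<Rightarrow> real) \<Rightarrow> bool" where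
  "TF_weak_on p q S U \<longleftrightarrow>
     weakly_differentiable_on UNIV U \<and> in_Lp p (weak_gradient UNIV U) \<and> in_Lp (q + 1) U \<and>
     (\<forall>\<phi>. test_function S \<phi> \<and> radial \<phi> \<longrightarrow>
        (LINT x|lebesgue. grad \<phi> x \<bullet>
            (norm (weak_gradient UNIV U x) powr (p - 2) *\<^sub>R weak_gradient UNIV U x))
          + (LINT x|lebesgue. \<phi> x * U x powr q)
        = TF_const p q U * \<phi> 0)"

definition TF_solution :: "real \<Rightarrow> real \<Rightarrow> ('a::euclidean_space \<Rightarrow> real) \<Rightarrow> bool" where
  "TF_solution p q U \<longleftrightarrow>
     radial_nonincreasing U \<and> TF_weak_on p q UNIV U \<and>
     (U \<longlongrightarrow> 1) (at 0) \<and> (U \<longlongrightarrow> 0) at_infinity"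

text \<open>The normal derivative at a boundary point \<open>x\<close> of the ball is taken from inside, along the unit
  outward normal \<open>x /\<^sub>R R\<close>.\<close>

definition TF_ball_solution ::
    "real \<Rightarrow> real \<Rightarrow> real \<Rightarrow> ('a::euclidean_space \<Rightarrow> real) \<Rightarrow> bool" where
  "TF_ball_solution p q R U \<longleftrightarrow>
     0 < R \<and> (\<forall>x. x \<noteq> 0 \<and> norm x < R \<longrightarrow> 0 < U x) \<and> (\<forall>x. R \<le> norm x \<longrightarrow> U x = 0) \<and>
     radial_nonincreasing U \<and> TF_weak_on p q (ball 0 R) U \<and>
     (U \<longlongrightarrow> 1) (at 0) \<and>
     (\<forall>x. norm x = R \<longrightarrow> U x = 0 \<and>
        ((\<lambda>t. U (x + t *\<^sub>R (x /\<^sub>R R))) has_real_derivative 0) (at_left 0))"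

end

theory Submission
  imports Defs
begin

text \<open>
  Everything rests on the flux \<open>W = r\<^sup>d\<^sup>-\<^sup>1 |u'|\<^sup>p\<^sup>-\<^sup>2 u'\<close>. The radial equation says that \<open>W' = r\<^sup>d\<^sup>-\<^sup>1 u\<^sup>q\<close>, and by the
  lemma of du Bois-Reymond \<open>W\<close> is then absolutely continuous, non-positive and non-decreasing, so it
  has a finite limit \<open>W(0+)\<close>. Since \<open>(u W)' = r\<^sup>d\<^sup>-\<^sup>1 (|u'|\<^sup>p + u\<^sup>q\<^sup>+\<^sup>1)\<close> and \<open>u W\<close> vanishes at the right end,
  \<open>a = - \<sigma> W(0+)\<close>, where \<open>\<sigma>\<close> is the area of the unit sphere. Integrating \<open>(\<phi> W)'\<close> for a radial test
  function \<open>\<phi>\<close> produces exactly the boundary term \<open>a \<phi>(0)\<close>; conversely, test functions vanishing near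
  the origin give back the radial equation. For \<open>d = 1\<close> the first integral of the equation
  determines \<open>W(0+)\<close>.

  No polar coordinates are needed: the image under the norm of a measure \<open>v dx\<close> has a density on the
  half-line by the Radon--Nikodym theorem, and this density plays the role of the spherical means
  of \<open>v\<close>. It transfers weak derivatives between \<open>u(r)\<close> and \<open>u(|x|)\<close> in both directions.
\<close>

section \<open>Smooth functions and bumps\<close>


text \<open>Three features of the definitions shape the proof. A Bochner integral of a
  non-integrable function is 0, so splitting an integral or passing to a limit needs integrability
  first. The weak gradient is a choice, determined only up to null sets; it is exchanged for a Borel
  function \<open>g \<le> 0\<close>, and identities for it hold almost everywhere. The value
  \<open>u 0\<close> is arbitrary, so \<open>u\<close> is often cut off to the half-line
  (\<open>ut\<close>), and boundary values at 0 are limits.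

  Monotonicity tames the origin: \<open>u\<close> is bounded there and \<open>u'\<close> has a sign,
  hence \<open>u'\<close> is integrable up to 0; the source \<open>r^(d-1) u^q\<close> is bounded
  near 0, whence W(0+) is finite. At the right end the energy identity uses that \<open>W\<close>
  stays between W(0+) and 0 while \<open>u\<close> tends to 0. The first integral for
  \<open>d = 1\<close> needs \<open>W\<close> itself to tend to 0 there; otherwise \<open>u\<close>
  would decrease at least linearly, contradicting \<open>u \<ge> 0\<close> on the half-line and
  \<open>u'(R) = 0\<close> on a bounded interval. The constant is then \<open>2 |W(0+)|\<close>, as
  the unit sphere in dimension one has two points.\<close>

lemma Ck_SucI:
  assumes "\<And>x. (f has_derivative f' x) (at x)" and "\<And>b. b \<in> Basis \<Longrightarrow> Ck k (\<lambda>x. f' x b)"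
  shows "Ck (Suc k) f"
proof -
  have "frechet_derivative f (at x) = f' x" for x
    using frechet_derivative_at[OF assms(1)] by simp
  then show ?thesis
    using assms by (auto simp: differentiable_on_def differentiable_def intro: has_derivative_at_withinI)
qed

lemma Ck_SucD:
  assumes "Ck (Suc k) f"
  shows "(f has_derivative frechet_derivative f (at x)) (at x)"
    and "b \<in> Basis \<Longrightarrow> Ck k (\<lambda>x. frechet_derivative f (at x) b)"
  using assms by (auto simp: differentiable_on_def frechet_derivative_works)

lemma Ck_Suc_imp: "Ck (Suc k) f \<Longrightarrow> Ck k f"
proof (induction k arbitrary: f)
  case 0
  then show ?case
    by (auto simp: differentiable_imp_continuous_on)
next
  case (Suc k)
  then show ?case by auto
qed

lemma Ck_const: "Ck k (\<lambda>x. c)"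
  by (induction k arbitrary: c) (auto intro: Ck_SucI[where f' = "\<lambda>_ _. 0"])

lemma Ck_add: "Ck k f \<Longrightarrow> Ck k g \<Longrightarrow> Ck k (\<lambda>x. f x + g x)"
proof (induction k arbitrary: f g)
  case 0
  then show ?case by (auto intro: continuous_intros)
next
  case (Suc k)
  show ?case
    by (rule Ck_SucI[where f' = "\<lambda>x b. frechet_derivative f (at x) b + frechet_derivative g (at x) b"])
      (use Suc in \<open>auto intro!: has_derivative_add Ck_SucD(1)\<close>)
qed

lemma Ck_mult: "Ck k f \<Longrightarrow> Ck k g \<Longrightarrow> Ck k (\<lambda>x. f x * g x)"
proof (induction k arbitrary: f g)
  case 0
  then show ?case by (auto intro: continuous_intros)
next
  case (Suc k)
  have "Ck k f" "Ck k g" using Suc.prems Ck_Suc_imp by blast+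
  then show ?case
    by (intro Ck_SucI[where f' = "\<lambda>x b. f x * frechet_derivative g (at x) b + frechet_derivative f (at x) b * g x"])
      (use Suc in \<open>auto intro!: has_derivative_mult Ck_SucD(1) Ck_add\<close>)
qed

lemma Ck_cmult: "Ck k f \<Longrightarrow> Ck k (\<lambda>x. c * f x)"
  using Ck_mult[OF Ck_const] .

lemma Ck_prod: "finite A \<Longrightarrow> (\<And>i. i \<in> A \<Longrightarrow> Ck k (f i)) \<Longrightarrow> Ck k (\<lambda>x. \<Prod>i\<in>A. f i x)"
  by (induction A rule: finite_induct) (auto intro: Ck_const Ck_mult)

lemma Ck_affine: "Ck k (\<lambda>x. c * ((x - a) \<bullet> b))"
proof (cases k)
  case 0
  then show ?thesis by (auto intro!: continuous_intros)
next
  case (Suc n)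
  show ?thesis unfolding Suc
    by (rule Ck_SucI[where f' = "\<lambda>x h. c * (h \<bullet> b)"]) (auto intro!: derivative_eq_intros Ck_const)
qed

lemma Ck_inner: "Ck k (\<lambda>x. x \<bullet> b)"
  using Ck_affine[of k 1 0 b] by simp

text \<open>The induction generalises only \<open>f\<close>: the derivative of
  \<open>f (h x)\<close> is a partial derivative of \<open>h\<close> times \<open>f'\<close>
  composed with the same \<open>h\<close>.\<close>

lemma Ck_compose: 
  fixes f :: "real \<Rightarrow> real"
  shows "Ck k f \<Longrightarrow> Ck k h \<Longrightarrow> Ck k (\<lambda>x. f (h x))"
proof (induction k arbitrary: f)
  case 0
  then show ?case by (auto intro: continuous_on_compose2)
next
  case (Suc k)
  have lin: "frechet_derivative f (at y) t = t * frechet_derivative f (at y) 1" for y t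
    using linear_cmul[OF has_derivative_linear[OF Ck_SucD(1)[OF Suc.prems(1)]], of y t 1] by simp
  have "Ck k h" using Suc.prems Ck_Suc_imp by blast
  show ?case
  proof (rule Ck_SucI)
    show "((\<lambda>x. f (h x)) has_derivative
        (\<lambda>b. frechet_derivative h (at x) b * frechet_derivative f (at (h x)) 1)) (at x)" for x
      using has_derivative_compose[OF Ck_SucD(1)[OF Suc.prems(2)] Ck_SucD(1)[OF Suc.prems(1)], of x]
      unfolding lin[of "h x" "frechet_derivative h (at x) b" for b] .
    show "Ck k (\<lambda>x. frechet_derivative h (at x) b * frechet_derivative f (at (h x)) 1)"
      if "b \<in> Basis" for b
      using Ck_SucD(2)[OF Suc.prems(1), of 1] Ck_SucD(2)[OF Suc.prems(2) that] \<open>Ck k h\<close>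
      by (intro Ck_mult Suc.IH[of "\<lambda>y. frechet_derivative f (at y) 1"]) simp_all
  qed
qed

lemma Ck_real_SucI:
  fixes f :: "real \<Rightarrow> real"
  assumes "\<And>x. (f has_real_derivative f' x) (at x)" and "Ck k f'"
  shows "Ck (Suc k) f"
  by (rule Ck_SucI[where f' = "\<lambda>x h. f' x * h"]) (use assms in \<open>auto simp: has_field_derivative_def\<close>)

lemma Ck_real_SucD:
  fixes f :: "real \<Rightarrow> real"
  assumes "Ck (Suc k) f"
  shows "(f has_real_derivative deriv f x) (at x)" "Ck k (deriv f)"
    and "frechet_derivative f (at x) h = deriv f x * h"
proof -
  have *: "f differentiable (at x)" for x
    using Ck_SucD(1)[OF assms] by (auto simp: differentiable_def)
  then show D: "(f has_real_derivative deriv f x) (at x)" for x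
    by (simp add: DERIV_deriv_iff_real_differentiable)
  then show eq: "frechet_derivative f (at x) h = deriv f x * h" for x h
    by (metis frechet_derivative_at has_field_derivative_def)
  have "Ck k (\<lambda>x. frechet_derivative f (at x) 1)"
    using Ck_SucD(2)[OF assms, of 1] by simp
  moreover have "(\<lambda>x. frechet_derivative f (at x) 1) = deriv f" using eq by auto
  ultimately show "Ck k (deriv f)" by simp
qed

text \<open>\<open>flat 0\<close> is the classical smooth function \<open>exp (- 1 / t)\<close> that
  is flat at 0. The powers of \<open>1 / t\<close> are included because the linear span of the
  family is then closed under differentiation.\<close>

definition flat :: "nat \<Rightarrow> real \<Rightarrow> real" where
  "flat m t = (if 0 < t then (1 / t) ^ m * exp (- (1 / t)) else 0)"

lemma flat_tendsto: "((\<lambda>t. flat m t) \<longlongrightarrow> 0) (at 0)"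
proof -
  have "((\<lambda>t::real. (1 / t) ^ m * exp (- (1 / t))) \<longlongrightarrow> 0) (at_right 0)"
  proof -
    have "((\<lambda>s::real. s ^ m * exp (- s)) \<longlongrightarrow> 0) at_top"
      using tendsto_power_div_exp_0[of m] by (simp add: exp_minus field_simps)
    from filterlim_compose[OF this, of "\<lambda>t. 1 / t" "at_right 0"] show ?thesis
      using filterlim_inverse_at_top_right by (simp add: inverse_eq_divide)
  qed
  then have "((\<lambda>t. flat m t) \<longlongrightarrow> 0) (at_right 0)"
    by (rule Lim_transform_eventually) (auto simp: flat_def eventually_at_filter)
  moreover have "((\<lambda>t. flat m t) \<longlongrightarrow> 0) (at_left 0)"
    by (rule Lim_transform_eventually[where f = "\<lambda>_. 0"]) (auto simp: flat_def eventually_at_filter)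
  ultimately show ?thesis by (simp add: filterlim_at_split)
qed

lemma flat_deriv: "(flat m has_real_derivative (flat (m + 2) t - m * flat (m + 1) t)) (at t)"
proof -
  consider "t < 0" | "t = 0" | "t > 0" by linarith
  then show ?thesis
  proof cases
    case 1
    have "((\<lambda>_. 0) has_real_derivative 0) (at t)" by simp
    then have "(flat m has_real_derivative 0) (at t)"
      by (rule has_field_derivative_transform_within_open[of _ _ _ "{..<0}"]) (use 1 in \<open>auto simp: flat_def\<close>)
    then show ?thesis using 1 by (simp add: flat_def)
  next
    case 2
    \<comment> \<open>The difference quotient of \<open>flat m\<close> at 0 is
      \<open>flat (Suc m)\<close>, so its limit is already known.\<close>
    have "((\<lambda>h. flat (Suc m) h) \<longlongrightarrow> 0) (at 0)" by (rule flat_tendsto)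
    then have "((\<lambda>h. flat m h / h) \<longlongrightarrow> 0) (at 0)"
      by (rule Lim_transform_eventually) (auto simp: flat_def eventually_at_filter)
    then show ?thesis using 2 by (simp add: has_field_derivative_iff flat_def)
  next
    case 3
    have "((\<lambda>t. (1 / t) ^ m * exp (- (1 / t))) has_real_derivative (flat (m + 2) t - m * flat (m + 1) t)) (at t)"
    proof -
      have D: "((\<lambda>t. 1 / t) has_real_derivative - ((1 / t) * (1 / t))) (at t)"
        using 3 by (auto intro!: derivative_eq_intros)
      have E: "((\<lambda>t. exp (- (1 / t))) has_real_derivative exp (- (1 / t)) * - (- ((1 / t) * (1 / t)))) (at t)"
        by (intro DERIV_fun_exp DERIV_minus D)
      \<comment> \<open>The power rule leaves a truncated subtraction; for \<open>m = 0\<close> the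
        factor \<open>real m\<close> makes both sides vanish.\<close>
      have "real m * (1 / t) ^ (m - Suc 0) * ((1 / t) * (1 / t)) = real m * (1 / t) ^ (m + 1)"
        by (cases m) simp_all
      then show ?thesis
        using 3 by (intro DERIV_mult[OF DERIV_power[OF D] E, THEN DERIV_cong])
          (simp add: flat_def power_add power2_eq_square algebra_simps)
    qed
    then show ?thesis
      by (rule has_field_derivative_transform_within_open[of _ _ _ "{0<..}"]) (use 3 in \<open>auto simp: flat_def\<close>)
  qed
qed

lemma Ck_flat: "Ck k (flat m)"
proof (induction k arbitrary: m)
  case 0
  show ?case using flat_deriv[THEN DERIV_isCont] by (auto simp: continuous_on_eq_continuous_at)
next
  case (Suc k)
  have "Ck k (\<lambda>t. flat (m + 2) t + (- m) * flat (m + 1) t)"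
    by (intro Ck_add Ck_cmult Suc)
  then show ?case
    by (intro Ck_real_SucI[OF flat_deriv]) simp
qed

text \<open>One enclosing compact interval, instead of a compact support, provides endpoints for
  integration by parts. On non-empty intervals the notion coincides with
  \<open>test_function\<close>, see \<open>test_function_iff_test_on\<close>.\<close>

definition test_on :: "real set \<Rightarrow> (real \<Rightarrow> real) \<Rightarrow> bool" where
  "test_on I f \<longleftrightarrow> (\<forall>k. Ck k f) \<and> (\<exists>a b. a \<le> b \<and> {a..b} \<subseteq> I \<and> (\<forall>x. x \<notin> {a..b} \<longrightarrow> f x = 0))"

lemma test_functionI:
  assumes "\<And>k. Ck k \<phi>" "\<And>x. x \<notin> K \<Longrightarrow> \<phi> x = 0" "compact K" "K \<subseteq> S"
  shows "test_function S \<phi>"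
proof -
  have "closure (support_on UNIV \<phi>) \<subseteq> K"
    using assms by (intro closure_minimal compact_imp_closed) (auto simp: support_on_def)
  then show ?thesis using assms
    by (auto simp: test_function_def intro: compact_closure[THEN iffD2] bounded_subset compact_imp_bounded closure_subset)
     (meson bounded_subset closure_subset compact_imp_bounded subset_trans)
qed

lemma test_functionE:
  assumes "test_function S \<phi>"
  obtains K where "compact K" "K \<subseteq> S" "\<And>x. x \<notin> K \<Longrightarrow> \<phi> x = 0"
proof
  show "compact (closure (support_on UNIV \<phi>))" "closure (support_on UNIV \<phi>) \<subseteq> S"
    using assms by (auto simp: test_function_def)
  show "\<phi> x = 0" if "x \<notin> closure (support_on UNIV \<phi>)" for x
    using that closure_subset[of "support_on UNIV \<phi>"] by (auto simp: support_on_def)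
qed

lemma test_function_iff_test_on:
  fixes I :: "real set"
  assumes "is_interval I" "I \<noteq> {}"
  shows "test_function I \<phi> \<longleftrightarrow> test_on I \<phi>"
proof
  assume t: "test_function I \<phi>"
  obtain K where K: "compact K" "K \<subseteq> I" "\<And>x. x \<notin> K \<Longrightarrow> \<phi> x = 0"
    using test_functionE[OF t] by metis
  have "\<exists>a b. a \<le> b \<and> {a..b} \<subseteq> I \<and> K \<subseteq> {a..b}"
  proof (cases "K = {}")
    case True
    then show ?thesis using assms(2) by (metis atLeastAtMost_singleton empty_subsetI equals0I insert_subset order_refl)
  next
    case False
    obtain a where a: "a \<in> K" "\<And>x. x \<in> K \<Longrightarrow> a \<le> x" using compact_attains_inf[OF K(1) False] by blast
    obtain b where b: "b \<in> K" "\<And>x. x \<in> K \<Longrightarrow> x \<le> b" using compact_attains_sup[OF K(1) False] by blast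
    have "a \<in> I" "b \<in> I" using a(1) b(1) K(2) by auto
    then have "{a..b} \<subseteq> I"
      using assms(1) by (meson atLeastAtMost_iff is_interval_1 subsetI)
    moreover have "K \<subseteq> {a..b}" "a \<le> b" using a b by auto
    ultimately show ?thesis by blast
  qed
  then show "test_on I \<phi>"
    using t K(3) unfolding test_on_def test_function_def by (metis subsetD)
next
  assume "test_on I \<phi>"
  then show "test_function I \<phi>"
    unfolding test_on_def by (metis compact_Icc test_functionI)
qed

lemma test_on_deriv:
  assumes "test_on I f"
  shows "(f has_real_derivative deriv f x) (at x)" "test_on I (deriv f)"
    "continuous_on S f" "continuous_on S (deriv f)"
proof -
  have Ck: "Ck k f" for k using assms by (auto simp: test_on_def)
  show D: "(f has_real_derivative deriv f x) (at x)" for x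
    using Ck Ck_real_SucD(1) by blast
  obtain a b where ab: "a \<le> b" "{a..b} \<subseteq> I" "\<forall>x. x \<notin> {a..b} \<longrightarrow> f x = 0"
    using assms by (auto simp: test_on_def)
  have "deriv f x = 0" if "x \<notin> {a..b}" for x
  proof -
    have "((\<lambda>_. 0) has_real_derivative 0) (at x)" by simp
    then have "(f has_real_derivative 0) (at x)"
      by (rule has_field_derivative_transform_within_open[of _ _ _ "- {a..b}"]) (use that ab in auto)
    then show ?thesis by (simp add: DERIV_imp_deriv)
  qed
  with ab Ck Ck_real_SucD(2) show "test_on I (deriv f)"
    unfolding test_on_def by blast
  show "continuous_on S f" "continuous_on S (deriv f)"
    using Ck[of 0] Ck_real_SucD(2)[OF Ck, of 0] by (auto intro: continuous_on_subset)
qed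

text \<open>By continuity the function vanishes at the endpoints \<open>a\<close> and
  \<open>b\<close> as well; this kills the boundary terms in integrations by parts.\<close>

lemma test_onE:
  assumes "test_on I f"
  obtains a b where "a \<le> b" "{a..b} \<subseteq> I" "\<And>x. x \<notin> {a<..<b} \<Longrightarrow> f x = 0"
    "\<And>x. x \<notin> {a..b} \<Longrightarrow> f x = 0"
proof -
  obtain a b where ab: "a \<le> b" "{a..b} \<subseteq> I" "\<And>x. x \<notin> {a..b} \<Longrightarrow> f x = 0"
    using assms by (auto simp: test_on_def)
  have c: "isCont f x" for x using test_on_deriv(1)[OF assms] DERIV_isCont by blast
  have "(f \<longlongrightarrow> f a) (at_left a)" "(f \<longlongrightarrow> f b) (at_right b)"
    using c[of a] c[of b] by (auto simp: isCont_def filterlim_at_split)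
  from this[THEN Lim_transform_eventually, of "\<lambda>_. 0"]
  have "((\<lambda>_. 0) \<longlongrightarrow> f a) (at_left a)" "((\<lambda>_. 0) \<longlongrightarrow> f b) (at_right b)"
    using ab by (auto simp: eventually_at_filter)
  then have "f a = 0" "f b = 0"
    by (simp_all add: tendsto_const_iff)
  with ab have "f x = 0" if "x \<notin> {a<..<b}" for x
    using that by (cases "x = a \<or> x = b") auto
  with ab that show ?thesis by blast
qed

lemma test_on_subset: "test_on I f \<Longrightarrow> I \<subseteq> J \<Longrightarrow> test_on J f"
  unfolding test_on_def by (meson subset_trans)

text \<open>The support keeps away from 0, where the power may be singular. The induction treats all
  \<open>f\<close> and \<open>m\<close> together, since the derivative is a combination of two
  functions of the same form.\<close>

lemma test_on_powr:
  assumes "test_on I f" "I \<subseteq> {0<..}"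
  shows "test_on I (\<lambda>r. f r * r powr m)"
proof -
  have "Ck k (\<lambda>r. f r * r powr m)" if "test_on I f" for k f m
    using that
  proof (induction k arbitrary: f m)
    case (0 f m)
    obtain a b where ab: "a \<le> b" "{a..b} \<subseteq> I" "\<And>x. x \<notin> {a<..<b} \<Longrightarrow> f x = 0"
      using test_onE[OF 0] by metis
    have "0 < a" using ab assms(2) by fastforce
    have "continuous_on ({a/2..} \<union> {..a}) (\<lambda>r. f r * r powr m)"
    proof (rule continuous_on_closed_Un)
      show "continuous_on {a/2..} (\<lambda>r. f r * r powr m)"
        using \<open>0 < a\<close> by (intro continuous_intros test_on_deriv[OF 0]) auto
      have "\<And>x. x \<in> {..a} \<Longrightarrow> f x * x powr m = 0" using ab by force
      then show "continuous_on {..a} (\<lambda>r. f r * r powr m)"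
        by (metis (mono_tags, lifting) continuous_on_cong continuous_on_const)
    qed auto
    moreover have "{a/2..} \<union> {..a} = UNIV" using \<open>0 < a\<close> by auto
    ultimately show ?case by simp
  next
    case (Suc k f m)
    obtain a b where ab: "a \<le> b" "{a..b} \<subseteq> I" "\<forall>x. x \<notin> {a..b} \<longrightarrow> f x = 0"
      using Suc by (auto simp: test_on_def)
    have "0 < a" using ab assms(2) by fastforce
    have d0: "deriv f x = 0" if "x < a" for x
    proof -
      have "((\<lambda>_. 0) has_real_derivative 0) (at x)" by simp
      then have "(f has_real_derivative 0) (at x)"
        by (rule has_field_derivative_transform_within_open[of _ _ _ "{..<a}"]) (use that ab in auto)
      then show ?thesis by (simp add: DERIV_imp_deriv)
    qed
    show ?case
    proof (rule Ck_real_SucI)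
      show "((\<lambda>r. f r * r powr m) has_real_derivative
          deriv f x * x powr m + m * (f x * x powr (m - 1))) (at x)" for x
      proof (cases "x < a")
        case True
        have "((\<lambda>_. 0) has_real_derivative 0) (at x)" by simp
        then have "((\<lambda>r. f r * r powr m) has_real_derivative 0) (at x)"
          by (rule has_field_derivative_transform_within_open[of _ _ _ "{..<a}"]) (use True ab in auto)
        then show ?thesis using True d0 ab by simp
      next
        case False
        then show ?thesis using \<open>0 < a\<close>
          by (auto intro!: derivative_eq_intros test_on_deriv[OF Suc.prems] simp: powr_diff)
      qed
      show "Ck k (\<lambda>x. deriv f x * x powr m + m * (f x * x powr (m - 1)))"
        by (intro Ck_add Ck_cmult Suc.IH Suc.prems test_on_deriv)
    qed
  qed
  moreover obtain a b where "a \<le> b" "{a..b} \<subseteq> I" "\<And>x. x \<notin> {a..b} \<Longrightarrow> f x * x powr m = 0"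
    using assms(1) by (auto simp: test_on_def)
  ultimately show ?thesis using assms(1) unfolding test_on_def by blast
qed

lemma test_on_mult:
  assumes "test_on I f" "\<And>k. Ck k g"
  shows "test_on I (\<lambda>r. g r * f r)"
proof -
  obtain a b where "a \<le> b" "{a..b} \<subseteq> I" "\<And>x. x \<notin> {a..b} \<Longrightarrow> g x * f x = 0"
    using assms(1) by (auto simp: test_on_def)
  moreover have "Ck k (\<lambda>r. g r * f r)" for k
    using assms by (auto simp: test_on_def intro: Ck_mult)
  ultimately show ?thesis unfolding test_on_def by blast
qed

text \<open>The quotient is written as \<open>norm x powr (-1)\<close>, which is 0 at the origin;
  there \<open>f (norm x)\<close> vanishes in a whole neighbourhood. In this form each partial
  derivative is a coordinate times a function \<open>f1 (norm x)\<close> with \<open>f1\<close>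
  again a test function, which is what the induction in \<open>Ck_radial\<close> needs.\<close>

lemma has_derivative_radial:
  fixes x :: "'a::euclidean_space"
  assumes "test_on {0<..} f"
  shows "((\<lambda>x. f (norm x)) has_derivative (\<lambda>h. deriv f (norm x) * norm x powr (-1) * (h \<bullet> x))) (at x)"
proof (cases "x = 0")
  case True
  obtain a b where ab: "a \<le> b" "{a..b} \<subseteq> {0<..}" "\<forall>x. x \<notin> {a..b} \<longrightarrow> f x = 0"
    using assms by (auto simp: test_on_def)
  have "0 < a" using ab by fastforce
  have "((\<lambda>_. 0) has_derivative (\<lambda>_. 0)) (at x)" by simp
  then have "((\<lambda>x. f (norm x)) has_derivative (\<lambda>_. 0)) (at x)"
    by (rule has_derivative_transform_within_open[of _ _ _ _ "ball 0 a"]) (use True \<open>0 < a\<close> ab in auto)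
  then show ?thesis using True by simp
next
  case False
  have "((\<lambda>x. f (norm x)) has_derivative (\<lambda>h. deriv f (norm x) * (sgn x \<bullet> h))) (at x)"
    using has_derivative_compose[OF has_derivative_norm[OF False], of f "(*) (deriv f (norm x))"]
      test_on_deriv(1)[OF assms, of "norm x"]
    by (simp add: has_field_derivative_def inner_commute)
  moreover have "deriv f (norm x) * (sgn x \<bullet> h) = deriv f (norm x) * norm x powr (-1) * (h \<bullet> x)" for h
    using False by (simp add: sgn_div_norm powr_minus inner_commute)
  ultimately show ?thesis by simp
qed

lemma Ck_radial: "test_on {0<..} f \<Longrightarrow> Ck k (\<lambda>x::'a::euclidean_space. f (norm x))"
proof (induction k arbitrary: f)
  case 0
  show ?case
    using continuous_on_compose2[OF test_on_deriv(3)[OF 0, of UNIV] continuous_on_norm_id] by simp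
next
  case (Suc k)
  have "test_on {0<..} (\<lambda>r. deriv f r * r powr - 1)"
    by (intro test_on_powr test_on_deriv(2)[OF Suc.prems]) simp
  from Suc.IH[OF this]
  have "Ck k (\<lambda>x. deriv f (norm x) * norm x powr - 1 * (b \<bullet> x))" for b :: 'a
    unfolding inner_commute[of b] by (rule Ck_mult[OF _ Ck_inner])
  then show ?case
    by (rule Ck_SucI[OF has_derivative_radial[OF Suc.prems]])
qed

text \<open>The smooth factor \<open>g\<close> is later a constant, a coordinate, or another test
  function: these give radial test functions, components of radial vector fields, and localised test
  functions.\<close>

lemma test_function_radial:
  assumes "test_on I f" "I \<subseteq> {0<..}" "\<And>x. norm x \<in> I \<Longrightarrow> x \<in> S" "\<And>k. Ck k g"
  shows "test_function S (\<lambda>x::'a::euclidean_space. g x * f (norm x))"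
proof -
  obtain a b where ab: "a \<le> b" "{a..b} \<subseteq> I" "\<forall>x. x \<notin> {a..b} \<longrightarrow> f x = 0"
    using assms by (auto simp: test_on_def)
  have "compact {x::'a. norm x \<in> {a..b}}"
  proof -
    have "{x::'a. norm x \<in> {a..b}} = cball 0 b - ball 0 a" by auto
    then show ?thesis by (simp add: compact_diff)
  qed
  moreover have "Ck k (\<lambda>x::'a. g x * f (norm x))" for k
    using assms by (intro Ck_mult Ck_radial) (auto intro: test_on_subset)
  ultimately show ?thesis
    by (intro test_functionI[where K = "{x. norm x \<in> {a..b}}"]) (use ab assms(3) in auto)
qed

section \<open>The fundamental lemma of the calculus of variations\<close>


lemma flat_scaled_tendsto: "(\<lambda>n. flat 0 (real n * t)) \<longlonglongrightarrow> (if 0 < t then 1 else 0)"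
proof (cases "0 < t")
  case True
  have "(\<lambda>n. - (inverse t * inverse (real n))) \<longlonglongrightarrow> - (inverse t * 0)"
    by (intro tendsto_intros lim_inverse_n)
  then have "(\<lambda>n. exp (- (inverse t * inverse (real n)))) \<longlonglongrightarrow> exp (- (inverse t * 0))"
    by (rule tendsto_exp)
  then have "(\<lambda>n. exp (- (inverse t * inverse (real n)))) \<longlonglongrightarrow> 1" by simp
  then have "(\<lambda>n. flat 0 (real n * t)) \<longlonglongrightarrow> 1"
    by (rule Lim_transform_eventually)
      (use True in \<open>auto simp: flat_def eventually_sequentially field_simps intro!: exI[of _ 1]\<close>)
  then show ?thesis using True by simp
next
  case False
  then have "flat 0 (real n * t) = 0" for n
    by (auto simp: flat_def zero_less_mult_iff)
  then show ?thesis using False by simp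
qed

lemma flat_bounds: "0 \<le> flat 0 t" "flat 0 t \<le> 1"
  by (auto simp: flat_def)

text \<open>A product over the coordinates of \<open>flat 0 (n (x - a)) flat 0 (n (c - x))\<close>.
  The uniform bound 1 and the pointwise limit are tailored to dominated convergence, which turns
  test integrals into integrals over boxes.\<close>

lemma bump_sequence:
  fixes a c :: "'a::euclidean_space"
  obtains \<phi> :: "nat \<Rightarrow> 'a \<Rightarrow> real"
  where "\<And>n k. Ck k (\<phi> n)" "\<And>n x. 0 \<le> \<phi> n x" "\<And>n x. \<phi> n x \<le> 1"
    "\<And>n x. x \<notin> box a c \<Longrightarrow> \<phi> n x = 0" "\<And>x. (\<lambda>n. \<phi> n x) \<longlonglongrightarrow> indicator (box a c) x"
proof
  define \<phi> where "\<phi> = (\<lambda>n x. \<Prod>b\<in>Basis. flat 0 (real n * ((x - a) \<bullet> b)) * flat 0 ((- real n) * ((x - c) \<bullet> b)))"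
  show "Ck k (\<phi> n)" for k n
    unfolding \<phi>_def by (intro Ck_prod Ck_mult Ck_compose[OF Ck_flat] Ck_affine) simp
  show "0 \<le> \<phi> n x" for n x
    unfolding \<phi>_def by (intro prod_nonneg mult_nonneg_nonneg flat_bounds)
  show "\<phi> n x \<le> 1" for n x
    unfolding \<phi>_def by (intro prod_le_1 conjI mult_nonneg_nonneg mult_le_one flat_bounds)
  have \<phi>': "\<phi> n x = (\<Prod>b\<in>Basis. flat 0 (real n * ((x - a) \<bullet> b)) * flat 0 (real n * ((c - x) \<bullet> b)))" for n x
    unfolding \<phi>_def by (simp add: inner_diff_left algebra_simps)
  have lim: "(\<lambda>n. \<phi> n x) \<longlonglongrightarrow> (\<Prod>b\<in>Basis. (if 0 < (x - a) \<bullet> b then 1 else 0) * (if 0 < (c - x) \<bullet> b then 1 else 0))" for x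
    unfolding \<phi>' by (intro tendsto_prod tendsto_mult flat_scaled_tendsto)
  have ind: "(\<Prod>b\<in>Basis. (if 0 < (x - a) \<bullet> b then 1 else 0) * (if 0 < (c - x) \<bullet> b then 1 else 0)) = (indicator (box a c) x :: real)" for x
  proof (cases "x \<in> box a c")
    case True
    then show ?thesis by (simp add: mem_box inner_diff_left)
  next
    case False
    then obtain b where "b \<in> Basis" "\<not> (0 < (x - a) \<bullet> b \<and> 0 < (c - x) \<bullet> b)"
      by (auto simp: mem_box inner_diff_left)
    then show ?thesis using False by (subst prod_zero) auto
  qed
  show "(\<lambda>n. \<phi> n x) \<longlonglongrightarrow> indicator (box a c) x" for x
    using lim[of x] unfolding ind .
  show "\<phi> n x = 0" if "x \<notin> box a c" for n x
  proof -
    obtain b where "b \<in> Basis" "\<not> (0 < (x - a) \<bullet> b \<and> 0 < (c - x) \<bullet> b)"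
      using \<open>x \<notin> box a c\<close> by (auto simp: mem_box inner_diff_left)
    then have "flat 0 (real n * ((x - a) \<bullet> b)) * flat 0 (real n * ((c - x) \<bullet> b)) = 0"
      by (auto simp: flat_def zero_less_mult_iff)
    then show ?thesis unfolding \<phi>' using \<open>b \<in> Basis\<close> by (metis (no_types, lifting) finite_Basis prod_zero)
  qed
qed

lemma set_lebesgue_restrict:
  assumes "K \<subseteq> S" "\<And>x. x \<notin> K \<Longrightarrow> f x = 0"
  shows "set_integrable M S f \<longleftrightarrow> set_integrable M K f"
    and "(LINT x:S|M. f x) = (LINT x:K|M. f x)"
    and "integrable M f \<longleftrightarrow> set_integrable M K f"
    and "(LINT x|M. f x) = (LINT x:K|M. f x)"
proof -
  have S: "(\<lambda>x. indicator S x *\<^sub>R f x) = f" and K: "(\<lambda>x. indicator K x *\<^sub>R f x) = f"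
    using assms by (auto simp: indicator_def fun_eq_iff)
  show "set_integrable M S f \<longleftrightarrow> set_integrable M K f"
    "(LINT x:S|M. f x) = (LINT x:K|M. f x)" "integrable M f \<longleftrightarrow> set_integrable M K f"
    "(LINT x|M. f x) = (LINT x:K|M. f x)"
    unfolding set_integrable_def set_lebesgue_integral_def S K by (rule refl)+
qed

lemma set_integrable_continuous_mult:
  fixes h :: "'a::euclidean_space \<Rightarrow> 'b::euclidean_space" and \<phi> :: "'a \<Rightarrow> real"
  assumes "h absolutely_integrable_on K" "compact K" "continuous_on K \<phi>"
  shows "(\<lambda>x. \<phi> x *\<^sub>R h x) absolutely_integrable_on K"
proof -
  have "K \<in> sets borel" using assms(2) by (simp add: borel_compact)
  then have K: "K \<in> sets lebesgue" by simp
  have "bilinear (\<lambda>(a::real) (b::'b). a *\<^sub>R b)"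
    by (auto simp: bilinear_def intro!: linearI simp: algebra_simps)
  then show ?thesis
    by (rule absolutely_integrable_bounded_measurable_product)
      (use assms K in \<open>auto intro: continuous_imp_measurable_on_sets_lebesgue
        compact_continuous_image compact_imp_bounded\<close>)
qed

lemma set_integrable_test_mult:
  fixes h :: "'a::euclidean_space \<Rightarrow> 'b::euclidean_space" and \<phi> :: "'a \<Rightarrow> real"
  assumes "locally_integrable_on S h" "compact K" "K \<subseteq> S" "\<And>x. x \<notin> K \<Longrightarrow> \<phi> x = 0" "continuous_on K \<phi>"
  shows "set_integrable lebesgue S (\<lambda>x. \<phi> x *\<^sub>R h x)"
  using set_integrable_continuous_mult[where h = h and K = K and \<phi> = \<phi>] set_lebesgue_restrict(1)[of K S "\<lambda>x. \<phi> x *\<^sub>R h x" lebesgue] assms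
  by (auto simp: locally_integrable_on_def)

lemma borel_measurable_lebesgueI: "f \<in> borel_measurable borel \<Longrightarrow> f \<in> borel_measurable lebesgue"
  by (simp add: measurable_completion)

lemma AE_negligible: "negligible N \<Longrightarrow> (\<And>x. x \<notin> N \<Longrightarrow> P x) \<Longrightarrow> AE x in lebesgue. P x"
  using AE_not_in[of N lebesgue] by (auto simp: negligible_iff_null_sets)

lemma AE_nonzero: "AE x::'a::euclidean_space in lebesgue. x \<noteq> 0"
  using AE_lborel_singleton[of 0] by (rule AE_completion)

text \<open>The smooth bumps converge to the indicator function of a box, so all integrals of \<open>h\<close> over
  boxes vanish; Lebesgue differentiation along boxes then gives \<open>h = 0\<close>.\<close>

lemma AE_zero_if_test_integrals_zero:
  fixes h :: "'a::euclidean_space \<Rightarrow> real"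
  assumes "open S" and loc: "locally_integrable_on S h"
    and test: "\<And>\<phi>. test_function S \<phi> \<Longrightarrow> (LINT x:S|lebesgue. \<phi> x * h x) = 0"
  shows "AE x in lebesgue. x \<in> S \<longrightarrow> h x = 0"
proof -
  have int0: "integral (cbox a c) h = 0" if sub: "cbox a c \<subseteq> S" for a c
  proof -
    obtain \<phi> :: "nat \<Rightarrow> 'a \<Rightarrow> real" where \<phi>: "\<And>n k. Ck k (\<phi> n)" "\<And>n x. 0 \<le> \<phi> n x" "\<And>n x. \<phi> n x \<le> 1"
        "\<And>n x. x \<notin> box a c \<Longrightarrow> \<phi> n x = 0" "\<And>x. (\<lambda>n. \<phi> n x) \<longlonglongrightarrow> indicator (box a c) x"
      using bump_sequence[of a c] by metis
    have \<phi>0: "x \<notin> cbox a c \<Longrightarrow> \<phi> n x = 0" for n x using \<phi>(4) box_subset_cbox by blast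
    have h: "h absolutely_integrable_on cbox a c"
      using loc sub by (auto simp: locally_integrable_on_def)
    define H where "H x = indicator (cbox a c) x *\<^sub>R h x" for x
    have H: "integrable lebesgue H" using h by (simp add: H_def[abs_def] set_integrable_def)
    have z: "(LINT x|lebesgue. \<phi> n x * H x) = 0" for n
    proof -
      have "test_function S (\<phi> n)"
        using \<phi>0 \<phi>(1) sub by (intro test_functionI[where K = "cbox a c"]) auto
      from test[OF this] have "(LINT x:S|lebesgue. \<phi> n x * h x) = 0" .
      moreover have "indicator S x *\<^sub>R (\<phi> n x * h x) = \<phi> n x * H x" for x
        using \<phi>0[of x n] sub by (auto simp: indicator_def H_def)
      ultimately show ?thesis by (simp only: set_lebesgue_integral_def)
    qed
    have "(\<lambda>n. LINT x|lebesgue. \<phi> n x * H x) \<longlonglongrightarrow> (LINT x|lebesgue. H x)"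
    proof (rule integral_dominated_convergence[where w = "\<lambda>x. \<bar>H x\<bar>"])
      have "\<phi> n \<in> borel_measurable lebesgue" for n
        using \<phi>(1)[of 0 n] by (intro borel_measurable_lebesgueI borel_measurable_continuous_onI) simp
      then show "(\<lambda>x. \<phi> n x * H x) \<in> borel_measurable lebesgue" for n
        using H by (intro borel_measurable_times) auto
      show "AE x in lebesgue. (\<lambda>n. \<phi> n x * H x) \<longlonglongrightarrow> H x"
      proof (rule AE_negligible[OF negligible_frontier_interval])
        fix x assume x: "x \<notin> cbox a c - box a c"
        show "(\<lambda>n. \<phi> n x * H x) \<longlonglongrightarrow> H x"
        proof (cases "x \<in> box a c")
          case True
          then have "(\<lambda>n. \<phi> n x) \<longlonglongrightarrow> 1" using \<phi>(5)[of x] by simp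
          from tendsto_mult_right[OF this, of "H x"] show ?thesis by (simp add: mult.commute)
        qed (use x in \<open>auto simp: H_def\<close>)
      qed
      show "AE x in lebesgue. norm (\<phi> n x * H x) \<le> \<bar>H x\<bar>" for n
        using \<phi>(2)[of n] \<phi>(3)[of n] by (intro AE_I2) (auto simp: abs_mult intro: mult_left_le_one_le)
    qed (use H in auto)
    then have "(LINT x|lebesgue. H x) = 0" unfolding z by (simp add: LIMSEQ_const_iff)
    then show ?thesis
      using set_lebesgue_integral_eq_integral(2)[OF h] by (simp add: set_lebesgue_integral_def H_def)
  qed
  have box: "AE x in lebesgue. x \<in> cbox a c \<longrightarrow> h x = 0" if sub: "cbox a c \<subseteq> S" for a c
  proof -
    define f where "f x = (if x \<in> cbox a c then h x else 0)" for x
    have "h absolutely_integrable_on cbox a c"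
      using loc sub by (auto simp: locally_integrable_on_def)
    then have "h integrable_on cbox a c" by (rule set_lebesgue_integral_eq_integral)
    then have "f integrable_on UNIV" unfolding f_def by (simp add: integrable_restrict_UNIV)
    then have "\<And>u v. f integrable_on cbox u v" using integrable_on_subcbox by blast
    then obtain N where N: "negligible N"
      and lim: "\<And>x e. \<lbrakk>x \<notin> N; 0 < e\<rbrakk> \<Longrightarrow> \<exists>d>0. \<forall>t. 0 < t \<and> t < d \<longrightarrow>
          norm (integral (cbox x (x + t *\<^sub>R One)) f /\<^sub>R t ^ DIM('a) - f x) < e"
      using integrable_ccontinuous_explicit[of f] by metis
    have "negligible (N \<union> (cbox a c - box a c))"
      using N negligible_frontier_interval by (intro negligible_Un) auto
    then show ?thesis
    proof (rule AE_negligible, intro impI)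
      fix x assume "x \<notin> N \<union> (cbox a c - box a c)" "x \<in> cbox a c"
      then have x: "x \<notin> N" "x \<in> box a c" by auto
      show "h x = 0"
      proof (rule ccontr)
        assume "h x \<noteq> 0"
        then have "0 < \<bar>f x\<bar>" using \<open>x \<in> cbox a c\<close> by (simp add: f_def)
        from lim[OF x(1) this] obtain d where d: "d > 0" "\<And>t. 0 < t \<and> t < d \<Longrightarrow>
          norm (integral (cbox x (x + t *\<^sub>R One)) f /\<^sub>R t ^ DIM('a) - f x) < \<bar>f x\<bar>" by blast
        \<comment> \<open>The smallest distance from \<open>x\<close> to an upper face: a cube with
          lower corner \<open>x\<close> and side at most \<open>m\<close> stays inside the
          box.\<close>
        define m where "m = Min ((\<lambda>b. (c - x) \<bullet> b) ` Basis)"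
        have m: "0 < m" "\<And>b. b \<in> Basis \<Longrightarrow> m \<le> (c - x) \<bullet> b"
          using x(2) by (auto simp: m_def mem_box inner_diff_left)
        define t where "t = min (d / 2) m"
        have t: "0 < t" "t < d" "t \<le> m" using d(1) m(1) by (auto simp: t_def)
        have "cbox x (x + t *\<^sub>R One) \<subseteq> cbox a c"
          using x(2) m(2) t by (intro subset_box_imp) (force simp: mem_box inner_add_left inner_diff_left)
        moreover from this have "integral (cbox x (x + t *\<^sub>R One)) f = integral (cbox x (x + t *\<^sub>R One)) h"
          by (intro integral_cong) (auto simp: f_def)
        ultimately have "integral (cbox x (x + t *\<^sub>R One)) f = 0" using int0 sub by auto
        then show False using d(2)[of t] t by simp
      qed
    qed
  qed
  obtain \<D> where D: "countable \<D>" "\<Union>\<D> = S" "\<And>X. X \<in> \<D> \<Longrightarrow> X \<subseteq> S" "\<And>X. X \<in> \<D> \<Longrightarrow> \<exists>a b. X = cbox a b"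
    using open_countable_Union_open_cbox[OF \<open>open S\<close>] by (metis Pow_iff subsetD)
  have "AE x in lebesgue. \<forall>X\<in>\<D>. x \<in> X \<longrightarrow> h x = 0"
    unfolding AE_ball_countable[OF D(1)] using box D(3,4) by metis
  then show ?thesis using D(2) by auto
qed

section \<open>Absolutely continuous functions on the line\<close>


text \<open>Local absolute continuity with density \<open>f\<close>, stated through increments on
  compact subintervals. No pointwise derivative of \<open>F\<close> occurs, and nothing is demanded
  at the ends of an open interval \<open>I\<close>.\<close>

definition ac :: "real set \<Rightarrow> (real \<Rightarrow> real) \<Rightarrow> (real \<Rightarrow> real) \<Rightarrow> bool" where
  "ac I F f \<longleftrightarrow> (\<forall>a b. a \<le> b \<longrightarrow> {a..b} \<subseteq> I \<longrightarrow>
     f absolutely_integrable_on {a..b} \<and> F b - F a = integral {a..b} f)"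

lemma acD:
  assumes "ac I F f" "a \<le> b" "{a..b} \<subseteq> I"
  shows "f absolutely_integrable_on {a..b}" "F b - F a = integral {a..b} f"
  using assms unfolding ac_def by blast+

lemma ac_subset: "ac I F f \<Longrightarrow> J \<subseteq> I \<Longrightarrow> ac J F f"
  unfolding ac_def by (meson subset_trans)

lemma ac_integrable_subinterval:
  assumes "ac I F f" "{a..b} \<subseteq> I"
  shows "f absolutely_integrable_on {a..b}"
  using acD(1)[OF assms(1), of a b] assms(2) by (cases "a \<le> b") auto

lemma ac_continuous:
  assumes "ac I F f" "{a..b} \<subseteq> I"
  shows "continuous_on {a..b} F"
proof -
  have "continuous_on {a..b} (\<lambda>x. F a + integral {a..x} f)"
    using set_lebesgue_integral_eq_integral(1)[OF ac_integrable_subinterval[OF assms]]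
    by (intro continuous_intros indefinite_integral_continuous_1)
  moreover have "F a + integral {a..x} f = F x" if "x \<in> {a..b}" for x
  proof -
    have "{a..x} \<subseteq> I" using that assms(2) by auto
    then show ?thesis using acD(2)[OF assms(1), of a x] that by auto
  qed
  ultimately show ?thesis by (metis (no_types, lifting) continuous_on_cong)
qed

lemma ac_deriv:
  assumes "\<And>x. x \<in> I \<Longrightarrow> (F has_real_derivative f x) (at x)" "continuous_on I f"
  shows "ac I F f"
  unfolding ac_def
proof (intro allI impI conjI)
  fix a b assume ab: "a \<le> b" "{a..b} \<subseteq> I"
  show "f absolutely_integrable_on {a..b}"
    using assms(2) ab by (intro absolutely_integrable_continuous_real continuous_on_subset[OF assms(2)])
  have "(f has_integral F b - F a) {a..b}"
    using ab assms(1) by (intro fundamental_theorem_of_calculus)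
      (auto simp: has_real_derivative_iff_has_vector_derivative[symmetric]
        intro!: has_field_derivative_at_within assms(1))
  then show "F b - F a = integral {a..b} f" by (simp add: integral_unique)
qed

text \<open>The density matters only up to null sets; this is how a weak derivative chosen
  arbitrarily is exchanged for a Borel function with the right sign everywhere.\<close>

lemma ac_cong_AE:
  assumes "ac I F f" "AE x in lebesgue. x \<in> I \<longrightarrow> f x = g x" "g \<in> borel_measurable lebesgue"
  shows "ac I F g"
  unfolding ac_def
proof (intro allI impI conjI)
  fix a b assume ab: "a \<le> b" "{a..b} \<subseteq> I"
  have f: "f absolutely_integrable_on {a..b}" "F b - F a = integral {a..b} f"
    using acD[OF assms(1) ab] .
  have AE: "AE x in lebesgue. indicator {a..b} x *\<^sub>R g x = indicator {a..b} x *\<^sub>R f x"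
    using assms(2) by eventually_elim (use ab in \<open>auto simp: indicator_def\<close>)
  have "(\<lambda>x. indicator {a..b} x *\<^sub>R g x) \<in> borel_measurable lebesgue"
    by (intro borel_measurable_scaleR borel_measurable_indicator assms(3)) simp
  note m = this borel_measurable_integrable[OF f(1)[unfolded set_integrable_def]]
  show g: "g absolutely_integrable_on {a..b}"
    using f(1) integrable_cong_AE[OF m AE] by (simp add: set_integrable_def)
  have "(LINT x:{a..b}|lebesgue. g x) = (LINT x:{a..b}|lebesgue. f x)"
    using integral_cong_AE[OF m AE] by (simp add: set_lebesgue_integral_def)
  then show "F b - F a = integral {a..b} g"
    using f g by (simp add: set_lebesgue_integral_eq_integral)
qed

lemma ac_cong: "ac I F f \<Longrightarrow> (\<And>x. x \<in> I \<Longrightarrow> F x = G x) \<Longrightarrow> ac I G f"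
  unfolding ac_def by (metis atLeastAtMost_iff order_refl subsetD)

lemma ac_add_const: "ac I F f \<Longrightarrow> ac I (\<lambda>x. F x + c) f"
  unfolding ac_def by simp

lemma ac_cmult: "ac I F f \<Longrightarrow> ac I (\<lambda>x. c * F x) (\<lambda>x. c * f x)"
  unfolding ac_def by (auto simp: right_diff_distrib[symmetric] intro!: set_integrable_mult_right)

text \<open>Fubini and image measures are used on \<open>lborel\<close>, whereas all integrals of
  the problem refer to its completion. This lemma is the bridge between the two.\<close>

lemma borel_version:
  fixes f :: "'a::euclidean_space \<Rightarrow> real"
  assumes "f absolutely_integrable_on S" "S \<in> sets borel"
  obtains f' where "f' \<in> borel_measurable borel" "integrable lborel f'" "\<And>x. x \<notin> S \<Longrightarrow> f' x = 0"
    "AE x in lebesgue. f' x = indicator S x *\<^sub>R f x"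
proof -
  have f: "integrable lebesgue (\<lambda>x. indicator S x *\<^sub>R f x)" using assms(1) by (simp add: set_integrable_def)
  then obtain g where g: "g \<in> borel_measurable lborel" "AE x in lborel. indicator S x *\<^sub>R f x = g x"
    using completion_ex_borel_measurable_real[of "\<lambda>x. indicator S x *\<^sub>R f x" lborel] by auto
  define f' where "f' x = indicator S x * g x" for x
  have m: "f' \<in> borel_measurable borel" using g(1) assms(2) by (simp add: f'_def[abs_def])
  have AE: "AE x in lebesgue. f' x = indicator S x *\<^sub>R f x"
    using AE_completion[OF g(2)] by eventually_elim (auto simp: f'_def indicator_def split: if_splits)
  have "integrable lebesgue f'"
    using f AE m by (subst integrable_cong_AE[OF _ _ AE]) (auto intro: borel_measurable_lebesgueI)
  then have "integrable lborel f'" using m by (simp add: integrable_completion)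
  then show ?thesis using that[of f'] m AE by (auto simp: f'_def)
qed

text \<open>Fubini on the triangle \<open>x < y\<close>.\<close>

lemma ac_mult_interval:
  assumes F: "ac {a..b} F f" and G: "ac {a..b} G g" and "a \<le> b"
  shows "(\<lambda>x. F x * g x + f x * G x) absolutely_integrable_on {a..b}" (is ?A)
    and "integral {a..b} (\<lambda>x. F x * g x + f x * G x) = F b * G b - F a * G a" (is ?B)
proof -
  have fi: "f absolutely_integrable_on {a..b}" and gi: "g absolutely_integrable_on {a..b}"
    using acD[OF F \<open>a \<le> b\<close>] acD[OF G \<open>a \<le> b\<close>] by auto
  have cont: "continuous_on {a..b} F" "continuous_on {a..b} G"
    using ac_continuous F G by blast+
  have Fg: "(\<lambda>x. F x * g x) absolutely_integrable_on {a..b}" and Gf: "(\<lambda>x. G x * f x) absolutely_integrable_on {a..b}"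
    using set_integrable_continuous_mult[OF gi _ cont(1)] set_integrable_continuous_mult[OF fi _ cont(2)] by auto
  then show ?A by (simp add: set_integral_add mult.commute)
  obtain f1 where f1: "f1 \<in> borel_measurable borel" "integrable lborel f1" "\<And>x. x \<notin> {a..b} \<Longrightarrow> f1 x = 0"
    "AE x in lebesgue. f1 x = indicator {a..b} x *\<^sub>R f x"
    using borel_version[OF fi] by auto
  obtain g1 where g1: "g1 \<in> borel_measurable borel" "integrable lborel g1" "\<And>x. x \<notin> {a..b} \<Longrightarrow> g1 x = 0"
    "AE x in lebesgue. g1 x = indicator {a..b} x *\<^sub>R g x"
    using borel_version[OF gi] by auto
  have part: "(LINT y|lborel. indicator {..x} y * h1 y) = H x - H a"
    if h: "ac {a..b} H h" "h1 \<in> borel_measurable borel" "AE x in lebesgue. h1 x = indicator {a..b} x *\<^sub>R h x"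
      and x: "x \<in> {a..b}" for h1 h H x
  proof -
    have hx: "h absolutely_integrable_on {a..x}" "H x - H a = integral {a..x} h"
      using acD[OF h(1), of a x] x by auto
    have "(LINT y|lborel. indicator {..x} y * h1 y) = (LINT y|lebesgue. indicator {..x} y * h1 y)"
      using h(2) by (simp add: integral_completion)
    also have "\<dots> = (LINT y|lebesgue. indicator {a..x} y *\<^sub>R h y)"
    proof (rule integral_cong_AE)
      show "(\<lambda>y. indicator {..x} y * h1 y) \<in> borel_measurable lebesgue"
        using h(2) by (intro borel_measurable_lebesgueI) auto
      show "(\<lambda>y. indicator {a..x} y *\<^sub>R h y) \<in> borel_measurable lebesgue"
        using hx(1) by (simp add: set_integrable_def)
      show "AE y in lebesgue. indicator {..x} y * h1 y = indicator {a..x} y *\<^sub>R h y"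
        using h(3) by eventually_elim (use x in \<open>auto simp: indicator_def\<close>)
    qed
    also have "\<dots> = H x - H a"
      using hx set_lebesgue_integral_eq_integral(2)[OF hx(1)] by (simp add: set_lebesgue_integral_def)
    finally show ?thesis .
  qed
  \<comment> \<open>Integrating first over \<open>y\<close> gives \<open>g(x) (F b - F x)\<close>,
    first over \<open>x\<close> gives \<open>f(y) (G y - G a)\<close>. Equality of the two iterated
    integrals is the product rule after rearrangement.\<close>
  define k where "k = (\<lambda>x y. if x < y then g1 x * f1 y else 0)"
  have prod: "integrable (lborel \<Otimes>\<^sub>M lborel) (\<lambda>(x, y). g1 x * f1 y)"
  proof (rule lborel_pair.Fubini_integrable)
    show "(\<lambda>(x, y). g1 x * f1 y) \<in> borel_measurable (lborel \<Otimes>\<^sub>M lborel)"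
      using f1(1) g1(1) by simp
    show "integrable lborel (\<lambda>x. LINT y|lborel. norm (case (x, y) of (x, y) \<Rightarrow> g1 x * f1 y))"
      using g1(2) by (simp add: abs_mult)
    show "AE x in lborel. integrable lborel (\<lambda>y. case (x, y) of (x, y) \<Rightarrow> g1 x * f1 y)"
      using f1(2) by simp
  qed
  have k: "integrable (lborel \<Otimes>\<^sub>M lborel) (\<lambda>(x, y). k x y)"
  proof (rule Bochner_Integration.integrable_bound[OF prod])
    show "(\<lambda>(x, y). k x y) \<in> borel_measurable (lborel \<Otimes>\<^sub>M lborel)"
      unfolding k_def using f1(1) g1(1) by measurable
    show "AE z in lborel \<Otimes>\<^sub>M lborel. norm (case z of (x, y) \<Rightarrow> k x y) \<le> norm (case z of (x, y) \<Rightarrow> g1 x * f1 y)"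
      by (intro AE_I2) (auto simp: k_def)
  qed
  have inner_y: "(LINT y|lborel. k x y) = g1 x * (F b - F x)" for x
  proof (cases "x \<in> {a..b}")
    case True
    have "(LINT y|lborel. k x y) = (LINT y|lborel. g1 x * (indicator {..b} y * f1 y - indicator {..x} y * f1 y))"
      using f1(3) True by (intro Bochner_Integration.integral_cong) (auto simp: k_def indicator_def)
    also have "\<dots> = g1 x * ((F b - F a) - (F x - F a))"
      using part[OF F f1(1,4) True] part[OF F f1(1,4), of b] \<open>a \<le> b\<close> f1(2)
      by (subst integral_mult_right_zero, subst Bochner_Integration.integral_diff)
        (auto intro!: integrable_real_mult_indicator simp: mult.commute[of "indicator _ _"])
    finally show ?thesis by simp
  next
    case False
    have "k x y = 0" for y using g1(3)[OF False] by (simp add: k_def)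
    then show ?thesis using g1(3)[OF False] by simp
  qed
  have inner_x: "(LINT x|lborel. k x y) = f1 y * (G y - G a)" for y
  proof (cases "y \<in> {a..b}")
    case True
    have "(LINT x|lborel. k x y) = (LINT x|lborel. f1 y * (indicator {..y} x * g1 x))"
    proof (rule integral_cong_AE)
      show "(\<lambda>x. k x y) \<in> borel_measurable lborel" "(\<lambda>x. f1 y * (indicator {..y} x * g1 x)) \<in> borel_measurable lborel"
        unfolding k_def using g1(1) by measurable
      \<comment> \<open>The triangle is open and the half-line \<open>{..y}\<close> is closed, so
        the two sides may differ at the single point \<open>x = y\<close>.\<close>
      show "AE x in lborel. k x y = f1 y * (indicator {..y} x * g1 x)"
        using AE_lborel_singleton[of y] by eventually_elim (auto simp: k_def indicator_def)
    qed
    also have "\<dots> = f1 y * (G y - G a)" using part[OF G g1(1,4) True] by simp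
    finally show ?thesis .
  next
    case False
    have "k x y = 0" for x using f1(3)[OF False] by (simp add: k_def)
    then show ?thesis using f1(3)[OF False] by simp
  qed
  have "(LINT y|lborel. f1 y * (G y - G a)) = (LINT x|lborel. g1 x * (F b - F x))"
    using lborel_pair.Fubini_integral[OF k] unfolding inner_x inner_y .
  moreover have eq: "(LINT x|lborel. h1 x * C x) = integral {a..b} (\<lambda>x. C x * h x)"
    if "h1 \<in> borel_measurable borel" "\<And>x. x \<notin> {a..b} \<Longrightarrow> h1 x = 0" "AE x in lebesgue. h1 x = indicator {a..b} x *\<^sub>R h x"
      "h absolutely_integrable_on {a..b}" "continuous_on {a..b} C" for h1 h C :: "real \<Rightarrow> real"
  proof -
    have i: "(\<lambda>x. C x * h x) absolutely_integrable_on {a..b}"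
      using set_integrable_continuous_mult[OF that(4) _ that(5)] by simp
    have m: "(\<lambda>x. h1 x * (indicator {a..b} x * C x)) \<in> borel_measurable borel"
      using borel_measurable_times[OF that(1) borel_measurable_continuous_on_indicator[OF _ that(5)]] by simp
    have "(LINT x|lborel. h1 x * C x) = (LINT x|lborel. h1 x * (indicator {a..b} x * C x))"
      using that(2) by (intro Bochner_Integration.integral_cong) (auto simp: indicator_def)
    also have "\<dots> = (LINT x|lebesgue. h1 x * (indicator {a..b} x * C x))"
      using m by (simp add: integral_completion)
    also have "\<dots> = (LINT x|lebesgue. indicator {a..b} x *\<^sub>R (C x * h x))"
    proof (rule integral_cong_AE)
      show "(\<lambda>x. h1 x * (indicator {a..b} x * C x)) \<in> borel_measurable lebesgue"
        using m by (rule borel_measurable_lebesgueI)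
      show "(\<lambda>x. indicator {a..b} x *\<^sub>R (C x * h x)) \<in> borel_measurable lebesgue"
        using i by (simp add: set_integrable_def)
      show "AE x in lebesgue. h1 x * (indicator {a..b} x * C x) = indicator {a..b} x *\<^sub>R (C x * h x)"
        using that(3) by eventually_elim (auto simp: indicator_def)
    qed
    finally show ?thesis
      using set_lebesgue_integral_eq_integral(2)[OF i] by (simp add: set_lebesgue_integral_def)
  qed
  ultimately have "integral {a..b} (\<lambda>x. (G x - G a) * f x) = integral {a..b} (\<lambda>x. (F b - F x) * g x)"
    using eq[OF f1(1,3,4) fi, of "\<lambda>x. G x - G a"] eq[OF g1(1,3,4) gi, of "\<lambda>x. F b - F x"] cont
    by (simp add: continuous_on_diff)
  moreover have "integral {a..b} (\<lambda>x. (G x - G a) * f x) = integral {a..b} (\<lambda>x. G x * f x) - G a * (F b - F a)"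
    using set_lebesgue_integral_eq_integral(1)[OF Gf] set_lebesgue_integral_eq_integral(1)[OF fi] acD(2)[OF F \<open>a \<le> b\<close>]
      integrable_cmul[of f "{a..b}" "G a"]
    by (simp add: left_diff_distrib Henstock_Kurzweil_Integration.integral_diff)
  moreover have "integral {a..b} (\<lambda>x. (F b - F x) * g x) = F b * (G b - G a) - integral {a..b} (\<lambda>x. F x * g x)"
    using set_lebesgue_integral_eq_integral(1)[OF Fg] set_lebesgue_integral_eq_integral(1)[OF gi] acD(2)[OF G \<open>a \<le> b\<close>]
      integrable_cmul[of g "{a..b}" "F b"]
    by (simp add: left_diff_distrib Henstock_Kurzweil_Integration.integral_diff)
  ultimately have "integral {a..b} (\<lambda>x. F x * g x) + integral {a..b} (\<lambda>x. f x * G x) = F b * G b - F a * G a"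
    by (simp add: algebra_simps)
  then show ?B
    using set_lebesgue_integral_eq_integral(1)[OF Fg] set_lebesgue_integral_eq_integral(1)[OF Gf]
    by (simp add: Henstock_Kurzweil_Integration.integral_add mult.commute[of "f _"])
qed

lemma ac_mult:
  assumes "ac I F f" "ac I G g"
  shows "ac I (\<lambda>x. F x * G x) (\<lambda>x. F x * g x + f x * G x)"
  unfolding ac_def
proof (intro allI impI conjI)
  fix a b assume "a \<le> b" "{a..b} \<subseteq> I"
  then show "(\<lambda>x. F x * g x + f x * G x) absolutely_integrable_on {a..b}"
    "F b * G b - F a * G a = integral {a..b} (\<lambda>x. F x * g x + f x * G x)"
    using ac_mult_interval[of a b F f G g] ac_subset[OF assms(1)] ac_subset[OF assms(2)] by auto
qed

lemma ac_test:
  assumes "test_on I \<phi>"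
  shows "ac J \<phi> (deriv \<phi>)"
  by (intro ac_deriv test_on_deriv[OF assms])

text \<open>The product rule for \<open>\<phi> F\<close> on an interval at whose endpoints
  \<open>\<phi>\<close> vanishes: increments over compact intervals already imply the weak
  formulation.\<close>

lemma ac_weak:
  assumes F: "ac I F f" and \<phi>: "test_on I \<phi>"
  shows "(LINT x:I|lebesgue. deriv \<phi> x * F x) = - (LINT x:I|lebesgue. \<phi> x * f x)"
    and "set_integrable lebesgue I (\<lambda>x. deriv \<phi> x * F x)" "set_integrable lebesgue I (\<lambda>x. \<phi> x * f x)"
proof -
  obtain a b where ab: "a \<le> b" "{a..b} \<subseteq> I" "\<And>x. x \<notin> {a<..<b} \<Longrightarrow> \<phi> x = 0"
    using test_onE[OF \<phi>] by metis
  have \<phi>0: "\<phi> a = 0" "\<phi> b = 0" "\<And>x. x \<notin> {a..b} \<Longrightarrow> \<phi> x = 0" using ab(3) by auto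
  have d0: "deriv \<phi> x = 0" if "x \<notin> {a..b}" for x
  proof -
    have "((\<lambda>_. 0) has_real_derivative 0) (at x)" by simp
    then have "(\<phi> has_real_derivative 0) (at x)"
      by (rule has_field_derivative_transform_within_open[of _ _ _ "- {a..b}"]) (use that \<phi>0 in auto)
    then show ?thesis by (simp add: DERIV_imp_deriv)
  qed
  have i1: "(\<lambda>x. deriv \<phi> x * F x) absolutely_integrable_on {a..b}"
    by (intro absolutely_integrable_continuous_real continuous_on_mult test_on_deriv[OF \<phi>] ac_continuous[OF F ab(2)])
  have i2: "(\<lambda>x. \<phi> x * f x) absolutely_integrable_on {a..b}"
    using set_integrable_continuous_mult[OF acD(1)[OF F ab(1,2)] _ test_on_deriv(3)[OF \<phi>]] by simp
  note r1 = set_lebesgue_restrict[of "{a..b}" I "\<lambda>x. deriv \<phi> x * F x" lebesgue, OF ab(2)]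
    and r2 = set_lebesgue_restrict[of "{a..b}" I "\<lambda>x. \<phi> x * f x" lebesgue, OF ab(2)]
  show "set_integrable lebesgue I (\<lambda>x. deriv \<phi> x * F x)" "set_integrable lebesgue I (\<lambda>x. \<phi> x * f x)"
    using r1(1) r2(1) i1 i2 d0 \<phi>0(3) by auto
  have "integral {a..b} (\<lambda>x. \<phi> x * f x + deriv \<phi> x * F x) = 0"
    using ac_mult_interval(2)[OF ac_test[OF \<phi>] ac_subset[OF F ab(2)] ab(1)] \<phi>0 by simp
  then have "integral {a..b} (\<lambda>x. deriv \<phi> x * F x) = - integral {a..b} (\<lambda>x. \<phi> x * f x)"
    using set_lebesgue_integral_eq_integral(1)[OF i1] set_lebesgue_integral_eq_integral(1)[OF i2]
    by (simp add: Henstock_Kurzweil_Integration.integral_add)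
  then show "(LINT x:I|lebesgue. deriv \<phi> x * F x) = - (LINT x:I|lebesgue. \<phi> x * f x)"
    using r1(2) r2(2) i1 i2 d0 \<phi>0(3) by (simp add: set_lebesgue_integral_eq_integral)
qed

text \<open>The base point lies in \<open>I\<close> and the integral is signed, because
  \<open>f\<close> need not be integrable up to the ends of an open interval.\<close>

lemma ac_primitive:
  assumes I: "is_interval I" and c: "c \<in> I" and loc: "\<And>a b. {a..b} \<subseteq> I \<Longrightarrow> f absolutely_integrable_on {a..b}"
  shows "ac I (\<lambda>x. if c \<le> x then integral {c..x} f else - integral {x..c} f) f"
  unfolding ac_def
proof (intro allI impI conjI)
  fix a b assume ab: "a \<le> b" "{a..b} \<subseteq> I"
  show "f absolutely_integrable_on {a..b}" using loc ab by simp
  have int: "f integrable_on {x..y}" if "x \<in> I" "y \<in> I" for x y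
  proof -
    have "{x..y} \<subseteq> I" using that I by (meson atLeastAtMost_iff is_interval_1 subsetI)
    from loc[OF this] show ?thesis by (rule set_lebesgue_integral_eq_integral)
  qed
  have I': "a \<in> I" "b \<in> I" using ab by auto
  consider "c \<le> a" | "a < c" "c \<le> b" | "b < c" by linarith
  then show "(if c \<le> b then integral {c..b} f else - integral {b..c} f) -
      (if c \<le> a then integral {c..a} f else - integral {a..c} f) = integral {a..b} f"
  proof cases
    case 1
    then show ?thesis
      using Henstock_Kurzweil_Integration.integral_combine[OF 1 ab(1) int[OF c I'(2)]] ab(1) by simp
  next
    case 2
    then show ?thesis
      using Henstock_Kurzweil_Integration.integral_combine[of a c b f] int[OF I'] by simp
  next
    case 3
    then show ?thesis
      using Henstock_Kurzweil_Integration.integral_combine[of a b c f] int[OF I'(1) c] ab(1) by simp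
  qed
qed

text \<open>Zero mean is exactly what makes the primitive vanish again to the right of the
  support.\<close>

lemma test_on_primitive:
  assumes \<rho>: "test_on I \<rho>" and int: "(LINT x|lebesgue. \<rho> x) = 0"
  obtains \<eta> where "test_on I \<eta>" "deriv \<eta> = \<rho>"
proof -
  obtain a b where ab: "a \<le> b" "{a..b} \<subseteq> I" "\<And>x. x \<notin> {a<..<b} \<Longrightarrow> \<rho> x = 0"
    using test_onE[OF \<rho>] by metis
  \<comment> \<open>Starting at \<open>a - 1\<close> makes every \<open>x \<ge> a\<close> an
    interior point of the interval on which the integral is differentiated, including
    \<open>x = a\<close>.\<close>
  define \<eta> where "\<eta> x = integral {a - 1..x} \<rho>" for x
  have int_on: "\<rho> integrable_on {u..v}" for u v
    by (intro integrable_continuous_real test_on_deriv[OF \<rho>])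
  have low: "\<eta> x = 0" if "x \<le> a" for x
    unfolding \<eta>_def using ab(3) that by (intro integral_unique has_integral_is_0) auto
  have "\<rho> absolutely_integrable_on {a..b}"
    by (intro absolutely_integrable_continuous_real test_on_deriv[OF \<rho>])
  then have "integral {a..b} \<rho> = (LINT x:{a..b}|lebesgue. \<rho> x)"
    by (simp add: set_lebesgue_integral_eq_integral)
  also have "\<dots> = (LINT x|lebesgue. \<rho> x)"
    using ab(3) by (intro set_lebesgue_restrict(4)[symmetric, of _ UNIV]) auto
  finally have tot: "integral {a..b} \<rho> = 0" using int by simp
  have high: "\<eta> x = 0" if "b \<le> x" for x
  proof -
    have "\<eta> x = integral {a - 1..a} \<rho> + (integral {a..b} \<rho> + integral {b..x} \<rho>)"
      unfolding \<eta>_def using that ab(1) int_on by (simp add: Henstock_Kurzweil_Integration.integral_combine)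
    moreover have "integral {a - 1..a} \<rho> = 0" "integral {b..x} \<rho> = 0"
      using ab(3) by (auto intro!: integral_unique has_integral_is_0)
    ultimately show ?thesis using tot by simp
  qed
  have D: "(\<eta> has_real_derivative \<rho> x) (at x)" for x
  proof (cases "x < a")
    case True
    have "((\<lambda>_. 0) has_real_derivative 0) (at x)" by simp
    then have "(\<eta> has_real_derivative 0) (at x)"
      by (rule has_field_derivative_transform_within_open[of _ _ _ "{..<a}"]) (use True low in auto)
    then show ?thesis using True ab(3)[of x] by simp
  next
    case False
    have "(\<eta> has_real_derivative \<rho> x) (at x within {a - 1..x + 1})"
      unfolding \<eta>_def using False
      by (intro integral_has_real_derivative test_on_deriv[OF \<rho>]) auto
    moreover have "at x within {a - 1..x + 1} = at x"
      using False by (intro at_within_interior) auto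
    ultimately show ?thesis by simp
  qed
  have "Ck k \<eta>" for k
    by (rule Ck_Suc_imp, rule Ck_real_SucI[OF D]) (use \<rho> in \<open>simp add: test_on_def\<close>)
  moreover have "\<eta> x = 0" if "x \<notin> {a..b}" for x using that low high by (cases "x \<le> a") auto
  ultimately have "test_on I \<eta>" using ab unfolding test_on_def by blast
  moreover have "deriv \<eta> = \<rho>" using D by (auto intro: DERIV_imp_deriv)
  ultimately show ?thesis using that by blast
qed

lemma locally_integrable_on_realI:
  fixes f :: "real \<Rightarrow> 'b::euclidean_space"
  assumes "is_interval I" "\<And>a b. {a..b} \<subseteq> I \<Longrightarrow> f absolutely_integrable_on {a..b}"
  shows "locally_integrable_on I f"
  unfolding locally_integrable_on_def
proof (intro allI impI)
  fix K assume K: "compact K \<and> K \<subseteq> I"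
  show "f absolutely_integrable_on K"
  proof (cases "K = {}")
    case False
    obtain a where a: "a \<in> K" "\<And>x. x \<in> K \<Longrightarrow> a \<le> x" using compact_attains_inf[of K] False K by blast
    obtain b where b: "b \<in> K" "\<And>x. x \<in> K \<Longrightarrow> x \<le> b" using compact_attains_sup[of K] False K by blast
    have "a \<in> I" "b \<in> I" using a b K by auto
    then have "{a..b} \<subseteq> I" using assms(1) by (meson atLeastAtMost_iff is_interval_1 subsetI)
    moreover have "K \<subseteq> {a..b}" using a b by auto
    moreover have "K \<in> sets lebesgue" using K by (simp add: borel_compact)
    ultimately show ?thesis using assms(2) set_integrable_subset by blast
  qed simp
qed

lemma locally_integrable_diff:
  "locally_integrable_on S f \<Longrightarrow> locally_integrable_on S g \<Longrightarrow> locally_integrable_on S (\<lambda>x. f x - g x)"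
  unfolding locally_integrable_on_def by (simp add: set_integral_diff(1))

lemma ac_locally_integrable:
  assumes "ac I F f" "is_interval I"
  shows "locally_integrable_on I F" "locally_integrable_on I f"
  by (intro locally_integrable_on_realI[OF assms(2)] absolutely_integrable_continuous_real
      ac_continuous[OF assms(1)] ac_integrable_subinterval[OF assms(1)]; assumption)+

text \<open>The integrals of smooth bumps converge to the length \<open>2 * e\<close> of an interval
  in \<open>I\<close>, so one of them is positive and can be scaled.\<close>

lemma test_on_normalized:
  assumes "open I" "I \<noteq> {}"
  obtains \<phi> where "test_on I \<phi>" "(LINT x|lebesgue. \<phi> x) = 1"
proof -
  obtain c where "c \<in> I" using assms by auto
  then obtain e where e: "e > 0" "cball c e \<subseteq> I" using assms(1) open_contains_cball by blast
  have sub: "{c - e..c + e} \<subseteq> I" using e by (simp add: cball_eq_atLeastAtMost)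
  obtain \<phi> :: "nat \<Rightarrow> real \<Rightarrow> real" where \<phi>: "\<And>n k. Ck k (\<phi> n)" "\<And>n x. 0 \<le> \<phi> n x" "\<And>n x. \<phi> n x \<le> 1"
        "\<And>n x. x \<notin> box (c - e) (c + e) \<Longrightarrow> \<phi> n x = 0" "\<And>x. (\<lambda>n. \<phi> n x) \<longlonglongrightarrow> indicator (box (c - e) (c + e)) x"
    using bump_sequence[of "c - e" "c + e"] by metis
  have t: "test_on I (\<phi> n)" for n
    unfolding test_on_def using \<phi>(1,4) sub e(1) by (intro conjI exI[of _ "c - e"] exI[of _ "c + e"]) auto
  have "(\<lambda>n. LINT x|lebesgue. \<phi> n x) \<longlonglongrightarrow> (LINT x|lebesgue. indicator (box (c - e) (c + e)) x)"
  proof (rule integral_dominated_convergence[where w = "indicator (box (c - e) (c + e))"])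
    show "\<phi> n \<in> borel_measurable lebesgue" for n
      using \<phi>(1)[of 0 n] by (intro borel_measurable_lebesgueI borel_measurable_continuous_onI) simp
    show "AE x in lebesgue. norm (\<phi> n x) \<le> indicator (box (c - e) (c + e)) x" for n
      using \<phi>(2,3,4) by (intro AE_I2) (auto simp: indicator_def)
    show "indicat_real (box (c - e) (c + e)) \<in> borel_measurable lebesgue" 
      by (intro borel_measurable_indicator) simp
    show "integrable lebesgue (indicat_real (box (c - e) (c + e)))"
      using e(1) by (intro integrable_real_indicator) simp_all
  qed (use \<phi>(5) in auto)
  moreover have "(LINT x|lebesgue. indicator (box (c - e) (c + e)) x) = 2 * e"
    using e(1) by simp
  ultimately have "(\<lambda>n. LINT x|lebesgue. \<phi> n x) \<longlonglongrightarrow> 2 * e" by simp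
  from order_tendstoD(1)[OF this, of 0]
  have "\<forall>\<^sub>F n in sequentially. 0 < (LINT x|lebesgue. \<phi> n x)"
    using e(1) by simp
  then obtain n where n: "0 < (LINT x|lebesgue. \<phi> n x)" by (metis eventually_sequentially order_refl)
  show ?thesis
  proof (rule that)
    show "test_on I (\<lambda>x. (1 / (LINT x|lebesgue. \<phi> n x)) * \<phi> n x)"
      by (intro test_on_mult t Ck_const)
    show "(LINT x|lebesgue. (1 / (LINT x|lebesgue. \<phi> n x)) * \<phi> n x) = 1"
      using n by (subst integral_mult_right_zero) simp
  qed
qed

lemma set_integrable_test_on:
  assumes "locally_integrable_on I h" "test_on I \<phi>"
  shows "set_integrable lebesgue I (\<lambda>x. \<phi> x * h x)"
proof -
  obtain a b where ab: "a \<le> b" "{a..b} \<subseteq> I" "\<And>x. x \<notin> {a<..<b} \<Longrightarrow> \<phi> x = 0"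
    using test_onE[OF assms(2)] by metis
  then have "\<And>x. x \<notin> {a..b} \<Longrightarrow> \<phi> x = 0" by auto
  from set_integrable_test_mult[OF assms(1) _ ab(2) this test_on_deriv(3)[OF assms(2)]]
  show ?thesis by simp
qed

text \<open>Subtracting a primitive \<open>P\<close> of \<open>z\<close> leaves a function
  \<open>D\<close> that annihilates all derivatives of test functions, hence all test functions of
  mean zero. Such a \<open>D\<close> is almost everywhere a constant \<open>\<kappa>\<close>, and
  \<open>F = P + \<kappa>\<close>.\<close>

lemma du_bois_reymond:
  fixes Z z :: "real \<Rightarrow> real"
  assumes I: "open I" "is_interval I" "I \<noteq> {}"
    and Z: "locally_integrable_on I Z" and z: "locally_integrable_on I z"
    and weak: "\<And>\<phi>. test_on I \<phi> \<Longrightarrow> (LINT x:I|lebesgue. deriv \<phi> x * Z x) = - (LINT x:I|lebesgue. \<phi> x * z x)"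
  obtains F where "ac I F z" "AE x in lebesgue. x \<in> I \<longrightarrow> F x = Z x"
proof -
  obtain c where c: "c \<in> I" using I(3) by auto
  obtain P where P: "ac I P z"
    using ac_primitive[OF I(2) c, of z] z by (auto simp: locally_integrable_on_def)
  have Pl: "locally_integrable_on I P" using ac_locally_integrable[OF P I(2)] by simp
  define D where "D x = Z x - P x" for x
  have D: "locally_integrable_on I D" unfolding D_def by (intro locally_integrable_diff Z Pl)
  have D0: "(LINT x:I|lebesgue. deriv \<phi> x * D x) = 0" if "test_on I \<phi>" for \<phi>
  proof -
    have "(LINT x:I|lebesgue. deriv \<phi> x * D x)
        = (LINT x:I|lebesgue. deriv \<phi> x * Z x) - (LINT x:I|lebesgue. deriv \<phi> x * P x)"
      unfolding D_def right_diff_distrib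
      by (intro set_integral_diff set_integrable_test_on Z Pl test_on_deriv that)
    then show ?thesis using weak[OF that] ac_weak(1)[OF P that] by simp
  qed
  obtain \<phi>0 where \<phi>0: "test_on I \<phi>0" "(LINT x|lebesgue. \<phi>0 x) = 1"
    using test_on_normalized[OF I(1,3)] by metis
  define \<kappa> where "\<kappa> = (LINT x:I|lebesgue. \<phi>0 x * D x)"
  have test_int: "integrable lebesgue \<phi>" "set_integrable lebesgue I \<phi>" "(LINT x:I|lebesgue. \<phi> x) = (LINT x|lebesgue. \<phi> x)" if t: "test_on I \<phi>" for \<phi>
  proof -
    obtain a b where ab: "a \<le> b" "{a..b} \<subseteq> I" "\<And>x. x \<notin> {a<..<b} \<Longrightarrow> \<phi> x = 0"
      using test_onE[OF t] by metis
    have i: "\<phi> absolutely_integrable_on {a..b}"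
      by (intro absolutely_integrable_continuous_real test_on_deriv[OF t])
    note r = set_lebesgue_restrict[where f = \<phi> and S = I and K = "{a..b}" and M = lebesgue, OF ab(2)]
    have z: "\<forall>x. x \<notin> {a..b} \<longrightarrow> \<phi> x = 0" using ab(3) by auto
    then have "set_integrable lebesgue I \<phi> = set_integrable lebesgue {a..b} \<phi>"
      "integrable lebesgue \<phi> = set_integrable lebesgue {a..b} \<phi>"
      "(LINT x:I|lebesgue. \<phi> x) = (LINT x:{a..b}|lebesgue. \<phi> x)"
      "(LINT x|lebesgue. \<phi> x) = (LINT x:{a..b}|lebesgue. \<phi> x)"
      by (intro r; blast)+
    with i show "integrable lebesgue \<phi>" "set_integrable lebesgue I \<phi>"
      "(LINT x:I|lebesgue. \<phi> x) = (LINT x|lebesgue. \<phi> x)"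
      by simp_all
  qed
  have "AE x in lebesgue. x \<in> I \<longrightarrow> D x - \<kappa> = 0"
  proof (rule AE_zero_if_test_integrals_zero[OF I(1)])
    show "locally_integrable_on I (\<lambda>x. D x - \<kappa>)"
      by (intro locally_integrable_diff D locally_integrable_on_realI I(2)
          absolutely_integrable_continuous_real continuous_on_const)
    fix \<psi> assume "test_function I \<psi>"
    then have \<psi>: "test_on I \<psi>" using test_function_iff_test_on[OF I(2,3)] by simp
    define s where "s = (LINT x|lebesgue. \<psi> x)"
    \<comment> \<open>Removing the mean of \<open>\<psi>\<close> by a multiple of the normalised
      bump makes it a derivative of a test function; \<open>\<kappa>\<close> is the value of
      \<open>D\<close> on that bump.\<close>
    define \<rho> where "\<rho> x = \<psi> x + (- s) * \<phi>0 x" for x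
    have \<rho>: "test_on I \<rho>"
    proof -
      obtain a b where ab: "a \<le> b" "{a..b} \<subseteq> I" "\<And>x. x \<notin> {a<..<b} \<Longrightarrow> \<psi> x = 0"
        using test_onE[OF \<psi>] by metis
      obtain a' b' where ab': "a' \<le> b'" "{a'..b'} \<subseteq> I" "\<And>x. x \<notin> {a'<..<b'} \<Longrightarrow> \<phi>0 x = 0"
        using test_onE[OF \<phi>0(1)] by metis
      have "min a a' \<in> I" "max b b' \<in> I"
        using ab(1,2) ab'(1,2) by (auto simp: min_def max_def)
      then have "{min a a'..max b b'} \<subseteq> I" using I(2) by (meson atLeastAtMost_iff is_interval_1 subsetI)
      moreover have "\<rho> x = 0" if "x \<notin> {min a a'..max b b'}" for x
      proof -
        have "x \<notin> {a<..<b}" "x \<notin> {a'<..<b'}" using that by auto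
        then show ?thesis using ab(3) ab'(3) by (simp only: \<rho>_def) simp
      qed
      moreover have "Ck k \<rho>" for k
        unfolding \<rho>_def[abs_def] using \<psi> \<phi>0(1) by (intro Ck_add Ck_cmult) (auto simp: test_on_def)
      moreover have "min a a' \<le> max b b'" using ab(1) by auto
      ultimately show ?thesis unfolding test_on_def by blast
    qed
    have "(LINT x|lebesgue. \<rho> x) = 0"
      unfolding \<rho>_def using test_int(1)[OF \<psi>] test_int(1)[OF \<phi>0(1)] \<phi>0(2)
      by (simp add: s_def)
    then obtain \<eta> where "test_on I \<eta>" "deriv \<eta> = \<rho>" using test_on_primitive[OF \<rho>] by metis
    then have "0 = (LINT x:I|lebesgue. \<rho> x * D x)" using D0 by metis
    also have "\<dots> = (LINT x:I|lebesgue. \<psi> x * D x) + (LINT x:I|lebesgue. (- s) * (\<phi>0 x * D x))"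
      unfolding \<rho>_def distrib_right mult.assoc
      by (intro set_integral_add set_integrable_mult_right set_integrable_test_on D \<psi> \<phi>0)
    also have "\<dots> = (LINT x:I|lebesgue. \<psi> x * D x) - s * \<kappa>"
      by (subst set_integral_mult_right) (simp add: \<kappa>_def)
    finally have "(LINT x:I|lebesgue. \<psi> x * D x) = \<kappa> * s" by simp
    moreover have "(LINT x:I|lebesgue. \<psi> x * (D x - \<kappa>)) = (LINT x:I|lebesgue. \<psi> x * D x) - (LINT x:I|lebesgue. \<psi> x * \<kappa>)"
      unfolding right_diff_distrib
      by (intro set_integral_diff set_integrable_mult_left set_integrable_test_on D \<psi> test_int)
    ultimately show "(LINT x:I|lebesgue. \<psi> x * (D x - \<kappa>)) = 0"
      using test_int(3)[OF \<psi>] by (simp add: s_def)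
  qed
  then have "AE x in lebesgue. x \<in> I \<longrightarrow> P x + \<kappa> = Z x" by eventually_elim (auto simp: D_def)
  then show ?thesis using that ac_add_const[OF P] by blast
qed

section \<open>Radial integration\<close>


definition sphere_area :: "nat \<Rightarrow> real" where
  "sphere_area d = real d * unit_ball_vol (real d)"

lemma sphere_area_pos: "0 < d \<Longrightarrow> 0 < sphere_area d"
  by (simp add: sphere_area_def unit_ball_vol_def)

abbreviation radial_density :: "nat \<Rightarrow> real \<Rightarrow> real" where
  "radial_density d r \<equiv> indicator {0<..} r * (sphere_area d * r ^ (d - 1))"

lemma radial_density_nonneg: "0 \<le> radial_density d r"
  by (auto simp: indicator_def sphere_area_def intro!: mult_nonneg_nonneg unit_ball_vol_nonneg)

lemma radial_density_borel [measurable]: "radial_density d \<in> borel_measurable borel"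
  by simp

text \<open>Both measures give the volume of a ball to each half-line \<open>{..a}\<close>, by the
  power rule on the right, and these half-lines are an intersection-stable generator of the Borel
  sets.\<close>

lemma distr_norm:
  "distr (lborel :: 'a::euclidean_space measure) borel norm = density lborel (\<lambda>r. ennreal (radial_density DIM('a) r))"
    (is "?M = ?N")
proof (rule measure_eqI_generator_eq[where E = "range (\<lambda>a::real. {..a})" and \<Omega> = UNIV and A = "\<lambda>n. {..real n}"])
  let ?d = "DIM('a)"
  have M: "emeasure ?M {..a} = emeasure lborel (cball (0::'a) a)" for a
  proof -
    have "(norm :: 'a \<Rightarrow> real) -` {..a} = cball 0 a" by auto
    then show ?thesis by (subst emeasure_distr) simp_all
  qed
  have N: "emeasure ?N {..a} = emeasure lborel (cball (0::'a) a)" for a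
  proof (cases "0 \<le> a")
    case False
    have "emeasure ?N {..a} = (\<integral>\<^sup>+r. ennreal (radial_density ?d r) * indicator {..a} r \<partial>lborel)"
      by (intro emeasure_density) simp_all
    also have "\<dots> = (\<integral>\<^sup>+r. 0 \<partial>(lborel :: real measure))"
      using False by (intro nn_integral_cong) (auto simp: indicator_def)
    finally show ?thesis using False by simp
  next
    case True
    let ?f = "\<lambda>r. sphere_area ?d * r ^ (?d - 1)"
    have "emeasure ?N {..a} = (\<integral>\<^sup>+r. ennreal (indicator {0..a} r *\<^sub>R ?f r) \<partial>lborel)"
    proof (subst emeasure_density)
      show "(\<integral>\<^sup>+r. ennreal (radial_density ?d r) * indicator {..a} r \<partial>lborel) = (\<integral>\<^sup>+r. ennreal (indicator {0..a} r *\<^sub>R ?f r) \<partial>lborel)"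
      proof (rule nn_integral_cong_AE)
        \<comment> \<open>The sides may differ at \<open>r = 0\<close>: for \<open>d = 1\<close> the
          power \<open>0 ^ (d - 1)\<close> is 1, while the density is cut off there.\<close>
        show "AE r in lborel. ennreal (radial_density ?d r) * indicator {..a} r = ennreal (indicator {0..a} r *\<^sub>R ?f r)"
          using AE_lborel_singleton[of 0] by eventually_elim (auto simp: indicator_def)
      qed
    qed simp_all
    also have "\<dots> = ennreal (LINT r|lborel. indicator {0..a} r *\<^sub>R ?f r)"
    proof (rule nn_integral_eq_integral)
      show "integrable lborel (\<lambda>r. indicator {0..a} r *\<^sub>R ?f r)"
        using borel_integrable_atLeastAtMost'[of 0 a ?f]
        by (simp add: set_integrable_def continuous_intros)
      show "AE r in lborel. 0 \<le> indicator {0..a} r *\<^sub>R ?f r"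
        by (intro AE_I2) (auto simp: indicator_def sphere_area_def)
    qed
    also have "(LINT r|lborel. indicator {0..a} r *\<^sub>R ?f r) = unit_ball_vol ?d * a ^ ?d - unit_ball_vol ?d * 0 ^ ?d"
      using True
      by (intro integral_FTC_atLeastAtMost)
        (auto intro!: derivative_eq_intros continuous_intros
          simp: has_real_derivative_iff_has_vector_derivative[symmetric] sphere_area_def)
    finally show ?thesis using True by (simp add: emeasure_cball power_0_left)
  qed
  show "emeasure ?M X = emeasure ?N X" if "X \<in> range (\<lambda>a. {..a})" for X
    using that M N by auto
  show "emeasure ?M {..real n} \<noteq> \<infinity>" for n
    unfolding M using emeasure_lborel_cball_finite[of "0::'a" n] by simp
  show "Int_stable (range (\<lambda>a::real. {..a}))"
    by (auto simp: Int_stable_def)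
  show "sets ?M = sigma_sets UNIV (range (\<lambda>a. {..a}))" "sets ?N = sigma_sets UNIV (range (\<lambda>a. {..a}))"
    by (simp_all add: borel_eq_atMost)
  show "(\<Union>i. {..real i}) = UNIV" using real_arch_simple by blast
qed auto

text \<open>The image of Lebesgue measure under the norm has a density supported on
  \<open>{0<..}\<close>, so preimages of null sets are null and the origin is harmless.\<close>

lemma AE_norm:
  assumes "AE r in lebesgue. 0 < r \<longrightarrow> P r"
  shows "AE x::'a::euclidean_space in lebesgue. P (norm x)"
proof -
  have "AE r in lborel. 0 < r \<longrightarrow> P r" using assms by (simp add: AE_completion_iff)
  then have "AE r in distr (lborel :: 'a measure) borel norm. P r"
    unfolding distr_norm by (subst AE_density) (auto simp: indicator_def split: if_splits)
  then have "AE x::'a in lborel. P (norm x)" by (intro AE_distrD[of norm _ borel]) auto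
  then show ?thesis by (rule AE_completion)
qed

lemma radial_integral:
  fixes h :: "real \<Rightarrow> real"
  assumes [measurable]: "h \<in> borel_measurable borel"
  shows "integrable lebesgue (\<lambda>x::'a::euclidean_space. h (norm x)) \<longleftrightarrow>
      (\<lambda>r. r ^ (DIM('a) - 1) * h r) absolutely_integrable_on {0<..}"
    and "(LINT x::'a|lebesgue. h (norm x)) =
      sphere_area DIM('a) * (LINT r:{0<..}|lebesgue. r ^ (DIM('a) - 1) * h r)"
proof -
  let ?d = "DIM('a)"
  have m: "(\<lambda>x::'a. h (norm x)) \<in> borel_measurable lborel" by measurable
  have m2: "(\<lambda>r. indicator {0<..} r *\<^sub>R (r ^ (?d - 1) * h r)) \<in> borel_measurable lborel" by measurable
  have eq: "radial_density ?d r *\<^sub>R h r = sphere_area ?d * (indicator {0<..} r *\<^sub>R (r ^ (?d - 1) * h r))" for r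
    by simp
  have nn: "AE r in lborel. 0 \<le> radial_density ?d r" by (intro AE_I2 radial_density_nonneg)
  have "integrable lebesgue (\<lambda>x::'a. h (norm x)) \<longleftrightarrow> integrable (distr (lborel :: 'a measure) borel norm) h"
    using m by (simp add: integrable_completion integrable_distr_eq)
  also have "\<dots> \<longleftrightarrow> integrable lborel (\<lambda>r. radial_density ?d r *\<^sub>R h r)"
    unfolding distr_norm using nn by (intro integrable_density) simp_all
  also have "\<dots> \<longleftrightarrow> integrable lborel (\<lambda>r. indicator {0<..} r *\<^sub>R (r ^ (?d - 1) * h r))"
    unfolding eq using sphere_area_pos[of ?d] by simp
  finally show "integrable lebesgue (\<lambda>x::'a. h (norm x)) \<longleftrightarrow>
      (\<lambda>r. r ^ (?d - 1) * h r) absolutely_integrable_on {0<..}"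
    using m2 by (simp only: set_integrable_def integrable_completion)
  have "(LINT x::'a|lebesgue. h (norm x)) = integral\<^sup>L (distr (lborel :: 'a measure) borel norm) h"
    using m by (simp add: integral_completion integral_distr)
  also have "\<dots> = (LINT r|lborel. radial_density ?d r *\<^sub>R h r)"
    unfolding distr_norm using nn by (intro integral_density) simp_all
  also have "\<dots> = sphere_area ?d * (LINT r:{0<..}|lebesgue. r ^ (?d - 1) * h r)"
    unfolding eq set_lebesgue_integral_def using m2 by (simp only: integral_completion integral_mult_right_zero)
  finally show "(LINT x::'a|lebesgue. h (norm x)) =
      sphere_area DIM('a) * (LINT r:{0<..}|lebesgue. r ^ (DIM('a) - 1) * h r)" .
qed

text \<open>\<open>K r\<close> is the integral of \<open>v\<close> over the sphere of radius
  \<open>r\<close>, obtained as the Radon-Nikodym density of the image of \<open>v dx\<close> under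
  the norm. Absolute continuity of this image is the fact that norm preimages of null sets are
  null.\<close>

lemma radial_pushforward_nonneg:
  fixes v :: "'a::euclidean_space \<Rightarrow> real"
  assumes v[measurable]: "v \<in> borel_measurable borel" and v0: "\<And>x. 0 \<le> v x" and vi: "integrable lborel v"
  obtains K where "K \<in> borel_measurable borel" "integrable lborel K" "\<And>r. r \<le> 0 \<Longrightarrow> K r = 0"
    "\<And>g :: real \<Rightarrow> real. g \<in> borel_measurable borel \<Longrightarrow>
       integrable lborel (\<lambda>r. g r * K r) \<longleftrightarrow> integrable lborel (\<lambda>x. g (norm x) * v x)"
    "\<And>g :: real \<Rightarrow> real. g \<in> borel_measurable borel \<Longrightarrow>
       (LINT r|lborel. g r * K r) = (LINT x|lborel. g (norm x) * v x)"
proof -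
  define N where "N = distr (density lborel v) borel norm"
  have null: "emeasure N A = 0" if A: "A \<in> sets borel" "AE r in lebesgue. 0 < r \<longrightarrow> r \<notin> A" for A
  proof -
    have "AE x::'a in lborel. norm x \<notin> A" using AE_norm[OF A(2), where 'a = 'a] by (simp add: AE_completion_iff)
    have "emeasure N A = emeasure (density lborel v) (norm -` A)"
      unfolding N_def using A(1) by (subst emeasure_distr) auto
    also have "\<dots> = (\<integral>\<^sup>+x. ennreal (v x) * indicator (norm -` A) x \<partial>lborel)"
      using A(1) measurable_sets[of norm "borel::'a measure" borel A] by (intro emeasure_density) auto
    also have "\<dots> = (\<integral>\<^sup>+x. 0 \<partial>(lborel :: 'a measure))"
      using \<open>AE x::'a in lborel. norm x \<notin> A\<close> by (intro nn_integral_cong_AE) (auto simp: indicator_def elim!: eventually_mono)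
    finally show ?thesis by simp
  qed
  have setsN: "sets N = sets lborel" by (simp add: N_def)
  have "absolutely_continuous lborel N"
    unfolding absolutely_continuous_def
  proof
    fix A :: "real set" assume A: "A \<in> null_sets lborel"
    then have "AE r in lebesgue. 0 < r \<longrightarrow> r \<notin> A" using AE_not_in[OF A] by (auto intro: AE_completion elim!: eventually_mono)
    then show "A \<in> null_sets N" using null[of A] A setsN by (auto simp: null_sets_def)
  qed
  then obtain f where f[measurable]: "f \<in> borel_measurable lborel" and fN: "density lborel f = N"
    using sigma_finite_measure.Radon_Nikodym[OF sigma_finite_lborel _ setsN] by blast
  have tot: "(\<integral>\<^sup>+r. f r \<partial>lborel) = ennreal (LINT x|lborel. v x)"
  proof -
    have "(\<integral>\<^sup>+r. f r \<partial>lborel) = emeasure (density lborel f) UNIV" by (subst emeasure_density) simp_all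
    also have "\<dots> = (\<integral>\<^sup>+x. ennreal (v x) \<partial>lborel)" unfolding fN N_def by (subst emeasure_distr) (simp_all add: emeasure_density)
    also have "\<dots> = ennreal (LINT x|lborel. v x)" using v0 vi by (intro nn_integral_eq_integral) auto
    finally show ?thesis .
  qed
  \<comment> \<open>The density has values in the extended reals; finite total mass allows passing
    to a real function.\<close>
  have fin: "AE r in lborel. f r \<noteq> \<infinity>" using tot by (intro nn_integral_PInf_AE) auto
  have "emeasure (density lborel f) {..0} = 0" unfolding fN by (rule null) auto
  then have "(\<integral>\<^sup>+r. f r * indicator {..0} r \<partial>lborel) = 0" by (subst (asm) emeasure_density) simp_all
  then have neg: "AE r in lborel. f r * indicator {..0} r = 0" by (subst (asm) nn_integral_0_iff_AE) simp_all
  define K where "K r = indicator {0<..} r * enn2real (f r)" for r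
  have K[measurable]: "K \<in> borel_measurable borel" unfolding K_def[abs_def] by measurable
  have K0: "0 \<le> K r" for r by (simp add: K_def)
  have fK: "AE r in lborel. f r = ennreal (K r)"
    using fin neg
  proof eventually_elim
    case (elim r)
    then show ?case by (cases "0 < r") (auto simp: K_def ennreal_enn2real_if indicator_def)
  qed
  then have NK: "N = density lborel (\<lambda>r. ennreal (K r))"
    unfolding fN[symmetric] by (intro density_cong) auto
  have "(\<integral>\<^sup>+r. ennreal (K r) \<partial>lborel) = (\<integral>\<^sup>+r. f r \<partial>lborel)"
    using fK by (intro nn_integral_cong_AE) (auto elim!: eventually_mono)
  then have Ki: "integrable lborel K"
    using tot K0 by (intro integrableI_bounded) auto
  have nn: "AE r in lborel. 0 \<le> K r" "AE x in lborel. 0 \<le> v x" using K0 v0 by auto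
  show ?thesis
  proof (rule that[of K])
    show "K r = 0" if "r \<le> 0" for r using that by (simp add: K_def)
    fix g :: "real \<Rightarrow> real" assume g[measurable]: "g \<in> borel_measurable borel"
    have "integrable lborel (\<lambda>r. g r * K r) \<longleftrightarrow> integrable N g"
      unfolding NK using integrable_density[OF _ _ nn(1), of g] by (simp add: mult.commute)
    also have "\<dots> \<longleftrightarrow> integrable (density lborel v) (\<lambda>x. g (norm x))"
      unfolding N_def by (intro integrable_distr_eq) simp_all
    also have "\<dots> \<longleftrightarrow> integrable lborel (\<lambda>x. g (norm x) * v x)"
      using integrable_density[OF _ _ nn(2), of "\<lambda>x. g (norm x)"] by (simp add: mult.commute)
    finally show "integrable lborel (\<lambda>r. g r * K r) \<longleftrightarrow> integrable lborel (\<lambda>x. g (norm x) * v x)" .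
    have "(LINT r|lborel. g r * K r) = integral\<^sup>L N g"
      unfolding NK using integral_density[OF _ _ nn(1), of g] by (simp add: mult.commute)
    also have "\<dots> = (LINT x|density lborel v. g (norm x))"
      unfolding N_def by (intro integral_distr) simp_all
    also have "\<dots> = (LINT x|lborel. g (norm x) * v x)"
      using integral_density[OF _ _ nn(2), of "\<lambda>x. g (norm x)"] by (simp add: mult.commute)
    finally show "(LINT r|lborel. g r * K r) = (LINT x|lborel. g (norm x) * v x)" .
  qed (use K Ki in auto)
qed

text \<open>The positive and negative parts of a Borel version are pushed forward separately. Both
  inherit the integrability of \<open>g (norm x) * v x\<close>, being bounded by it in absolute
  value, so the two densities may be subtracted.\<close>

lemma radial_pushforward:
  fixes v :: "'a::euclidean_space \<Rightarrow> real"
  assumes "integrable lebesgue v"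
  obtains K where "K \<in> borel_measurable borel" "integrable lebesgue K"
    "\<And>g :: real \<Rightarrow> real. g \<in> borel_measurable borel \<Longrightarrow> integrable lebesgue (\<lambda>x. g (norm x) * v x) \<Longrightarrow>
       (\<lambda>r. g r * K r) absolutely_integrable_on {0<..} \<and>
       (LINT x|lebesgue. g (norm x) * v x) = (LINT r:{0<..}|lebesgue. g r * K r)"
proof -
  have "v absolutely_integrable_on UNIV" using assms by (simp add: set_integrable_def)
  then obtain v' where v'[measurable]: "v' \<in> borel_measurable borel" and v'i: "integrable lborel v'"
    and AE: "AE x in lebesgue. v' x = v x"
    using borel_version[of UNIV v] by auto
  let ?p = "\<lambda>x. max 0 (v' x)" and ?n = "\<lambda>x. max 0 (- v' x)"
  have pi: "integrable lborel ?p" and ni: "integrable lborel ?n" using v'i by auto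
  obtain Kp where Kp: "Kp \<in> borel_measurable borel" "integrable lborel Kp" "\<And>r. r \<le> 0 \<Longrightarrow> Kp r = 0"
    "\<And>g :: real \<Rightarrow> real. g \<in> borel_measurable borel \<Longrightarrow>
       integrable lborel (\<lambda>r. g r * Kp r) \<longleftrightarrow> integrable lborel (\<lambda>x. g (norm x) * ?p x)"
    "\<And>g :: real \<Rightarrow> real. g \<in> borel_measurable borel \<Longrightarrow>
       (LINT r|lborel. g r * Kp r) = (LINT x|lborel. g (norm x) * ?p x)"
    using radial_pushforward_nonneg[OF _ _ pi] by auto
  obtain Kn where Kn: "Kn \<in> borel_measurable borel" "integrable lborel Kn" "\<And>r. r \<le> 0 \<Longrightarrow> Kn r = 0"
    "\<And>g :: real \<Rightarrow> real. g \<in> borel_measurable borel \<Longrightarrow>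
       integrable lborel (\<lambda>r. g r * Kn r) \<longleftrightarrow> integrable lborel (\<lambda>x. g (norm x) * ?n x)"
    "\<And>g :: real \<Rightarrow> real. g \<in> borel_measurable borel \<Longrightarrow>
       (LINT r|lborel. g r * Kn r) = (LINT x|lborel. g (norm x) * ?n x)"
    using radial_pushforward_nonneg[OF _ _ ni] by auto
  note [measurable] = Kp(1) Kn(1)
  define K where "K r = Kp r - Kn r" for r
  have K[measurable]: "K \<in> borel_measurable borel" unfolding K_def[abs_def] by measurable
  show ?thesis
  proof (rule that[OF K])
    have "integrable lborel K" unfolding K_def[abs_def] using Kp(2) Kn(2) by simp
    then show "integrable lebesgue K" using K by (simp add: integrable_completion)
    fix g :: "real \<Rightarrow> real" assume g[measurable]: "g \<in> borel_measurable borel"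
      and gi: "integrable lebesgue (\<lambda>x. g (norm x) * v x)"
    have AE': "AE x in lebesgue. g (norm x) * v' x = g (norm x) * v x" using AE by eventually_elim simp
    have m: "(\<lambda>x. g (norm x) * v' x) \<in> borel_measurable lborel" by measurable
    have m': "(\<lambda>x. g (norm x) * v' x) \<in> borel_measurable lebesgue" using m by (simp add: measurable_completion)
    have gi': "integrable lborel (\<lambda>x. g (norm x) * v' x)"
      using gi integrable_cong_AE[OF m' borel_measurable_integrable[OF gi] AE'] m by (simp add: integrable_completion)
    have gp: "integrable lborel (\<lambda>x. g (norm x) * ?p x)"
      by (rule Bochner_Integration.integrable_bound[OF gi']) (auto simp: abs_mult intro!: mult_left_mono)
    have gn: "integrable lborel (\<lambda>x. g (norm x) * ?n x)"
      by (rule Bochner_Integration.integrable_bound[OF gi']) (auto simp: abs_mult intro!: mult_left_mono)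
    have eqK: "(\<lambda>r. indicator {0<..} r *\<^sub>R (g r * K r)) = (\<lambda>r. g r * Kp r - g r * Kn r)"
      using Kp(3) Kn(3) by (auto simp: K_def indicator_def fun_eq_iff right_diff_distrib not_less)
    have i: "integrable lborel (\<lambda>r. g r * Kp r)" "integrable lborel (\<lambda>r. g r * Kn r)"
      using gp gn Kp(4) Kn(4) by auto
    have mK: "(\<lambda>r. g r * Kp r - g r * Kn r) \<in> borel_measurable lborel" by measurable
    have "(LINT x|lebesgue. g (norm x) * v x) = (LINT x|lborel. g (norm x) * v' x)"
      using integral_cong_AE[OF m' borel_measurable_integrable[OF gi] AE'] m by (simp add: integral_completion)
    also have "\<dots> = (LINT x|lborel. g (norm x) * ?p x - g (norm x) * ?n x)"
      by (intro Bochner_Integration.integral_cong) (auto simp: max_def)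
    also have "\<dots> = (LINT r|lborel. g r * Kp r - g r * Kn r)"
      using gp gn i Kp(5) Kn(5) by simp
    also have "\<dots> = (LINT r:{0<..}|lebesgue. g r * K r)"
      unfolding set_lebesgue_integral_def eqK using mK by (simp add: integral_completion)
    finally show "(\<lambda>r. g r * K r) absolutely_integrable_on {0<..} \<and>
       (LINT x|lebesgue. g (norm x) * v x) = (LINT r:{0<..}|lebesgue. g r * K r)"
      unfolding set_integrable_def eqK using mK i by (simp add: integrable_completion)
  qed
qed

section \<open>Partial derivatives of test functions\<close>

lemma test_function_deriv:
  assumes "test_function S \<phi>" "b \<in> Basis"
  shows "test_function S (\<lambda>x. frechet_derivative \<phi> (at x) b)"
proof -
  obtain K where K: "compact K" "K \<subseteq> S" "\<And>x. x \<notin> K \<Longrightarrow> \<phi> x = 0" using test_functionE[OF assms(1)] by metis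
  have Ck: "Ck k \<phi>" for k using assms(1) by (simp add: test_function_def)
  have "frechet_derivative \<phi> (at x) b = 0" if "x \<notin> K" for x
  proof -
    have "((\<lambda>_. 0) has_derivative (\<lambda>_. 0)) (at x)" by simp
    then have "(\<phi> has_derivative (\<lambda>_. 0)) (at x)"
      by (rule has_derivative_transform_within_open[of _ _ _ _ "- K"])
        (use that K in \<open>auto simp: compact_imp_closed\<close>)
    then show ?thesis by (simp add: frechet_derivative_at[symmetric])
  qed
  then show ?thesis
    using K Ck_SucD(2)[OF Ck assms(2)] by (intro test_functionI[where K = K])
qed

lemma test_function_props:
  assumes "test_function S \<phi>"
  shows "continuous_on A \<phi>" "\<phi> \<in> borel_measurable borel" "integrable lebesgue \<phi>" "\<exists>C. \<forall>x. \<bar>\<phi> x\<bar> \<le> C"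
    "(\<phi> has_derivative frechet_derivative \<phi> (at x)) (at x)"
proof -
  have "Ck 0 \<phi>" using assms by (simp add: test_function_def del: Ck.simps)
  then have c: "continuous_on UNIV \<phi>" by simp
  then show "continuous_on A \<phi>" by (rule continuous_on_subset) simp
  then show "\<phi> \<in> borel_measurable borel" using c by (intro borel_measurable_continuous_onI)
  obtain K where K: "compact K" "K \<subseteq> S" "\<And>x. x \<notin> K \<Longrightarrow> \<phi> x = 0" using test_functionE[OF assms] by metis
  have "bounded (\<phi> ` K)"
    using K(1) c by (meson compact_continuous_image compact_imp_bounded continuous_on_subset subset_UNIV)
  then obtain C where "\<And>x. x \<in> K \<Longrightarrow> \<bar>\<phi> x\<bar> \<le> C" by (auto simp: bounded_iff)
  then show "\<exists>C. \<forall>x. \<bar>\<phi> x\<bar> \<le> C" using K(3) by (intro exI[of _ "max C 0"]) (metis abs_zero max.coboundedI1 max.cobounded2)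
  obtain a where a: "K \<subseteq> cbox (-a) a" using K(1) bounded_subset_cbox_symmetric compact_imp_bounded by metis
  have "\<phi> absolutely_integrable_on cbox (-a) a"
    using c by (intro absolutely_integrable_continuous) (rule continuous_on_subset, auto)
  moreover have "(\<lambda>x. indicator (cbox (-a) a) x *\<^sub>R \<phi> x) = \<phi>"
    using a K(3) by (auto simp: indicator_def fun_eq_iff)
  ultimately show "integrable lebesgue \<phi>" by (simp add: set_integrable_def)
  have "Ck (Suc 0) \<phi>" using assms by (simp add: test_function_def del: Ck.simps)
  then show "(\<phi> has_derivative frechet_derivative \<phi> (at x)) (at x)" by (rule Ck_SucD(1))
qed

text \<open>Translation invariance makes the integrals of the difference quotients vanish.\<close>

lemma integral_partial_derivative_zero:
  fixes \<phi> :: "'a::euclidean_space \<Rightarrow> real"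
  assumes \<phi>: "test_function UNIV \<phi>" and b: "b \<in> Basis"
  shows "(LINT x|lebesgue. frechet_derivative \<phi> (at x) b) = 0"
proof -
  define D where "D x = frechet_derivative \<phi> (at x) b" for x
  define h where "h n = inverse (real (Suc n))" for n
  define q where "q n x = (\<phi> (x + h n *\<^sub>R b) - \<phi> x) / h n" for n x
  have D: "test_function UNIV D" unfolding D_def[abs_def] by (rule test_function_deriv[OF \<phi> b])
  have h: "0 < h n" "h n \<le> 1" for n by (auto simp: h_def divide_simps)
  have line: "((\<lambda>s. \<phi> (x + s *\<^sub>R b)) has_real_derivative D (x + s *\<^sub>R b)) (at s)" for x s
  proof -
    have "((\<lambda>s. x + s *\<^sub>R b) has_derivative (\<lambda>t. t *\<^sub>R b)) (at s)" by (auto intro!: derivative_eq_intros)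
    from has_derivative_compose[OF this test_function_props(5)[OF \<phi>]]
    have "((\<lambda>s. \<phi> (x + s *\<^sub>R b)) has_derivative (\<lambda>t. frechet_derivative \<phi> (at (x + s *\<^sub>R b)) (t *\<^sub>R b))) (at s)" .
    moreover have "frechet_derivative \<phi> (at y) (t *\<^sub>R b) = D y * t" for y t
      using linear_cmul[OF has_derivative_linear[OF test_function_props(5)[OF \<phi>]], of y t b] by (simp add: D_def)
    ultimately show ?thesis by (simp add: has_field_derivative_def)
  qed
  obtain C where C: "\<And>x. \<bar>D x\<bar> \<le> C" using test_function_props(4)[OF D] by blast
  obtain K where K: "compact K" "\<And>x. x \<notin> K \<Longrightarrow> \<phi> x = 0" using test_functionE[OF \<phi>] by metis
  obtain M where M: "K \<subseteq> cball 0 M"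
    using compact_imp_bounded[OF K(1)] unfolding bounded_iff by (auto simp: subset_iff)
  have \<phi>m[measurable]: "\<phi> \<in> borel_measurable borel" and \<phi>i: "integrable lborel \<phi>"
    using test_function_props(2,3)[OF \<phi>] by (auto simp: integrable_completion)
  have transl: "integrable lborel (\<lambda>x. \<phi> (x + c))" "(LINT x|lborel. \<phi> (x + c)) = (LINT x|lborel. \<phi> x)" for c
  proof -
    have *: "distr lborel borel ((+) c) = (lborel :: 'a measure)" by (rule lborel_distr_plus)
    show "integrable lborel (\<lambda>x. \<phi> (x + c))"
      using integrable_distr_eq[of "(+) c" lborel borel \<phi>] \<phi>i unfolding * by (simp add: add.commute)
    show "(LINT x|lborel. \<phi> (x + c)) = (LINT x|lborel. \<phi> x)"
      using integral_distr[of "(+) c" lborel borel \<phi>] unfolding * by (simp add: add.commute)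
  qed
  have q0: "(LINT x|lborel. q n x) = 0" for n
    unfolding q_def using transl \<phi>i by simp
  have "(\<lambda>n. LINT x|lborel. q n x) \<longlonglongrightarrow> (LINT x|lborel. D x)"
  \<comment> \<open>By the mean value theorem the quotients are bounded by \<open>C\<close>. As the
    step \<open>h n\<close> is at most 1, they vanish outside the ball of radius
    \<open>M + 1\<close>.\<close>
  proof (rule integral_dominated_convergence[where w = "\<lambda>x. C * indicator (cball 0 (M + 1)) x"])
    show "D \<in> borel_measurable lborel" using test_function_props(2)[OF D] by simp
    show "q n \<in> borel_measurable lborel" for n unfolding q_def[abs_def] by measurable
    show "integrable lborel (\<lambda>x::'a. C * indicator (cball 0 (M + 1)) x)"
      using emeasure_lborel_cball_finite[of "0::'a" "M + 1"]
      by (intro integrable_mult_right integrable_real_indicator) (auto simp: less_top)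
    show "AE x in lborel. (\<lambda>n. q n x) \<longlonglongrightarrow> D x"
    proof (intro AE_I2)
      fix x
      have "((\<lambda>t. (\<phi> (x + t *\<^sub>R b) - \<phi> x) / t) \<longlongrightarrow> D x) (at 0)"
        using line[of x 0] by (simp add: has_field_derivative_iff)
      moreover have "filterlim h (at 0) sequentially"
        unfolding filterlim_at using h LIMSEQ_inverse_real_of_nat
        by (auto simp: h_def[abs_def] intro!: always_eventually)
      ultimately show "(\<lambda>n. q n x) \<longlonglongrightarrow> D x"
        unfolding q_def by (rule filterlim_compose)
    qed
    show "AE x in lborel. norm (q n x) \<le> C * indicator (cball 0 (M + 1)) x" for n
    proof (intro AE_I2)
      fix x
      have "\<exists>z. 0 < z \<and> z < h n \<and> \<phi> (x + h n *\<^sub>R b) - \<phi> (x + 0 *\<^sub>R b) = (h n - 0) * D (x + z *\<^sub>R b)"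
        using line h by (intro MVT2) auto
      then obtain z where "\<phi> (x + h n *\<^sub>R b) - \<phi> x = h n * D (x + z *\<^sub>R b)" by auto
      then have "q n x = D (x + z *\<^sub>R b)" using h(1)[of n] by (simp add: q_def)
      then have le: "\<bar>q n x\<bar> \<le> C" using C by simp
      show "norm (q n x) \<le> C * indicator (cball 0 (M + 1)) x"
      proof (cases "x \<in> cball 0 (M + 1)")
        case False
        have "norm x \<le> norm (x + h n *\<^sub>R b) + 1"
          using norm_triangle_ineq4[of "x + h n *\<^sub>R b" "h n *\<^sub>R b"] h[of n] b by simp
        then have "x \<notin> K" "x + h n *\<^sub>R b \<notin> K" using False M by (auto simp: subset_iff)
        then show ?thesis using K(2) False by (simp add: q_def indicator_def)
      qed (use le in simp)
    qed
  qed
  then have "(LINT x|lborel. D x) = 0" unfolding q0 by (simp add: LIMSEQ_const_iff)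
  then have "(LINT x|lebesgue. D x) = 0" using test_function_props(2)[OF D] by (simp add: integral_completion)
  then show ?thesis by (simp add: D_def)
qed

section \<open>Weak gradients\<close>


lemma set_integrable_test_function:
  fixes h :: "'a::euclidean_space \<Rightarrow> 'b::euclidean_space" and \<phi> :: "'a \<Rightarrow> real"
  assumes "locally_integrable_on S h" "test_function S \<phi>"
  shows "set_integrable lebesgue S (\<lambda>x. \<phi> x *\<^sub>R h x)"
proof -
  obtain K where K: "compact K" "K \<subseteq> S" "\<And>x. x \<notin> K \<Longrightarrow> \<phi> x = 0" using test_functionE[OF assms(2)] by metis
  show ?thesis by (rule set_integrable_test_mult[OF assms(1) K test_function_props(1)[OF assms(2)]])
qed

lemma set_integral_inner:
  fixes h :: "'a::euclidean_space \<Rightarrow> 'b::euclidean_space"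
  assumes "set_integrable lebesgue S h"
  shows "set_integrable lebesgue S (\<lambda>x. h x \<bullet> b)" "(LINT x:S|lebesgue. h x) \<bullet> b = (LINT x:S|lebesgue. h x \<bullet> b)"
proof -
  have i: "integrable lebesgue (\<lambda>x. indicator S x *\<^sub>R h x)" using assms by (simp add: set_integrable_def)
  show "set_integrable lebesgue S (\<lambda>x. h x \<bullet> b)"
    using integrable_inner_left[OF i, of b] by (simp add: set_integrable_def)
  show "(LINT x:S|lebesgue. h x) \<bullet> b = (LINT x:S|lebesgue. h x \<bullet> b)"
    using integral_inner_left[OF i, of b] by (simp add: set_lebesgue_integral_def)
qed

lemma grad_inner: "b \<in> Basis \<Longrightarrow> grad \<phi> x \<bullet> b = frechet_derivative \<phi> (at x) b"
  by (simp add: grad_def inner_sum_left_Basis)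

lemma set_integrable_scaleR_grad:
  fixes f :: "'a::euclidean_space \<Rightarrow> real"
  assumes "locally_integrable_on S f" "test_function S \<phi>"
  shows "set_integrable lebesgue S (\<lambda>x. f x *\<^sub>R grad \<phi> x)"
proof -
  have "set_integrable lebesgue S (\<lambda>x. (frechet_derivative \<phi> (at x) b *\<^sub>R f x) *\<^sub>R b)" if "b \<in> Basis" for b :: 'a
    using set_integrable_test_function[OF assms(1) test_function_deriv[OF assms(2) that]]
      integrable_scaleR_left[of b lebesgue "\<lambda>x. indicator S x *\<^sub>R (frechet_derivative \<phi> (at x) b *\<^sub>R f x)"]
    by (simp add: set_integrable_def mult.assoc)
  then have "set_integrable lebesgue S (\<lambda>x. \<Sum>b\<in>Basis. (frechet_derivative \<phi> (at x) b *\<^sub>R f x) *\<^sub>R b)"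
    unfolding set_integrable_def scaleR_sum_right by (intro Bochner_Integration.integrable_sum)
  then show ?thesis
    by (simp add: grad_def scaleR_sum_right mult.commute)
qed

lemma weak_gradient_component:
  assumes "has_weak_gradient S f g" "test_function S \<phi>" "b \<in> Basis"
  shows "(LINT x:S|lebesgue. f x * frechet_derivative \<phi> (at x) b) = - (LINT x:S|lebesgue. \<phi> x * (g x \<bullet> b))"
proof -
  have f: "locally_integrable_on S f" and g: "locally_integrable_on S g"
    and eq: "(LINT x:S|lebesgue. f x *\<^sub>R grad \<phi> x) = - (LINT x:S|lebesgue. \<phi> x *\<^sub>R g x)"
    using assms by (auto simp: has_weak_gradient_def)
  show ?thesis
    using arg_cong[OF eq, of "\<lambda>v. v \<bullet> b"]
      set_integral_inner(2)[OF set_integrable_scaleR_grad[OF f assms(2)], of b]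
      set_integral_inner(2)[OF set_integrable_test_function[OF g assms(2)], of b]
    by (simp add: grad_inner[OF assms(3)])
qed

lemma has_weak_gradientI:
  assumes f: "locally_integrable_on S f" and g: "locally_integrable_on S g"
    and eq: "\<And>\<phi> b. test_function S \<phi> \<Longrightarrow> b \<in> Basis \<Longrightarrow>
      (LINT x:S|lebesgue. f x * frechet_derivative \<phi> (at x) b) = - (LINT x:S|lebesgue. \<phi> x * (g x \<bullet> b))"
  shows "has_weak_gradient S f g"
  unfolding has_weak_gradient_def
proof (intro conjI f g allI impI, rule euclidean_eqI)
  fix \<phi> and b :: 'a assume \<phi>: "test_function S \<phi>" and b: "b \<in> Basis"
  show "(LINT x:S|lebesgue. f x *\<^sub>R grad \<phi> x) \<bullet> b = (- (LINT x:S|lebesgue. \<phi> x *\<^sub>R g x)) \<bullet> b"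
    using eq[OF \<phi> b] set_integral_inner(2)[OF set_integrable_scaleR_grad[OF f \<phi>], of b]
      set_integral_inner(2)[OF set_integrable_test_function[OF g \<phi>], of b]
    by (simp add: grad_inner[OF b])
qed

text \<open>Each component of the difference is annihilated by all test functions. This ties the
  chosen \<open>weak_gradient\<close> to any gradient that has been computed.\<close>

lemma has_weak_gradient_unique:
  assumes "open S" "has_weak_gradient S f g" "has_weak_gradient S f g'"
  shows "AE x in lebesgue. x \<in> S \<longrightarrow> g x = g' x"
proof -
  have loc: "locally_integrable_on S g" "locally_integrable_on S g'"
    using assms by (auto simp: has_weak_gradient_def)
  have "AE x in lebesgue. x \<in> S \<longrightarrow> (g x - g' x) \<bullet> b = 0" if b: "b \<in> Basis" for b
  proof (rule AE_zero_if_test_integrals_zero[OF assms(1)])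
    show "locally_integrable_on S (\<lambda>x. (g x - g' x) \<bullet> b)"
      using locally_integrable_diff[OF loc] set_integral_inner(1) unfolding locally_integrable_on_def by blast
    fix \<phi> :: "'a \<Rightarrow> real" assume \<phi>: "test_function S \<phi>"
    have i: "set_integrable lebesgue S (\<lambda>x. \<phi> x * (g x \<bullet> b))" "set_integrable lebesgue S (\<lambda>x. \<phi> x * (g' x \<bullet> b))"
      using set_integral_inner(1)[OF set_integrable_test_function[OF loc(1) \<phi>], of b]
        set_integral_inner(1)[OF set_integrable_test_function[OF loc(2) \<phi>], of b] by simp_all
    then have "(LINT x:S|lebesgue. \<phi> x * ((g x - g' x) \<bullet> b)) =
        (LINT x:S|lebesgue. \<phi> x * (g x \<bullet> b)) - (LINT x:S|lebesgue. \<phi> x * (g' x \<bullet> b))"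
      by (simp add: inner_diff_left right_diff_distrib set_integral_diff)
    then show "(LINT x:S|lebesgue. \<phi> x * ((g x - g' x) \<bullet> b)) = 0"
      using weak_gradient_component[OF assms(2) \<phi> b] weak_gradient_component[OF assms(3) \<phi> b] by simp
  qed
  then have "AE x in lebesgue. \<forall>b\<in>Basis. x \<in> S \<longrightarrow> (g x - g' x) \<bullet> b = 0"
    unfolding AE_ball_countable[OF countable_finite[OF finite_Basis]] by blast
  then show ?thesis
  proof eventually_elim
    case (elim x)
    then show ?case by (intro impI euclidean_eqI[of "g x"]) (simp add: inner_diff_left)
  qed
qed

lemma weakly_differentiableD:
  "weakly_differentiable_on S f \<Longrightarrow> has_weak_gradient S f (weak_gradient S f)"
  unfolding weakly_differentiable_on_def weak_gradient_def by (rule someI_ex[of "has_weak_gradient S f"])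

lemma weak_gradient_eq:
  assumes "open S" "has_weak_gradient S f g"
  shows "weakly_differentiable_on S f" "AE x in lebesgue. x \<in> S \<longrightarrow> weak_gradient S f x = g x"
proof -
  show "weakly_differentiable_on S f" using assms(2) by (auto simp: weakly_differentiable_on_def)
  then show "AE x in lebesgue. x \<in> S \<longrightarrow> weak_gradient S f x = g x"
    using has_weak_gradient_unique[OF assms(1) weakly_differentiableD assms(2)] by simp
qed

lemma frechet_derivative_test_real:
  assumes "test_on I \<phi>"
  shows "frechet_derivative \<phi> (at x) h = deriv \<phi> x * h"
  using assms by (intro Ck_real_SucD(3)[of 0]) (simp add: test_on_def del: Ck.simps)

lemma has_weak_gradient_real_iff:
  fixes I :: "real set"
  assumes "is_interval I" "I \<noteq> {}"
  shows "has_weak_gradient I f g \<longleftrightarrow> locally_integrable_on I f \<and> locally_integrable_on I g \<and>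
    (\<forall>\<phi>. test_on I \<phi> \<longrightarrow> (LINT x:I|lebesgue. deriv \<phi> x * f x) = - (LINT x:I|lebesgue. \<phi> x * g x))"
proof -
  have "f x *\<^sub>R grad \<phi> x = deriv \<phi> x * f x" if "test_on I \<phi>" for \<phi> x
    using frechet_derivative_test_real[OF that] by (simp add: grad_def)
  then have "(LINT x:I|lebesgue. f x *\<^sub>R grad \<phi> x) = (LINT x:I|lebesgue. deriv \<phi> x * f x)"
    if "test_on I \<phi>" for \<phi> using that by (simp only:)
  then show ?thesis
    unfolding has_weak_gradient_def test_function_iff_test_on[OF assms] by simp
qed

lemma has_weak_gradient_ac:
  assumes "is_interval I" "I \<noteq> {}" "ac I F f"
  shows "has_weak_gradient I F f"
  using assms ac_locally_integrable[OF assms(3,1)] ac_weak(1)[OF assms(3)]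
  by (simp add: has_weak_gradient_real_iff)

section \<open>From almost everywhere to everywhere, and signs of derivatives\<close>

lemma dense_AE:
  assumes "AE x in lebesgue. x \<in> {a<..<b::real} \<longrightarrow> P x" "a < b"
  shows "\<exists>x\<in>{a<..<b}. P x"
proof (rule ccontr)
  assume *: "\<not> ?thesis"
  have "AE x in lebesgue. x \<notin> {a<..<b}"
    using assms(1) by eventually_elim (use * in auto)
  then have "emeasure lebesgue {a<..<b} = 0"
    by (subst (asm) AE_iff_null_sets[symmetric]) auto
  then show False using assms(2) by simp
qed

lemma continuous_AE_eq:
  fixes f g :: "real \<Rightarrow> real"
  assumes "open I" "continuous_on I f" "continuous_on I g" "AE x in lebesgue. x \<in> I \<longrightarrow> f x = g x" "x \<in> I"
  shows "f x = g x"
proof (rule ccontr)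
  assume "f x \<noteq> g x"
  have "open {y \<in> I. f y \<noteq> g y}"
  proof -
    have "open (I \<inter> (\<lambda>y. f y - g y) -` (- {0}))"
      using assms(1-3) by (intro continuous_open_preimage continuous_intros) auto
    moreover have "I \<inter> (\<lambda>y. f y - g y) -` (- {0}) = {y \<in> I. f y \<noteq> g y}" by auto
    ultimately show ?thesis by simp
  qed
  then obtain e where e: "e > 0" "ball x e \<subseteq> {y \<in> I. f y \<noteq> g y}"
    using \<open>f x \<noteq> g x\<close> assms(5) open_contains_ball_eq by blast
  have sub: "{x - e<..<x + e} \<subseteq> {y \<in> I. f y \<noteq> g y}" using e(2) by (simp add: ball_eq_greaterThanLessThan)
  have "\<exists>y\<in>{x - e<..<x + e}. f y = g y"
    using assms(4) sub e(1) by (intro dense_AE) (auto elim!: eventually_mono)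
  then show False using sub by auto
qed

text \<open>Points of agreement are dense. If \<open>u x > F x\<close>, such a point slightly to the
  left has \<open>u\<close> at least \<open>u x\<close> but \<open>F\<close> close to
  \<open>F x\<close>; if \<open>u x < F x\<close>, a point to the right gives the same conflict.
  Hence a monotone function already is its continuous representative.\<close>

lemma antimono_AE_eq_continuous:
  fixes F u :: "real \<Rightarrow> real"
  assumes I: "open I" and anti: "\<And>x y. x \<in> I \<Longrightarrow> y \<in> I \<Longrightarrow> x \<le> y \<Longrightarrow> u y \<le> u x"
    and F: "continuous_on I F" and AE: "AE x in lebesgue. x \<in> I \<longrightarrow> F x = u x" and x: "x \<in> I"
  shows "u x = F x"
proof (rule ccontr)
  assume ne: "u x \<noteq> F x"
  obtain e where e: "e > 0" "ball x e \<subseteq> I" using I x open_contains_ball_eq by blast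
  have "isCont F x" using F I x continuous_on_eq_continuous_at by blast
  then obtain d where d: "d > 0" "\<And>y. dist y x < d \<Longrightarrow> dist (F y) (F x) < dist (u x) (F x)"
    using ne unfolding continuous_at_eps_delta by (metis dist_pos_lt)
  define m where "m = min d e"
  have m: "0 < m" "m \<le> d" "m \<le> e" using d e by (auto simp: m_def)
  have sub: "{x - m<..<x + m} \<subseteq> I" using e(2) m by (auto simp: subset_iff dist_real_def)
  have pick: "\<exists>y\<in>{a<..<b}. F y = u y" if "{a<..<b} \<subseteq> {x - m<..<x + m}" "a < b" for a b
    using AE sub that by (intro dense_AE) (auto elim!: eventually_mono)
  show False
  proof (cases "u x > F x")
    case True
    obtain y where y: "y \<in> {x - m<..<x}" "F y = u y"
      using pick[of "x - m" x] m(1) by (auto simp: subset_iff)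
    have "y \<in> I" using y sub m(1) by (auto simp: subset_iff)
    then have "u x \<le> u y" using anti[of y x] y x by auto
    moreover have "dist (F y) (F x) < dist (u x) (F x)" using y m d(2)[of y] by (auto simp: dist_real_def)
    ultimately show False using y True by (auto simp: dist_real_def)
  next
    case False
    obtain y where y: "y \<in> {x<..<x + m}" "F y = u y"
      using pick[of x "x + m"] m(1) by (auto simp: subset_iff)
    have "y \<in> I" using y sub m(1) by (auto simp: subset_iff)
    then have "u y \<le> u x" using anti[of x y] y x by auto
    moreover have "dist (F y) (F x) < dist (u x) (F x)" using y m d(2)[of y] by (auto simp: dist_real_def)
    ultimately show False using y False ne by (auto simp: dist_real_def)
  qed
qed

text \<open>By Lebesgue differentiation the density is almost everywhere a limit of difference
  quotients of \<open>u\<close>, and these are non-positive. Compact boxes covering \<open>I\<close>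
  globalise the local statement.\<close>

lemma ac_antimono_AE_nonpos:
  assumes u: "ac I u g" and anti: "\<And>x y. x \<in> I \<Longrightarrow> y \<in> I \<Longrightarrow> x \<le> y \<Longrightarrow> u y \<le> u x" and "open I"
  shows "AE x in lebesgue. x \<in> I \<longrightarrow> g x \<le> 0"
proof -
  have box: "AE x in lebesgue. x \<in> {c..d} \<longrightarrow> g x \<le> 0" if sub: "{c..d} \<subseteq> I" for c d
  proof -
    define f where "f x = (if x \<in> {c..d} then g x else 0)" for x
    have "g integrable_on {c..d}"
      using ac_integrable_subinterval[OF u sub] by (rule set_lebesgue_integral_eq_integral)
    then have "f integrable_on UNIV" unfolding f_def by (simp only: integrable_restrict_UNIV)
    then have "\<And>a b. f integrable_on cbox a b" using integrable_on_subcbox by blast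
    then obtain N where N: "negligible N"
      and lim: "\<And>x e. \<lbrakk>x \<notin> N; 0 < e\<rbrakk> \<Longrightarrow> \<exists>d>0. \<forall>t. 0 < t \<and> t < d \<longrightarrow>
          norm (integral (cbox x (x + t *\<^sub>R One)) f /\<^sub>R t ^ DIM(real) - f x) < e"
      using integrable_ccontinuous_explicit[of f] by metis
    have "negligible (N \<union> {d})" using N by (simp add: negligible_Un)
    then show ?thesis
    proof (rule AE_negligible, intro impI)
      fix x assume "x \<notin> N \<union> {d}" "x \<in> {c..d}"
      then have x: "x \<notin> N" "c \<le> x" "x < d" by auto
      show "g x \<le> 0"
      proof (rule ccontr)
        assume "\<not> g x \<le> 0"
        then have fx: "0 < f x" "f x = g x" using x by (auto simp: f_def)
        from lim[OF x(1) fx(1)] obtain e where e: "e > 0" "\<And>t. 0 < t \<and> t < e \<Longrightarrow>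
          \<bar>integral {x..x + t} f / t - f x\<bar> < f x" by (auto simp: divide_inverse mult.commute)
        define t where "t = min (e / 2) (d - x)"
        have t: "0 < t" "t < e" "x + t \<le> d" using e(1) x by (auto simp: t_def)
        have sub': "{x..x + t} \<subseteq> I" using sub x t by auto
        have "integral {x..x + t} f = integral {x..x + t} g"
          using x t by (intro Henstock_Kurzweil_Integration.integral_cong) (auto simp: f_def)
        also have "\<dots> = u (x + t) - u x" using acD(2)[OF u _ sub'] t(1) by simp
        also have "\<dots> \<le> 0" using anti[of x "x + t"] sub' t(1) by (auto simp: subset_iff)
        finally have "integral {x..x + t} f / t \<le> 0" using t(1) by (simp add: divide_nonpos_pos)
        then show False using e(2)[of t] t by auto
      qed
    qed
  qed
  obtain \<D> where D: "countable \<D>" "\<Union>\<D> = I" "\<And>X. X \<in> \<D> \<Longrightarrow> X \<subseteq> I" "\<And>X. X \<in> \<D> \<Longrightarrow> \<exists>a b. X = cbox a b"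
    using open_countable_Union_open_cbox[OF \<open>open I\<close>] by (metis Pow_iff subsetD)
  have "AE x in lebesgue. \<forall>X\<in>\<D>. x \<in> X \<longrightarrow> g x \<le> 0"
    unfolding AE_ball_countable[OF D(1)] using box D(3,4) by (metis box_real(2))
  then show ?thesis using D(2) by auto
qed

lemma ac_nonpos_antimono:
  assumes "ac I u g" "\<And>r. g r \<le> 0" "a \<le> b" "{a..b} \<subseteq> I"
  shows "u b \<le> u a"
proof -
  have "integral {a..b} g \<le> integral {a..b} (\<lambda>_. 0)"
    using assms set_lebesgue_integral_eq_integral(1)[OF acD(1)[OF assms(1,3,4)]]
    by (intro integral_le) auto
  then show ?thesis using acD(2)[OF assms(1,3,4)] by simp
qed

section \<open>Integrals over open intervals as limits over compact ones\<close>

lemma set_integral_exhaust: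
  fixes h :: "real \<Rightarrow> real"
  assumes h: "h absolutely_integrable_on J" and sub: "\<And>n. {a n..b n} \<subseteq> J"
    and ev: "\<And>x. x \<in> J \<Longrightarrow> \<forall>\<^sub>F n in sequentially. x \<in> {a n..b n}"
  shows "(\<lambda>n. integral {a n..b n} h) \<longlonglongrightarrow> (LINT x:J|lebesgue. h x)"
proof -
  have i: "integrable lebesgue (\<lambda>x. indicator J x *\<^sub>R h x)" using h by (simp add: set_integrable_def)
  have hn: "h absolutely_integrable_on {a n..b n}" for n
    by (rule set_integrable_subset[OF h]) (use sub in auto)
  have "(\<lambda>n. LINT x|lebesgue. indicator {a n..b n} x *\<^sub>R h x) \<longlonglongrightarrow> (LINT x|lebesgue. indicator J x *\<^sub>R h x)"
  proof (rule integral_dominated_convergence[where w = "\<lambda>x. norm (indicator J x *\<^sub>R h x)"])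
    show "AE x in lebesgue. (\<lambda>n. indicator {a n..b n} x *\<^sub>R h x) \<longlonglongrightarrow> indicator J x *\<^sub>R h x"
    proof (intro AE_I2)
      fix x
      have "\<forall>\<^sub>F n in sequentially. indicator {a n..b n} x *\<^sub>R h x = indicator J x *\<^sub>R h x"
      proof (cases "x \<in> J")
        case True
        then show ?thesis by (intro eventually_mono[OF ev[OF True]]) (use True in simp)
      next
        case False
        then have "x \<notin> {a n..b n}" for n using sub by blast
        then show ?thesis using False by (simp add: indicator_def)
      qed
      then show "(\<lambda>n. indicator {a n..b n} x *\<^sub>R h x) \<longlonglongrightarrow> indicator J x *\<^sub>R h x"
        by (rule tendsto_eventually)
    qed
    show "AE x in lebesgue. norm (indicator {a n..b n} x *\<^sub>R h x) \<le> norm (indicator J x *\<^sub>R h x)" for n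
      using sub[of n] by (intro AE_I2) (auto simp: indicator_def)
    show "(\<lambda>x. indicator {a n..b n} x *\<^sub>R h x) \<in> borel_measurable lebesgue" for n
      using hn[of n] unfolding set_integrable_def by (rule borel_measurable_integrable)
    show "(\<lambda>x. indicator J x *\<^sub>R h x) \<in> borel_measurable lebesgue"
      by (rule borel_measurable_integrable[OF i])
    show "integrable lebesgue (\<lambda>x. norm (indicator J x *\<^sub>R h x))" by (rule integrable_norm[OF i])
  qed
  then show ?thesis
    using set_lebesgue_integral_eq_integral(2)[OF hn] by (simp add: set_lebesgue_integral_def)
qed

text \<open>Monotone convergence supplies, for non-negative functions, the integrability up to open
  ends that \<open>set_integral_exhaust\<close> presupposes.\<close>

lemma set_integrable_monotone_exhaust:
  fixes h :: "real \<Rightarrow> real"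
  assumes "h \<in> borel_measurable lebesgue" "J \<in> sets lebesgue" "\<And>x. 0 \<le> h x"
    and hn: "\<And>n. h absolutely_integrable_on {a n..b n}" and sub: "\<And>n. {a n..b n} \<subseteq> J"
    and mono: "\<And>m n. m \<le> n \<Longrightarrow> {a m..b m} \<subseteq> {a n..b n}"
    and ev: "\<And>x. x \<in> J \<Longrightarrow> \<forall>\<^sub>F n in sequentially. x \<in> {a n..b n}"
    and lim: "(\<lambda>n. integral {a n..b n} h) \<longlonglongrightarrow> L"
  shows "h absolutely_integrable_on J"
  unfolding set_integrable_def
proof (rule integrable_monotone_convergence)
  show "integrable lebesgue (\<lambda>x. indicator {a n..b n} x *\<^sub>R h x)" for n
    using hn by (simp add: set_integrable_def)
  show "AE x in lebesgue. mono (\<lambda>n. indicator {a n..b n} x *\<^sub>R h x)"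
  proof (intro AE_I2 monoI)
    fix x and m n :: nat assume "m \<le> n"
    from mono[OF this] have "indicat_real {a m..b m} x \<le> indicator {a n..b n} x"
      by (auto simp: indicator_def simp del: atLeastatMost_subset_iff)
    then show "indicator {a m..b m} x *\<^sub>R h x \<le> indicator {a n..b n} x *\<^sub>R h x"
      using assms(3) by (simp add: mult_right_mono)
  qed
  show "AE x in lebesgue. (\<lambda>n. indicator {a n..b n} x *\<^sub>R h x) \<longlonglongrightarrow> indicator J x *\<^sub>R h x"
  proof (intro AE_I2)
    fix x
    have "\<forall>\<^sub>F n in sequentially. indicator {a n..b n} x *\<^sub>R h x = indicator J x *\<^sub>R h x"
    proof (cases "x \<in> J")
      case True
      then show ?thesis by (intro eventually_mono[OF ev[OF True]]) (use True in simp)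
    next
      case False
      then have "x \<notin> {a n..b n}" for n using sub by blast
      then show ?thesis using False by (simp add: indicator_def)
    qed
    then show "(\<lambda>n. indicator {a n..b n} x *\<^sub>R h x) \<longlonglongrightarrow> indicator J x *\<^sub>R h x"
      by (rule tendsto_eventually)
  qed
  show "(\<lambda>n. LINT x|lebesgue. indicator {a n..b n} x *\<^sub>R h x) \<longlonglongrightarrow> L"
    using lim set_lebesgue_integral_eq_integral(2)[OF hn] by (simp add: set_lebesgue_integral_def)
  show "(\<lambda>x. indicator J x *\<^sub>R h x) \<in> borel_measurable lebesgue"
    using assms(1,2) by (intro borel_measurable_scaleR borel_measurable_indicator)
qed

section \<open>Weak gradients of radial functions\<close>


lemma integrable_bounded_mult:
  fixes f v :: "'a::euclidean_space \<Rightarrow> real"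
  assumes "f \<in> borel_measurable lebesgue" "\<And>x. \<bar>f x\<bar> \<le> C" "integrable lebesgue v"
  shows "integrable lebesgue (\<lambda>x. f x * v x)"
proof (rule Bochner_Integration.integrable_bound)
  show "integrable lebesgue (\<lambda>x. C * v x)" using assms(3) by simp
  show "(\<lambda>x. f x * v x) \<in> borel_measurable lebesgue" using assms by (intro borel_measurable_times) auto
  have "\<bar>f x\<bar> \<le> \<bar>C\<bar>" for x using assms(2)[of x] by linarith
  then show "AE x in lebesgue. norm (f x * v x) \<le> norm (C * v x)"
    by (intro AE_I2) (simp add: abs_mult mult_right_mono)
qed

lemma integrable_imp_locally_integrable:
  assumes "integrable lebesgue f"
  shows "locally_integrable_on S f"
  unfolding locally_integrable_on_def
proof (intro allI impI)
  fix K assume "compact K \<and> K \<subseteq> S"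
  then have K: "K \<in> sets lebesgue" by (simp add: borel_compact)
  have "f absolutely_integrable_on UNIV" using assms by (simp add: set_integrable_def)
  then show "f absolutely_integrable_on K" by (rule set_integrable_subset[OF _ K]) simp
qed

lemma ac_continuous_open:
  assumes "ac I F f" "open I"
  shows "continuous_on I F"
  unfolding continuous_on_eq_continuous_at[OF assms(2)]
proof
  fix x assume "x \<in> I"
  then obtain e where e: "e > 0" "cball x e \<subseteq> I" using assms(2) open_contains_cball by blast
  then have "continuous_on {x - e..x + e} F"
    by (intro ac_continuous[OF assms(1)]) (simp add: cball_eq_atLeastAtMost)
  then show "isCont F x" using e(1) by (intro continuous_on_interior[of "{x - e..x + e}"]) auto
qed

lemma ac_positive_borel:
  assumes "ac {0<..} u g"
  shows "(\<lambda>r. indicator {0<..} r *\<^sub>R u r) \<in> borel_measurable borel"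
  by (intro borel_measurable_continuous_on_indicator ac_continuous_open[OF assms]) simp_all

lemma reciprocal_exhaust: "0 < (x::real) \<Longrightarrow> \<forall>\<^sub>F n in sequentially. 1 / real (Suc n) \<le> x"
proof -
  assume "0 < x"
  have "(\<lambda>n. 1 / real (Suc n)) \<longlonglongrightarrow> 0" using LIMSEQ_inverse_real_of_nat by (simp add: inverse_eq_divide)
  from order_tendstoD(2)[OF this \<open>0 < x\<close>] show ?thesis by (auto elim!: eventually_mono)
qed

lemma reciprocal_at_right: "filterlim (\<lambda>n. 1 / real (Suc n)) (at_right 0) sequentially"
  using LIMSEQ_inverse_real_of_nat unfolding filterlim_at by (simp add: inverse_eq_divide)

lemma ac_nonpos_le_limit:
  assumes u: "ac {0<..} u g" and g: "\<And>r. g r \<le> 0" and lim: "(u \<longlongrightarrow> L) (at_right 0)" and r: "0 < r"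
  shows "u r \<le> L"
proof (rule tendsto_lowerbound[OF lim])
  have "u r \<le> u s" if "0 < s" "s < r" for s
    using that by (intro ac_nonpos_antimono[OF u g]) auto
  then show "\<forall>\<^sub>F s in at_right 0. u r \<le> u s"
    using r eventually_at_right_real[of 0 r] by (auto elim!: eventually_mono)
qed simp

text \<open>As \<open>g\<close> has a sign, the integral of \<open>|g|\<close> over
  \<open>[\<epsilon>, M]\<close> is \<open>u \<epsilon> - u M\<close>, which converges to
  \<open>L - u M\<close>.\<close>

lemma ac_nonpos_integrable_at_zero:
  assumes u: "ac {0<..} u g" and gm: "g \<in> borel_measurable borel" and g: "\<And>r. g r \<le> 0"
    and lim: "(u \<longlongrightarrow> L) (at_right 0)"
  shows "g absolutely_integrable_on {0<..M}"
proof -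
  define a where "a n = 1 / real (Suc n)" for n
  have a: "0 < a n" for n by (simp add: a_def)
  have gi: "g absolutely_integrable_on {a n..M}" for n
    using a[of n] by (intro ac_integrable_subinterval[OF u]) auto
  have "(\<lambda>r. - g r) absolutely_integrable_on {0<..M}"
  proof (rule set_integrable_monotone_exhaust)
    show "(\<lambda>r. - g r) \<in> borel_measurable lebesgue" using gm by (intro borel_measurable_lebesgueI) simp
    show "(\<lambda>r. - g r) absolutely_integrable_on {a n..M}" for n
      using set_integrable_mult_right[of "-1" lebesgue "{a n..M}" g] gi[of n] by simp
    show "{a n..M} \<subseteq> {0<..M}" for n using a[of n] by auto
    show "{a m..M} \<subseteq> {a n..M}" if "m \<le> n" for m n using that by (auto simp: a_def field_simps intro: order_trans[rotated])
    show "\<forall>\<^sub>F n in sequentially. x \<in> {a n..M}" if "x \<in> {0<..M}" for x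
      using reciprocal_exhaust[of x] that by (auto simp: a_def)
    \<comment> \<open>For \<open>M \<le> 0\<close> all the intervals are empty.\<close>
    show "(\<lambda>n. integral {a n..M} (\<lambda>r. - g r)) \<longlonglongrightarrow> (if 0 < M then L - u M else 0)"
    proof (cases "0 < M")
      case True
      have "(\<lambda>n. u (a n)) \<longlonglongrightarrow> L"
        using filterlim_compose[OF lim reciprocal_at_right] by (simp add: a_def)
      then have "(\<lambda>n. u (a n) - u M) \<longlonglongrightarrow> L - u M" by (intro tendsto_intros)
      moreover have "\<forall>\<^sub>F n in sequentially. u (a n) - u M = integral {a n..M} (\<lambda>r. - g r)"
        using reciprocal_exhaust[OF True]
      proof eventually_elim
        case (elim n)
        then have "a n \<le> M" by (simp add: a_def)
        then have "u M - u (a n) = integral {a n..M} g" using acD(2)[OF u, of "a n" M] a[of n] by (simp add: subset_iff)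
        then show ?case by simp
      qed
      ultimately show ?thesis using True Lim_transform_eventually by auto
    next
      case False
      then have "{a n..M} = {}" for n using a[of n] by auto
      then show ?thesis using False by simp
    qed
  qed (use g in auto)
  then show ?thesis using set_integrable_mult_right[of "-1" lebesgue "{0<..M}" "\<lambda>r. - g r"] by simp
qed

text \<open>On a bounded set the weight \<open>r^(d-1)\<close> is bounded, so integrability of
  \<open>h\<close> in one variable, up to the origin, is enough.\<close>

lemma locally_integrable_radial:
  fixes F :: "'a::euclidean_space \<Rightarrow> 'b::euclidean_space" and h :: "real \<Rightarrow> real"
  assumes h: "h \<in> borel_measurable borel" "\<And>M. h absolutely_integrable_on {0<..M}"
    and F: "F \<in> borel_measurable lebesgue" "\<And>x. x \<noteq> 0 \<Longrightarrow> norm (F x) \<le> \<bar>h (norm x)\<bar>"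
  shows "locally_integrable_on S F"
  unfolding locally_integrable_on_def
proof (intro allI impI)
  fix K assume K: "compact K \<and> K \<subseteq> S"
  then obtain M where M: "\<And>x. x \<in> K \<Longrightarrow> norm x \<le> M"
    using compact_imp_bounded[of K] by (auto simp: bounded_iff)
  let ?d = "DIM('a)"
  have "(\<lambda>r. r ^ (?d - 1) * h r) absolutely_integrable_on {0<..M}"
  proof (rule absolutely_integrable_bounded_measurable_product_real)
    show "(\<lambda>r. r ^ (?d - 1)) \<in> borel_measurable (lebesgue_on {0<..M})"
      by (intro continuous_imp_measurable_on_sets_lebesgue continuous_intros) simp
    show "bounded ((\<lambda>r. r ^ (?d - 1)) ` {0<..M})"
      by (rule bounded_subset[of "{0..M ^ (?d - 1)}"]) (auto intro!: power_mono)
  qed (use h in auto)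
  moreover have "indicator {0<..} r *\<^sub>R (r ^ (?d - 1) * (indicator {..M} r * h r)) = indicator {0<..M} r *\<^sub>R (r ^ (?d - 1) * h r)" for r
    by (auto simp: indicator_def)
  ultimately have "(\<lambda>r. r ^ (?d - 1) * (indicator {..M} r * h r)) absolutely_integrable_on {0<..}"
    by (simp only: set_integrable_def)
  then have int: "integrable lebesgue (\<lambda>x::'a. indicator {..M} (norm x) * h (norm x))"
    using radial_integral(1)[of "\<lambda>r. indicator {..M} r * h r", where 'a = 'a] h(1) by simp
  have Km: "K \<in> sets lebesgue" using K by (simp add: borel_compact)
  show "F absolutely_integrable_on K"
    unfolding set_integrable_def
  proof (rule Bochner_Integration.integrable_bound[OF int])
    show "(\<lambda>x. indicator K x *\<^sub>R F x) \<in> borel_measurable lebesgue"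
      by (intro borel_measurable_scaleR borel_measurable_indicator Km F(1))
    have "AE x::'a in lebesgue. x \<noteq> 0" using AE_lborel_singleton[of 0] by (rule AE_completion)
    then show "AE x in lebesgue. norm (indicator K x *\<^sub>R F x) \<le> norm (indicator {..M} (norm x) * h (norm x))"
      by eventually_elim (use F(2) M in \<open>auto simp: indicator_def\<close>)
  qed
qed

text \<open>Averaging over spheres reduces integration by parts in space to one variable.
  \<open>K1\<close> and \<open>K2\<close> are the radial densities of
  \<open>(x \<bullet> b / norm x) \<phi>\<close> and of the partial derivative of
  \<open>\<phi>\<close>, with \<open>K1' = K2\<close> weakly; then
  \<open>(u F)' = u K2 + g K1\<close> is integrated for the continuous version \<open>F\<close> of
  \<open>K1\<close>. The boundary term vanishes because \<open>F\<close> tends to 0 at the origin,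
  even for \<open>d = 1\<close>, where the points \<open>r\<close> and \<open>- r\<close> enter with
  opposite signs.\<close>

lemma has_weak_gradient_radial:
  fixes u g :: "real \<Rightarrow> real"
  assumes u: "ac {0<..} u g" and g[measurable]: "g \<in> borel_measurable borel" and g0: "\<And>r. g r \<le> 0"
    and lim: "(u \<longlongrightarrow> L) (at_right 0)"
  shows "has_weak_gradient UNIV (\<lambda>x::'a::euclidean_space. u (norm x)) (\<lambda>x. (g (norm x) / norm x) *\<^sub>R x)"
proof -
  define ut where "ut r = indicator {0<..} r *\<^sub>R u r" for r
  define G where "G x = (g (norm x) / norm x) *\<^sub>R x" for x :: 'a
  have ut[measurable]: "ut \<in> borel_measurable borel"
    unfolding ut_def[abs_def] by (rule ac_positive_borel[OF u])
  have ut_int: "ut absolutely_integrable_on {0<..M}" for M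
  proof -
    have "(\<lambda>r. ut r * 1) absolutely_integrable_on {0<..M}"
    proof (rule absolutely_integrable_bounded_measurable_product_real)
      have "{0<..M} \<in> lmeasurable" by (intro bounded_set_imp_lmeasurable) (auto intro: bounded_subset[of "{0..M}"])
      then show "(\<lambda>_. 1::real) absolutely_integrable_on {0<..M}" by (rule absolutely_integrable_on_const)
      show "ut \<in> borel_measurable (lebesgue_on {0<..M})"
        using borel_measurable_lebesgueI[OF ut] by (intro measurable_restrict_space1)
      have "ut r \<in> {u M..L}" if "r \<in> {0<..M}" for r
        using that ac_nonpos_le_limit[OF u g0 lim, of r] ac_nonpos_antimono[OF u g0, of r M]
        by (auto simp: ut_def subset_iff)
      then have "ut ` {0<..M} \<subseteq> {u M..L}" by (rule image_subsetI)
      then show "bounded (ut ` {0<..M})" by (rule bounded_subset[OF bounded_closed_interval])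
      show "{0<..M} \<in> sets lebesgue" by simp
    qed
    then show ?thesis by simp
  qed
  have utx: "(\<lambda>x::'a. ut (norm x)) \<in> borel_measurable borel" by measurable
  have ut_eq: "AE x::'a in lebesgue. ut (norm x) = u (norm x)"
    using AE_nonzero[where 'a = 'a] by eventually_elim (simp add: ut_def)
  have Um: "(\<lambda>x::'a. u (norm x)) \<in> borel_measurable lebesgue"
    by (rule borel_measurable_AE[OF borel_measurable_lebesgueI[OF utx] ut_eq])
  have U: "locally_integrable_on UNIV (\<lambda>x::'a. u (norm x))"
    by (rule locally_integrable_radial[OF ut ut_int Um]) (simp add: ut_def)
  have Ut: "locally_integrable_on UNIV (\<lambda>x::'a. ut (norm x))"
    by (rule locally_integrable_radial[OF ut ut_int borel_measurable_lebesgueI[OF utx]]) simp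
  have Gm: "G \<in> borel_measurable borel" unfolding G_def[abs_def] by measurable
  have G: "locally_integrable_on UNIV G"
    by (rule locally_integrable_radial[OF g ac_nonpos_integrable_at_zero[OF u g g0 lim] borel_measurable_lebesgueI[OF Gm]])
      (simp add: G_def)
  show ?thesis
    unfolding G_def[symmetric]
  proof (rule has_weak_gradientI[OF U G])
    fix \<phi> :: "'a \<Rightarrow> real" and b :: 'a
    assume \<phi>: "test_function UNIV \<phi>" and b: "b \<in> Basis"
    note [measurable] = test_function_props(2)[OF \<phi>]
    define v2 where "v2 x = frechet_derivative \<phi> (at x) b" for x
    define v1 where "v1 x = ((x \<bullet> b) / norm x) * \<phi> x" for x
    have v2t: "test_function UNIV v2" unfolding v2_def[abs_def] by (rule test_function_deriv[OF \<phi> b])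
    have v2: "integrable lebesgue v2" by (rule test_function_props(3)[OF v2t])
    have v1: "integrable lebesgue v1"
      unfolding v1_def
    proof (rule integrable_bounded_mult)
      show "(\<lambda>x. (x \<bullet> b) / norm x) \<in> borel_measurable lebesgue" by (intro borel_measurable_lebesgueI) measurable
      show "\<bar>(x \<bullet> b) / norm x\<bar> \<le> 1" for x
        using Basis_le_norm[OF b, of x] by (cases "x = 0") auto
    qed (rule test_function_props(3)[OF \<phi>])
    obtain K1 where K1[measurable]: "K1 \<in> borel_measurable borel" and K1i: "integrable lebesgue K1"
      and K1p: "\<And>h :: real \<Rightarrow> real. h \<in> borel_measurable borel \<Longrightarrow> integrable lebesgue (\<lambda>x. h (norm x) * v1 x) \<Longrightarrow>
       (\<lambda>r. h r * K1 r) absolutely_integrable_on {0<..} \<and>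
       (LINT x|lebesgue. h (norm x) * v1 x) = (LINT r:{0<..}|lebesgue. h r * K1 r)"
    proof (rule radial_pushforward[OF v1])
      fix K :: "real \<Rightarrow> real"
      assume "K \<in> borel_measurable borel" "integrable lebesgue K"
        "\<And>h :: real \<Rightarrow> real. h \<in> borel_measurable borel \<Longrightarrow> integrable lebesgue (\<lambda>x. h (norm x) * v1 x) \<Longrightarrow>
       (\<lambda>r. h r * K r) absolutely_integrable_on {0<..} \<and>
       (LINT x|lebesgue. h (norm x) * v1 x) = (LINT r:{0<..}|lebesgue. h r * K r)"
      then show thesis by (rule that)
    qed
    obtain K2 where K2[measurable]: "K2 \<in> borel_measurable borel" and K2i: "integrable lebesgue K2"
      and K2p: "\<And>h :: real \<Rightarrow> real. h \<in> borel_measurable borel \<Longrightarrow> integrable lebesgue (\<lambda>x. h (norm x) * v2 x) \<Longrightarrow>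
       (\<lambda>r. h r * K2 r) absolutely_integrable_on {0<..} \<and>
       (LINT x|lebesgue. h (norm x) * v2 x) = (LINT r:{0<..}|lebesgue. h r * K2 r)"
    proof (rule radial_pushforward[OF v2])
      fix K :: "real \<Rightarrow> real"
      assume "K \<in> borel_measurable borel" "integrable lebesgue K"
        "\<And>h :: real \<Rightarrow> real. h \<in> borel_measurable borel \<Longrightarrow> integrable lebesgue (\<lambda>x. h (norm x) * v2 x) \<Longrightarrow>
       (\<lambda>r. h r * K r) absolutely_integrable_on {0<..} \<and>
       (LINT x|lebesgue. h (norm x) * v2 x) = (LINT r:{0<..}|lebesgue. h r * K r)"
      then show thesis by (rule that)
    qed
    \<comment> \<open>The function \<open>\<phi> x * \<eta> (norm x)\<close> is smooth because
      \<open>\<eta>\<close> vanishes near 0. Its partial derivative has integral 0, which is the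
      weak form of \<open>K1' = K2\<close>.\<close>
    have weak: "(LINT r:{0<..}|lebesgue. deriv \<eta> r * K1 r) = - (LINT r:{0<..}|lebesgue. \<eta> r * K2 r)"
      if \<eta>: "test_on {0<..} \<eta>" for \<eta>
    proof -
      have t: "test_function UNIV (\<lambda>x::'a. \<phi> x * \<eta> (norm x))"
        using \<phi> by (intro test_function_radial[OF \<eta>]) (auto simp: test_function_def simp del: Ck.simps)
      have "frechet_derivative (\<lambda>x::'a. \<phi> x * \<eta> (norm x)) (at x) b = deriv \<eta> (norm x) * v1 x + \<eta> (norm x) * v2 x" for x
      proof -
        have "((\<lambda>x::'a. \<phi> x * \<eta> (norm x)) has_derivative (\<lambda>h. \<phi> x * (deriv \<eta> (norm x) * norm x powr (-1) * (h \<bullet> x))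
            + frechet_derivative \<phi> (at x) h * \<eta> (norm x))) (at x)"
          by (intro has_derivative_mult test_function_props(5)[OF \<phi>] has_derivative_radial[OF \<eta>])
        from frechet_derivative_at[OF this, symmetric] show ?thesis
          by (cases "x = 0") (simp_all add: v1_def v2_def powr_minus inner_commute[of b] field_simps)
      qed
      then have "(LINT x|lebesgue. deriv \<eta> (norm x) * v1 x + \<eta> (norm x) * v2 x) = 0"
        using integral_partial_derivative_zero[OF t b] by simp
      moreover have bm: "f \<in> borel_measurable borel" "integrable lebesgue (\<lambda>x. f (norm x) * v x)"
        if "test_on {0<..} f" "integrable lebesgue v" for f and v :: "'a \<Rightarrow> real"
      proof -
        have tf: "test_function {0<..} f" using that(1) by (subst test_function_iff_test_on) (auto simp: is_interval_1)
        show f[measurable]: "f \<in> borel_measurable borel" by (rule test_function_props(2)[OF tf])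
        obtain C where "\<forall>x. \<bar>f x\<bar> \<le> C" using test_function_props(4)[OF tf] by blast
        then show "integrable lebesgue (\<lambda>x. f (norm x) * v x)"
          by (intro integrable_bounded_mult[where C = C] that(2) borel_measurable_lebesgueI) auto
      qed
      note d\<eta> = test_on_deriv(2)[OF \<eta>]
      ultimately show ?thesis
        using K1p[OF bm(1)[OF d\<eta> v1] bm(2)[OF d\<eta> v1]] K2p[OF bm(1)[OF \<eta> v2] bm(2)[OF \<eta> v2]]
          bm(2)[OF d\<eta> v1] bm(2)[OF \<eta> v2] by simp
    qed
    obtain F where F: "ac {0<..} F K2" "AE r in lebesgue. r \<in> {0<..} \<longrightarrow> F r = K1 r"
    proof (rule du_bois_reymond[of "{0<..}" K1 K2])
      show "is_interval {0::real<..}" by (auto simp: is_interval_1)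
    qed (use weak K1i K2i integrable_imp_locally_integrable in auto)
    obtain M where M: "0 < M" "\<And>x. M < norm x \<Longrightarrow> \<phi> x = 0"
    proof -
      obtain K where K: "compact K" "\<And>x. x \<notin> K \<Longrightarrow> \<phi> x = 0" using test_functionE[OF \<phi>] by metis
      obtain M where M: "\<And>x. x \<in> K \<Longrightarrow> norm x \<le> M"
        using compact_imp_bounded[OF K(1)] by (auto simp: bounded_iff)
      have "\<phi> x = 0" if "max M 1 < norm x" for x using that K(2)[of x] M[of x] by (cases "x \<in> K") auto
      then show ?thesis using that[of "max M 1"] by auto
    qed
    have F0: "F r = 0" if "M < r" for r
    proof (rule continuous_AE_eq[of "{M<..}" F "\<lambda>_. 0"])
      have cF: "continuous_on {0<..} F" by (intro ac_continuous_open[OF F(1)]) simp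
      show "continuous_on {M<..} F" by (rule continuous_on_subset[OF cF]) (use M(1) in auto)
      \<comment> \<open>With this weight the transfer formula computes the integral of
        \<open>|K1|\<close> beyond \<open>M\<close>, where \<open>\<phi>\<close> and hence
        \<open>v1\<close> vanish.\<close>
      define h where "h r = indicator {M<..} r * sgn (K1 r)" for r
      have h: "h \<in> borel_measurable borel" unfolding h_def[abs_def] by measurable
      have "h (norm x) * v1 x = 0" for x using M(2)[of x] by (auto simp: h_def v1_def indicator_def)
      then have e: "(\<lambda>x. h (norm x) * v1 x) = (\<lambda>_. 0)" by (rule ext)
      have "(\<lambda>r. h r * K1 r) absolutely_integrable_on {0<..}" "(LINT r:{0<..}|lebesgue. h r * K1 r) = 0"
        using K1p[OF h] unfolding e by simp_all
      then have i: "integrable lebesgue (\<lambda>r. indicator {0<..} r *\<^sub>R (h r * K1 r))" "(LINT r|lebesgue. indicator {0<..} r *\<^sub>R (h r * K1 r)) = 0"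
        by (simp_all only: set_integrable_def set_lebesgue_integral_def)
      have "h r * K1 r = indicator {M<..} r * \<bar>K1 r\<bar>" for r by (simp add: h_def mult_sgn_abs sgn_mult_abs abs_sgn mult.commute[of "sgn _"])
      then have hK: "indicator {0<..} r *\<^sub>R (h r * K1 r) = indicator {M<..} r * \<bar>K1 r\<bar>" for r
        using M(1) by (auto simp: indicator_def)
      have "AE r in lebesgue. indicator {M<..} r * \<bar>K1 r\<bar> = 0"
        using i unfolding hK by (subst (asm) integral_nonneg_eq_0_iff_AE) auto
      then show "AE r in lebesgue. r \<in> {M<..} \<longrightarrow> F r = 0"
        using F(2) by eventually_elim (use M(1) in auto)
    qed (use that in auto)
    define a where "a n = 1 / real (Suc n)" for n
    define c where "c n = M + 1 + real n" for n
    have ac: "0 < a n" "a n \<le> 1" "M < c n" "a n \<le> c n" for n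
    proof -
      show "0 < a n" "a n \<le> 1" "M < c n" by (auto simp: a_def c_def)
      then show "a n \<le> c n" using M(1) by (simp add: c_def)
    qed
    have sub: "{a n..c n} \<subseteq> {0<..}" for n using ac(1)[of n] by auto
    have ev: "\<forall>\<^sub>F n in sequentially. x \<in> {a n..c n}" if "x \<in> {0<..}" for x
    proof -
      have "\<forall>\<^sub>F n in sequentially. a n \<le> x" using reciprocal_exhaust[of x] that by (simp add: a_def)
      moreover have "\<forall>\<^sub>F n in sequentially. x \<le> c n"
      proof -
        obtain N where "x \<le> real N" using real_arch_simple by blast
        then show ?thesis using M(1) by (intro eventually_sequentiallyI[of N]) (simp add: c_def)
      qed
      ultimately show ?thesis by eventually_elim auto
    qed
    \<comment> \<open>Since \<open>F (c n) = 0\<close>, the value \<open>- F (a n)\<close> is the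
      integral of \<open>K2\<close> over \<open>[a n, c n]\<close>. It tends to the integral of a
      partial derivative of \<open>\<phi>\<close> over the whole space, which is 0.\<close>
    have Fa: "(\<lambda>n. F (a n)) \<longlonglongrightarrow> 0"
    proof -
      have "(LINT x|lebesgue. v2 x) = 0"
        unfolding v2_def by (rule integral_partial_derivative_zero[OF \<phi> b])
      then have "K2 absolutely_integrable_on {0<..}" "(LINT r:{0<..}|lebesgue. K2 r) = 0"
        using K2p[of "\<lambda>_. 1"] v2 by simp_all
      then have "(\<lambda>n. integral {a n..c n} K2) \<longlonglongrightarrow> 0"
        using set_integral_exhaust[OF _ sub ev, of K2] by simp
      moreover have "integral {a n..c n} K2 = - F (a n)" for n
        using acD(2)[OF F(1) ac(4) sub, of n] F0[OF ac(3), of n] by simp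
      ultimately have "(\<lambda>n. - F (a n)) \<longlonglongrightarrow> 0" by simp
      from tendsto_minus[OF this] show ?thesis by simp
    qed
    have ua: "(\<lambda>n. u (a n)) \<longlonglongrightarrow> L"
      using filterlim_compose[OF lim reciprocal_at_right] by (simp add: a_def)
    have i2: "integrable lebesgue (\<lambda>x. ut (norm x) * v2 x)"
      using set_integrable_test_function[OF Ut v2t] by (simp add: set_integrable_def mult.commute)
    have gv: "g (norm x) * v1 x = \<phi> x * (G x \<bullet> b)" for x by (simp add: G_def v1_def)
    have i1: "integrable lebesgue (\<lambda>x. g (norm x) * v1 x)"
      using set_integral_inner(1)[OF set_integrable_test_function[OF G \<phi>], of b] by (simp add: gv set_integrable_def)
    have acP: "ac {0<..} (\<lambda>r. u r * F r) (\<lambda>r. ut r * K2 r + g r * K1 r)"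
    proof (rule ac_cong_AE[OF ac_mult[OF u F(1)]])
      show "AE r in lebesgue. r \<in> {0<..} \<longrightarrow> u r * K2 r + g r * F r = ut r * K2 r + g r * K1 r"
        using F(2) by eventually_elim (auto simp: ut_def)
      show "(\<lambda>r. ut r * K2 r + g r * K1 r) \<in> borel_measurable lebesgue"
        by (intro borel_measurable_lebesgueI) measurable
    qed
    have p2: "(\<lambda>r. ut r * K2 r) absolutely_integrable_on {0<..}"
      "(LINT x|lebesgue. ut (norm x) * v2 x) = (LINT r:{0<..}|lebesgue. ut r * K2 r)"
      using K2p[OF ut i2] by auto
    have p1: "(\<lambda>r. g r * K1 r) absolutely_integrable_on {0<..}"
      "(LINT x|lebesgue. g (norm x) * v1 x) = (LINT r:{0<..}|lebesgue. g r * K1 r)"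
      using K1p[OF g i1] by auto
    have "(\<lambda>n. integral {a n..c n} (\<lambda>r. ut r * K2 r + g r * K1 r)) \<longlonglongrightarrow> (LINT r:{0<..}|lebesgue. ut r * K2 r + g r * K1 r)"
      by (intro set_integral_exhaust sub ev set_integral_add p1 p2)
    moreover have "integral {a n..c n} (\<lambda>r. ut r * K2 r + g r * K1 r) = - (u (a n) * F (a n))" for n
      using acD(2)[OF acP ac(4) sub, of n] F0[OF ac(3), of n] by simp
    moreover have "(\<lambda>n. - (u (a n) * F (a n))) \<longlonglongrightarrow> - (L * 0)"
      by (intro tendsto_intros ua Fa)
    ultimately have "(LINT r:{0<..}|lebesgue. ut r * K2 r + g r * K1 r) = - (L * 0)"
      using LIMSEQ_unique by simp
    then have "(LINT r:{0<..}|lebesgue. ut r * K2 r) = - (LINT r:{0<..}|lebesgue. g r * K1 r)"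
      using set_integral_add(2)[OF p2(1) p1(1)] by simp
    then have "(LINT x|lebesgue. ut (norm x) * v2 x) = - (LINT x|lebesgue. \<phi> x * (G x \<bullet> b))"
      using p1(2) p2(2) by (simp add: gv)
    moreover have "(LINT x|lebesgue. ut (norm x) * v2 x) = (LINT x|lebesgue. u (norm x) * v2 x)"
    proof (rule integral_cong_AE)
      have "v2 \<in> borel_measurable lebesgue" using v2 by (rule borel_measurable_integrable)
      then show "(\<lambda>x. u (norm x) * v2 x) \<in> borel_measurable lebesgue" by (intro borel_measurable_times Um)
      show "(\<lambda>x. ut (norm x) * v2 x) \<in> borel_measurable lebesgue" using i2 by (rule borel_measurable_integrable)
      show "AE x in lebesgue. ut (norm x) * v2 x = u (norm x) * v2 x" using ut_eq by eventually_elim simp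
    qed
    ultimately show "(LINT x:UNIV|lebesgue. u (norm x) * frechet_derivative \<phi> (at x) b)
        = - (LINT x:UNIV|lebesgue. \<phi> x * (G x \<bullet> b))"
      by (simp add: set_lebesgue_integral_def v2_def)
  qed
qed

text \<open>The weight makes the gradient integrable, so that it can be averaged over spheres.\<close>

lemma integrable_exp_minus_norm: "integrable lebesgue (\<lambda>x::'a::euclidean_space. exp (- norm x))"
proof -
  let ?d = "DIM('a)"
  \<comment> \<open>In the radial variable the claim is the convergence of Euler's integral for the
    Gamma function at \<open>d\<close>.\<close>
  have "(\<lambda>t. t powr (real ?d - 1) / exp t) absolutely_integrable_on {0..}"
    using Gamma_integral_real[of "real ?d"] by (intro nonnegative_absolutely_integrable_1) (auto simp: integrable_on_def)
  then have "(\<lambda>t. t powr (real ?d - 1) / exp t) absolutely_integrable_on {0<..}"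
    by (rule set_integrable_subset) auto
  moreover have "indicator {0<..} t *\<^sub>R (t powr (real ?d - 1) / exp t) = indicator {0<..} t *\<^sub>R (t ^ (?d - 1) * exp (- t))" for t :: real
  proof (cases "0 < t")
    case True
    have "real ?d - 1 = real (?d - 1)" by (simp add: of_nat_diff)
    then have "t powr (real ?d - 1) / exp t = t ^ (?d - 1) * exp (- t)"
      using True by (simp only: powr_realpow exp_minus divide_inverse)
    then show ?thesis by simp
  qed simp
  ultimately have "(\<lambda>t::real. t ^ (?d - 1) * exp (- t)) absolutely_integrable_on {0<..}"
    by (simp only: set_integrable_def)
  then show ?thesis
    using radial_integral(1)[of "\<lambda>r. exp (- r)", where 'a = 'a] by simp
qed

lemma antimono_positive_borel:
  fixes u :: "real \<Rightarrow> real"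
  assumes "\<And>r s. 0 < r \<Longrightarrow> r \<le> s \<Longrightarrow> u s \<le> u r"
  shows "(\<lambda>r. indicator {0<..} r *\<^sub>R u r) \<in> borel_measurable borel"
proof -
  have "mono_on {0<..} (\<lambda>r. - u r)" using assms by (auto simp: mono_on_def)
  then have "(\<lambda>r. - u r) \<in> borel_measurable (restrict_space borel {0<..})" by (rule borel_measurable_mono_on_fnc)
  then have "(\<lambda>r. indicator {0<..} r *\<^sub>R - u r) \<in> borel_measurable borel"
    by (subst (asm) borel_measurable_restrict_space_iff) auto
  from borel_measurable_uminus[OF this] show ?thesis by simp
qed

text \<open>Tested with the vector fields \<open>\<eta>(|x|) |x|\<^sup>-\<^sup>d x\<close>, whose divergence is \<open>\<eta>'(|x|) |x|\<^sup>1\<^sup>-\<^sup>d\<close>, the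
  weak gradient of \<open>u(|x|)\<close> yields the weak derivative of \<open>u\<close>.\<close>

lemma radial_weak_gradient_profile:
  fixes u :: "real \<Rightarrow> real" and G :: "'a::euclidean_space \<Rightarrow> 'a"
  assumes anti: "\<And>r s. 0 < r \<Longrightarrow> r \<le> s \<Longrightarrow> u s \<le> u r"
    and G: "has_weak_gradient UNIV (\<lambda>x. u (norm x)) G"
    and Gm: "G \<in> borel_measurable lebesgue" and Gp: "integrable lebesgue (\<lambda>x. norm (G x) powr p)" and p: "1 \<le> p"
  obtains g where "g \<in> borel_measurable borel" "\<And>r. g r \<le> 0" "ac {0<..} u g"
proof -
  let ?d = "DIM('a)"
  define ut where "ut r = indicator {0<..} r *\<^sub>R u r" for r
  have ut[measurable]: "ut \<in> borel_measurable borel"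
    unfolding ut_def[abs_def] by (rule antimono_positive_borel[OF anti])
  have U: "locally_integrable_on UNIV (\<lambda>x::'a. u (norm x))" and Gl: "locally_integrable_on UNIV G"
    using G by (auto simp: has_weak_gradient_def)
  \<comment> \<open>The weighted radial component of the gradient. The bound
    \<open>t \<le> 1 + t powr p\<close> for \<open>t \<ge> 0\<close> gives the integrable majorant
    \<open>exp (- norm x) + norm (G x) powr p\<close>.\<close>
  define v where "v x = exp (- norm x) * (sgn x \<bullet> G x)" for x
  have v: "integrable lebesgue v"
  proof (rule Bochner_Integration.integrable_bound)
    show "integrable lebesgue (\<lambda>x. exp (- norm x) + norm (G x) powr p)"
      by (intro Bochner_Integration.integrable_add integrable_exp_minus_norm Gp)
    have "sgn \<in> borel_measurable (borel :: 'a measure)" by measurable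
    then have "sgn \<in> borel_measurable (lebesgue :: 'a measure)" by (rule borel_measurable_lebesgueI)
    moreover have "(\<lambda>x::'a. exp (- norm x)) \<in> borel_measurable lebesgue"
      by (intro borel_measurable_lebesgueI) measurable
    ultimately show "v \<in> borel_measurable lebesgue"
      unfolding v_def[abs_def] by (intro borel_measurable_times borel_measurable_inner Gm)
    have "norm (v x) \<le> norm (exp (- norm x) + norm (G x) powr p)" for x
    proof -
      have "\<bar>sgn x \<bullet> G x\<bar> \<le> norm (sgn x) * norm (G x)" by (rule Cauchy_Schwarz_ineq2)
      also have "\<dots> \<le> norm (G x)" by (simp add: norm_sgn)
      also have "\<dots> \<le> 1 + norm (G x) powr p"
      proof (cases "norm (G x) \<le> 1")
        case False
        then have "norm (G x) powr 1 \<le> norm (G x) powr p" using p by (intro powr_mono) auto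
        then show ?thesis by simp
      qed (simp add: add_increasing2)
      finally have "\<bar>v x\<bar> \<le> exp (- norm x) * (1 + norm (G x) powr p)"
        by (simp add: v_def abs_mult)
      also have "\<dots> \<le> exp (- norm x) + norm (G x) powr p"
        using mult_right_mono[of "exp (- norm x)" 1 "norm (G x) powr p"] by (simp add: distrib_left)
      finally show ?thesis by simp
    qed
    then show "AE x in lebesgue. norm (v x) \<le> norm (exp (- norm x) + norm (G x) powr p)" by simp
  qed
  obtain K where K[measurable]: "K \<in> borel_measurable borel" and Ki: "integrable lebesgue K"
    and Kp: "\<And>h :: real \<Rightarrow> real. h \<in> borel_measurable borel \<Longrightarrow> integrable lebesgue (\<lambda>x. h (norm x) * v x) \<Longrightarrow>
       (\<lambda>r. h r * K r) absolutely_integrable_on {0<..} \<and>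
       (LINT x|lebesgue. h (norm x) * v x) = (LINT r:{0<..}|lebesgue. h r * K r)"
  proof (rule radial_pushforward[OF v])
    fix K :: "real \<Rightarrow> real"
    assume "K \<in> borel_measurable borel" "integrable lebesgue K"
      "\<And>h :: real \<Rightarrow> real. h \<in> borel_measurable borel \<Longrightarrow> integrable lebesgue (\<lambda>x. h (norm x) * v x) \<Longrightarrow>
       (\<lambda>r. h r * K r) absolutely_integrable_on {0<..} \<and>
       (LINT x|lebesgue. h (norm x) * v x) = (LINT r:{0<..}|lebesgue. h r * K r)"
    then show thesis by (rule that)
  qed
  define \<sigma> where "\<sigma> = sphere_area ?d"
  have \<sigma>: "0 < \<sigma>" by (simp add: \<sigma>_def sphere_area_pos)
  \<comment> \<open>Dividing \<open>K\<close> by the weight \<open>exp (- r)\<close> and by the area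
    \<open>\<sigma> r^(d-1)\<close> of the sphere turns it into the spherical mean of the radial
    component of \<open>G\<close>.\<close>
  define z where "z r = (r powr (1 - real ?d) * exp r / \<sigma>) * K r" for r
  have zm: "z \<in> borel_measurable borel" unfolding z_def[abs_def] by measurable
  have zl: "locally_integrable_on {0<..} z"
  proof (rule locally_integrable_on_realI)
    fix a b :: real assume ab: "{a..b} \<subseteq> {0<..}"
    show "z absolutely_integrable_on {a..b}"
    proof (cases "a \<le> b")
      case True
      then have "0 < a" using ab by (auto simp: subset_iff)
      have "K absolutely_integrable_on {a..b}"
        using integrable_imp_locally_integrable[OF Ki] by (auto simp: locally_integrable_on_def)
      then show ?thesis
        using set_integrable_continuous_mult[of "{a..b}" K "\<lambda>r. r powr (1 - real ?d) * exp r / \<sigma>"] \<open>0 < a\<close> \<sigma>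
        by (simp add: z_def[abs_def] continuous_intros)
    qed simp
  qed (auto simp: is_interval_1)
  have ul: "locally_integrable_on {0<..} u"
  proof (rule locally_integrable_on_realI)
    fix a b :: real assume ab: "{a..b} \<subseteq> {0<..}"
    show "u absolutely_integrable_on {a..b}"
    proof (cases "a \<le> b")
      case True
      then have "0 < a" using ab by (auto simp: subset_iff)
      have "(\<lambda>r. ut r * 1) absolutely_integrable_on {a..b}"
      proof (rule absolutely_integrable_bounded_measurable_product_real)
        show "(\<lambda>_. 1::real) absolutely_integrable_on {a..b}" by (intro absolutely_integrable_on_const) simp
        show "ut \<in> borel_measurable (lebesgue_on {a..b})"
          using borel_measurable_lebesgueI[OF ut] by (intro measurable_restrict_space1)
        have "ut r \<in> {u b..u a}" if "r \<in> {a..b}" for r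
          using that anti[of a r] anti[of r b] \<open>0 < a\<close> by (auto simp: ut_def)
        then have "ut ` {a..b} \<subseteq> {u b..u a}" by (rule image_subsetI)
        then show "bounded (ut ` {a..b})" by (rule bounded_subset[OF bounded_closed_interval])
        show "{a..b} \<in> sets lebesgue" by simp
      qed
      moreover have "set_integrable lebesgue {a..b} (\<lambda>r. ut r * 1) \<longleftrightarrow> set_integrable lebesgue {a..b} u"
        using \<open>0 < a\<close> by (intro set_integrable_cong) (auto simp: ut_def)
      ultimately show ?thesis by simp
    qed simp
  qed (auto simp: is_interval_1)
  have weak: "(LINT r:{0<..}|lebesgue. deriv \<eta> r * u r) = - (LINT r:{0<..}|lebesgue. \<eta> r * z r)"
    if \<eta>: "test_on {0<..} \<eta>" for \<eta>
  proof -
    \<comment> \<open>The divergence of the field \<open>\<zeta> (norm x) x\<close> is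
      \<open>d \<zeta> + r \<zeta>'\<close>; the exponent \<open>- d\<close> cancels the part that
      does not contain \<open>\<eta>'\<close>.\<close>
    define \<zeta> where "\<zeta> r = \<eta> r * r powr (- real ?d)" for r
    have \<zeta>: "test_on {0<..} \<zeta>" unfolding \<zeta>_def[abs_def] by (rule test_on_powr[OF \<eta>]) simp
    have d\<zeta>: "deriv \<zeta> r = deriv \<eta> r * r powr (- real ?d) - real ?d * \<zeta> r / r" if "0 < r" for r
    proof (rule DERIV_imp_deriv)
      show "(\<zeta> has_real_derivative deriv \<eta> r * r powr (- real ?d) - real ?d * \<zeta> r / r) (at r)"
        unfolding \<zeta>_def[abs_def] using that
        by (auto intro!: derivative_eq_intros test_on_deriv(1)[OF \<eta>] simp: powr_diff)
    qed
    define \<Phi> where "\<Phi> b x = (x \<bullet> b) * \<zeta> (norm x)" for b x :: 'a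
    have \<Phi>: "test_function UNIV (\<Phi> b)" for b
      unfolding \<Phi>_def[abs_def] by (intro test_function_radial[OF \<zeta>] Ck_inner) auto
    define D where "D b x = frechet_derivative (\<Phi> b) (at x) b" for b x
    have D: "D b x = \<zeta> (norm x) + (x \<bullet> b) * (deriv \<zeta> (norm x) * norm x powr (-1) * (x \<bullet> b))" if b: "b \<in> Basis" for b x
    proof -
      have "(\<Phi> b has_derivative (\<lambda>h. (x \<bullet> b) * (deriv \<zeta> (norm x) * norm x powr (-1) * (h \<bullet> x)) + (h \<bullet> b) * \<zeta> (norm x))) (at x)"
        unfolding \<Phi>_def[abs_def]
        by (intro has_derivative_mult has_derivative_radial[OF \<zeta>]) (auto intro!: derivative_eq_intros)
      from frechet_derivative_at[OF this, symmetric] show ?thesis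
        using b by (simp add: D_def inner_commute[of b x] inner_same_Basis)
    qed
    have div: "(\<Sum>b\<in>Basis. D b x) = deriv \<eta> (norm x) * norm x powr (1 - real ?d)" for x
    proof (cases "x = 0")
      case True
      then show ?thesis by (simp add: D \<zeta>_def)
    next
      case False
      let ?c = "deriv \<zeta> (norm x) * norm x powr (-1)"
      have "D b x = \<zeta> (norm x) + ((x \<bullet> b) * (x \<bullet> b)) * ?c" if "b \<in> Basis" for b
        using D[OF that, of x] by (simp only: mult_ac)
      then have "(\<Sum>b\<in>Basis. D b x) = (\<Sum>b\<in>Basis. \<zeta> (norm x) + ((x \<bullet> b) * (x \<bullet> b)) * ?c)"
        by (rule sum.cong[OF refl])
      also have "\<dots> = real ?d * \<zeta> (norm x) + (\<Sum>b\<in>Basis. (x \<bullet> b) * (x \<bullet> b)) * ?c"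
        by (simp only: sum.distrib sum_constant sum_distrib_right)
      also have "(\<Sum>b\<in>Basis. (x \<bullet> b) * (x \<bullet> b)) = norm x * norm x"
        by (simp only: euclidean_inner[symmetric] power2_norm_eq_inner[symmetric] power2_eq_square)
      also have "real ?d * \<zeta> (norm x) + norm x * norm x * (deriv \<zeta> (norm x) * norm x powr (-1)) =
          deriv \<eta> (norm x) * (norm x * norm x powr (- real ?d))"
        using False by (simp add: d\<zeta> powr_minus[of "norm x" 1] field_simps)
      also have "norm x * norm x powr (- real ?d) = norm x powr (1 - real ?d)"
        using False powr_add[of "norm x" 1 "- real ?d"] by simp
      finally show ?thesis .
    qed
    have iL: "integrable lebesgue (\<lambda>x. u (norm x) * D b x)" if "b \<in> Basis" for b
      using set_integrable_test_function[OF U test_function_deriv[OF \<Phi> that], of b]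
      by (simp add: D_def set_integrable_def mult.commute)
    have iR: "integrable lebesgue (\<lambda>x. \<Phi> b x * (G x \<bullet> b))" for b
      using set_integral_inner(1)[OF set_integrable_test_function[OF Gl \<Phi>[of b]], of b] by (simp add: set_integrable_def)
    have "(\<Sum>b\<in>Basis. LINT x|lebesgue. u (norm x) * D b x) = (\<Sum>b\<in>Basis. - (LINT x|lebesgue. \<Phi> b x * (G x \<bullet> b)))"
    proof (rule sum.cong[OF refl])
      fix b :: 'a assume "b \<in> Basis"
      from weak_gradient_component[OF G \<Phi>[of b] this]
      show "(LINT x|lebesgue. u (norm x) * D b x) = - (LINT x|lebesgue. \<Phi> b x * (G x \<bullet> b))"
        by (simp add: D_def set_lebesgue_integral_def)
    qed
    then have E1: "(LINT x|lebesgue. (\<Sum>b\<in>Basis. u (norm x) * D b x)) = - (LINT x|lebesgue. (\<Sum>b\<in>Basis. \<Phi> b x * (G x \<bullet> b)))"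
      using iL iR by (simp add: Bochner_Integration.integral_sum sum_negf)
    \<comment> \<open>The factor \<open>exp r\<close> undoes the weight inside \<open>v\<close>, and
      \<open>r\<close> comes from
      \<open>x \<bullet> G x = norm x * (sgn x \<bullet> G x)\<close>.\<close>
    define h where "h r = \<zeta> r * r * exp r" for r
    have sR: "(\<Sum>b\<in>Basis. \<Phi> b x * (G x \<bullet> b)) = h (norm x) * v x" for x
    proof -
      have "(\<Sum>b\<in>Basis. \<Phi> b x * (G x \<bullet> b)) = \<zeta> (norm x) * (x \<bullet> G x)"
        unfolding euclidean_inner[of x "G x"] by (simp add: \<Phi>_def sum_distrib_left mult_ac)
      also have "x \<bullet> G x = norm x * (sgn x \<bullet> G x)" by (cases "x = 0") (simp_all add: sgn_div_norm)
      also have "\<zeta> (norm x) * (norm x * (sgn x \<bullet> G x)) = h (norm x) * v x"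
        by (simp add: h_def v_def exp_minus)
      finally show ?thesis .
    qed
    have tf: "test_function {0<..} \<eta>" "test_function {0<..} \<zeta>" "test_function {0<..} (deriv \<eta>)"
      using \<eta> \<zeta> test_on_deriv(2)[OF \<eta>] by (simp_all add: test_function_iff_test_on is_interval_1)
    note [measurable] = test_function_props(2)[OF tf(1)] test_function_props(2)[OF tf(2)] test_function_props(2)[OF tf(3)]
    have h: "h \<in> borel_measurable borel" unfolding h_def[abs_def] by measurable
    have ih: "integrable lebesgue (\<lambda>x. h (norm x) * v x)"
      unfolding sR[symmetric] using iR by (intro Bochner_Integration.integrable_sum)
    define w where "w r = ut r * (deriv \<eta> r * r powr (1 - real ?d))" for r
    have w[measurable]: "w \<in> borel_measurable borel" unfolding w_def[abs_def] by measurable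
    have "(LINT x|lebesgue. (\<Sum>b\<in>Basis. u (norm x) * D b x)) = (LINT x::'a|lebesgue. w (norm x))"
    proof (rule integral_cong_AE)
      show "(\<lambda>x. \<Sum>b\<in>Basis. u (norm x) * D b x) \<in> borel_measurable lebesgue"
        using iL by (intro borel_measurable_integrable Bochner_Integration.integrable_sum)
      show "(\<lambda>x::'a. w (norm x)) \<in> borel_measurable lebesgue"
        by (intro borel_measurable_lebesgueI) measurable
      show "AE x in lebesgue. (\<Sum>b\<in>Basis. u (norm x) * D b x) = w (norm x)"
        using AE_nonzero[where 'a = 'a] by eventually_elim (simp add: sum_distrib_left[symmetric] div w_def ut_def)
    qed
    also have "\<dots> = \<sigma> * (LINT r:{0<..}|lebesgue. r ^ (?d - 1) * w r)"
      unfolding \<sigma>_def by (rule radial_integral(2)[OF w])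
    also have "(LINT r:{0<..}|lebesgue. r ^ (?d - 1) * w r) = (LINT r:{0<..}|lebesgue. deriv \<eta> r * u r)"
    proof (rule set_lebesgue_integral_cong)
      show "\<forall>r. r \<in> {0<..} \<longrightarrow> r ^ (?d - 1) * w r = deriv \<eta> r * u r"
      proof (intro allI impI)
        fix r :: real assume r: "r \<in> {0<..}"
        have "r ^ (?d - 1) = r powr (real ?d - 1)" using r by (simp add: powr_realpow[symmetric] of_nat_diff)
        then have "r ^ (?d - 1) * r powr (1 - real ?d) = 1" using r by (simp add: powr_add[symmetric])
        then have "deriv \<eta> r * u r * (r ^ (?d - 1) * r powr (1 - real ?d)) = deriv \<eta> r * u r" by simp
        then show "r ^ (?d - 1) * w r = deriv \<eta> r * u r" using r by (simp add: w_def ut_def mult_ac)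
      qed
    qed simp
    finally have E2: "(LINT x|lebesgue. (\<Sum>b\<in>Basis. u (norm x) * D b x)) = \<sigma> * (LINT r:{0<..}|lebesgue. deriv \<eta> r * u r)" .
    have E3: "(LINT x|lebesgue. (\<Sum>b\<in>Basis. \<Phi> b x * (G x \<bullet> b))) = (LINT r:{0<..}|lebesgue. h r * K r)"
      unfolding sR using Kp[OF h ih] by simp
    have E4: "(LINT r:{0<..}|lebesgue. h r * K r) = (LINT r:{0<..}|lebesgue. \<sigma> * (\<eta> r * z r))"
    proof (rule set_lebesgue_integral_cong)
      show "\<forall>r. r \<in> {0<..} \<longrightarrow> h r * K r = \<sigma> * (\<eta> r * z r)"
        using \<sigma> by (auto simp: h_def \<zeta>_def z_def powr_diff powr_minus field_simps)
    qed simp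
    have "\<sigma> * (LINT r:{0<..}|lebesgue. deriv \<eta> r * u r) = - (\<sigma> * (LINT r:{0<..}|lebesgue. \<eta> r * z r))"
      using E1 E2 E3 E4 by simp
    then have "\<sigma> * (LINT r:{0<..}|lebesgue. deriv \<eta> r * u r) = \<sigma> * - (LINT r:{0<..}|lebesgue. \<eta> r * z r)" by simp
    then show ?thesis using \<sigma> by (subst (asm) mult_cancel_left) auto
  qed
  obtain F where F: "ac {0<..} F z" "AE r in lebesgue. r \<in> {0<..} \<longrightarrow> F r = u r"
  proof (rule du_bois_reymond[of "{0<..}" u z])
    show "is_interval {0::real<..}" by (auto simp: is_interval_1)
  qed (use weak ul zl in auto)
  \<comment> \<open>Continuity of \<open>u\<close> is not known at this point; its monotonicity
    upgrades the equality from almost everywhere to everywhere.\<close>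
  have "F r = u r" if "r \<in> {0<..}" for r
    by (rule antimono_AE_eq_continuous[of "{0<..}" u F, symmetric])
      (use that anti F(2) ac_continuous_open[OF F(1)] in auto)
  then have uz: "ac {0<..} u z" by (rule ac_cong[OF F(1)])
  have zn: "AE r in lebesgue. r \<in> {0<..} \<longrightarrow> z r \<le> 0"
    by (rule ac_antimono_AE_nonpos[OF uz]) (use anti in auto)
  \<comment> \<open>A change on a null set makes the sign condition hold at every point.\<close>
  have "ac {0<..} u (\<lambda>r. min 0 (z r))"
  proof (rule ac_cong_AE[OF uz])
    show "AE r in lebesgue. r \<in> {0<..} \<longrightarrow> z r = min 0 (z r)" using zn by eventually_elim auto
    show "(\<lambda>r. min 0 (z r)) \<in> borel_measurable lebesgue" using zm by (intro borel_measurable_lebesgueI) simp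
  qed
  then show ?thesis using that[of "\<lambda>r. min 0 (z r)"] zm by simp
qed

section \<open>Energy identity\<close>


lemma integral_AE_eq:
  fixes f g :: "'a::euclidean_space \<Rightarrow> real"
  assumes "f \<in> borel_measurable lebesgue" "AE x in lebesgue. f x = g x"
  shows "(LINT x|lebesgue. f x) = (LINT x|lebesgue. g x)" "integrable lebesgue f \<longleftrightarrow> integrable lebesgue g"
  using integral_cong_AE[OF assms(1) borel_measurable_AE[OF assms] assms(2)]
    integrable_cong_AE[OF assms(1) borel_measurable_AE[OF assms] assms(2)] by auto

lemma set_integral_AE_eq:
  fixes f g :: "'a::euclidean_space \<Rightarrow> real"
  assumes "set_integrable lebesgue S f" "AE x in lebesgue. x \<in> S \<longrightarrow> f x = g x"
  shows "set_integrable lebesgue S g" "(LINT x:S|lebesgue. f x) = (LINT x:S|lebesgue. g x)"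
proof -
  have m: "(\<lambda>x. indicator S x *\<^sub>R f x) \<in> borel_measurable lebesgue"
    using assms(1) unfolding set_integrable_def by (rule borel_measurable_integrable)
  have AE: "AE x in lebesgue. indicator S x *\<^sub>R f x = indicator S x *\<^sub>R g x"
    using assms(2) by eventually_elim (auto simp: indicator_def)
  show "set_integrable lebesgue S g" "(LINT x:S|lebesgue. f x) = (LINT x:S|lebesgue. g x)"
    using integral_AE_eq[OF m AE] assms(1) by (simp_all add: set_integrable_def set_lebesgue_integral_def)
qed

lemma powr_mult_self: "0 \<le> (x::real) \<Longrightarrow> x powr s * x = x powr (s + 1)"
  by (cases "x = 0") (auto simp: powr_add)

text \<open>With \<open>0 powr _ = 0\<close> these identities hold at \<open>g = 0\<close> too, also
  when \<open>p - 2\<close> is negative.\<close>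

lemma powr_flux:
  assumes "(g::real) \<le> 0"
  shows "\<bar>g\<bar> powr (p - 2) * g = - (\<bar>g\<bar> powr (p - 1))" "g * (\<bar>g\<bar> powr (p - 1)) = - (\<bar>g\<bar> powr p)"
  using assms powr_mult_self[of "\<bar>g\<bar>" "p - 2"] powr_mult_self[of "\<bar>g\<bar>" "p - 1"] by (auto simp: mult.commute)

lemma bounded_measurable_absolutely_integrable:
  fixes h :: "real \<Rightarrow> real"
  assumes "h \<in> borel_measurable borel" "\<And>r. r \<in> S \<Longrightarrow> \<bar>h r\<bar> \<le> C" "S \<in> sets borel" "bounded S"
  shows "h absolutely_integrable_on S"
proof -
  have "(\<lambda>r. h r * 1) absolutely_integrable_on S"
  proof (rule absolutely_integrable_bounded_measurable_product_real)
    have "S \<in> lmeasurable" using assms(3,4) by (intro bounded_set_imp_lmeasurable) auto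
    then show "(\<lambda>_. 1::real) absolutely_integrable_on S" by (rule absolutely_integrable_on_const)
    show "h \<in> borel_measurable (lebesgue_on S)"
      using borel_measurable_lebesgueI[OF assms(1)] by (intro measurable_restrict_space1)
    show "bounded (h ` S)" using assms(2) by (auto simp: bounded_iff)
    show "S \<in> sets lebesgue" using assms(3) by simp
  qed
  then show ?thesis by simp
qed

lemma ac_has_derivative:
  assumes F: "ac I F f" and "open I" and f: "continuous_on I f" and x: "x \<in> I"
  shows "(F has_real_derivative f x) (at x)"
proof -
  obtain e where e: "e > 0" "cball x e \<subseteq> I" using assms(2) x open_contains_cball by blast
  have sub: "{x - e..x + e} \<subseteq> I" using e(2) by (simp add: cball_eq_atLeastAtMost)
  have cf: "continuous_on {x - e..x + e} f" by (rule continuous_on_subset[OF f sub])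
  have "((\<lambda>y. integral {x - e..y} f) has_real_derivative f x) (at x within {x - e..x + e})"
    using e(1) by (intro integral_has_real_derivative cf) auto
  then have "((\<lambda>y. F (x - e) + integral {x - e..y} f) has_real_derivative f x) (at x within {x - e..x + e})"
    by (auto intro!: derivative_eq_intros)
  moreover have "F (x - e) + integral {x - e..y} f = F y" if "y \<in> {x - e..x + e}" for y
  proof -
    have "{x - e..y} \<subseteq> I" using that sub by auto
    then show ?thesis using acD(2)[OF F, of "x - e" y] that by auto
  qed
  ultimately have "(F has_real_derivative f x) (at x within {x - e..x + e})"
    using e(1) by (subst has_field_derivative_cong_eventually[where g = "\<lambda>y. F (x - e) + integral {x - e..y} f"])
      (auto simp: eventually_at_filter)
  moreover have "at x within {x - e..x + e} = at x" using e(1) by (intro at_within_interior) auto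
  ultimately show ?thesis by simp
qed

text \<open>At \<open>t = 0\<close> the difference quotient is bounded by
  \<open>|h| powr (s - 1)\<close>, which tends to 0 when \<open>1 < s\<close>; elsewhere the
  function is a smooth power of \<open>t\<close> or of \<open>- t\<close>.\<close>

lemma has_real_derivative_abs_powr:
  assumes "1 < s \<or> t \<noteq> (0::real)"
  shows "((\<lambda>t. \<bar>t\<bar> powr s) has_real_derivative s * \<bar>t\<bar> powr (s - 1) * sgn t) (at t)"
proof (cases "t = 0")
  case False
  show ?thesis
  proof (cases "0 < t")
    case True
    then have "((\<lambda>t. t powr s) has_real_derivative s * \<bar>t\<bar> powr (s - 1) * sgn t) (at t)"
      by (auto intro!: derivative_eq_intros simp: powr_diff)
    then show ?thesis
      by (rule has_field_derivative_transform_within_open[of _ _ _ "{0<..}"]) (use True in auto)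
  next
    case neg: False
    with False have "((\<lambda>t. (- t) powr s) has_real_derivative s * \<bar>t\<bar> powr (s - 1) * sgn t) (at t)"
      by (auto intro!: derivative_eq_intros simp: powr_diff)
    then show ?thesis
      by (rule has_field_derivative_transform_within_open[of _ _ _ "{..<0}"]) (use neg False in auto)
  qed
next
  case True
  have "((\<lambda>h. \<bar>h\<bar> powr (s - 1)) \<longlongrightarrow> \<bar>0\<bar> powr (s - 1)) (at (0::real))"
    using assms True by (intro tendsto_powr' tendsto_intros) auto
  then have "((\<lambda>h::real. \<bar>h\<bar> powr (s - 1)) \<longlongrightarrow> 0) (at 0)" by simp
  then have "((\<lambda>h::real. \<bar>h\<bar> powr s / h) \<longlongrightarrow> 0) (at 0)"
  proof (rule Lim_null_comparison[rotated])
    have "norm (\<bar>h\<bar> powr s / h) \<le> \<bar>h\<bar> powr (s - 1)" for h :: real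
      using powr_mult_self[of "\<bar>h\<bar>" "s - 1"] by (cases "h = 0") (auto simp: abs_divide field_simps)
    then show "\<forall>\<^sub>F h in at 0. norm (\<bar>h\<bar> powr s / h) \<le> \<bar>h\<bar> powr (s - 1)" by simp
  qed
  then show ?thesis using True by (simp add: has_field_derivative_iff)
qed

lemma grad_inner_frechet:
  assumes "(\<phi> has_derivative frechet_derivative \<phi> (at x)) (at x)"
  shows "grad \<phi> x \<bullet> y = frechet_derivative \<phi> (at x) y"
proof -
  interpret linear "frechet_derivative \<phi> (at x)" by (rule has_derivative_linear[OF assms])
  have "frechet_derivative \<phi> (at x) y = frechet_derivative \<phi> (at x) (\<Sum>b\<in>Basis. (y \<bullet> b) *\<^sub>R b)"
    by (simp add: euclidean_representation)
  also have "\<dots> = (\<Sum>b\<in>Basis. (y \<bullet> b) * frechet_derivative \<phi> (at x) b)" by (simp add: sum scale)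
  also have "\<dots> = grad \<phi> x \<bullet> y"
    by (simp add: grad_def inner_sum_left inner_commute[of y] mult.commute)
  finally show ?thesis ..
qed

text \<open>The sequence \<open>b\<close> exhausts \<open>I\<close>, so that \<open>I = (0, \<infinity>)\<close> and \<open>I = (0, R)\<close> are treated alike, and \<open>W\<close> is
  the continuous representative of the flux \<open>r\<^sup>d\<^sup>-\<^sup>1 |u'|\<^sup>p\<^sup>-\<^sup>2 u'\<close>.\<close>

locale radial_profile =
  fixes d :: nat and p q :: real and I :: "real set" and b :: "nat \<Rightarrow> real" and u g W :: "real \<Rightarrow> real"
  assumes d: "1 \<le> d" and p: "real d < p" and q: "0 \<le> q"
    and u: "ac {0<..} u g" and g[measurable]: "g \<in> borel_measurable borel" and g0: "\<And>r. g r \<le> 0"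
    and u0: "\<And>r. 0 < r \<Longrightarrow> 0 \<le> u r" and lim: "(u \<longlongrightarrow> 1) (at_right 0)"
    and energy: "(\<lambda>r. (\<bar>u r\<bar> powr (q + 1) + \<bar>g r\<bar> powr p) * r ^ (d - 1)) absolutely_integrable_on {0<..}"
    and I: "I = (\<Union>n. {0<..b n})" and b: "incseq b" "\<And>n. 0 < b n" and openI: "open I"
    and ub: "(\<lambda>n. u (b n)) \<longlonglongrightarrow> 0" and uI: "\<And>r. 0 < r \<Longrightarrow> r \<notin> I \<Longrightarrow> u r = 0"
    and gI: "AE r in lebesgue. 0 < r \<longrightarrow> r \<notin> I \<longrightarrow> g r = 0"
    and W: "ac I W (\<lambda>r. r ^ (d - 1) * u r powr q)"
    and Wg: "AE r in lebesgue. r \<in> I \<longrightarrow> W r = - (r ^ (d - 1) * \<bar>g r\<bar> powr (p - 1))"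
begin

lemma I_pos: "r \<in> I \<Longrightarrow> 0 < r" by (auto simp: I)

lemma b_in_I: "b n \<in> I" using b(2)[of n] by (auto simp: I)

lemma I_lower: "s \<in> I \<Longrightarrow> 0 < r \<Longrightarrow> r \<le> s \<Longrightarrow> r \<in> I"
  unfolding I by fastforce

lemma Icc_subset: "s \<in> I \<Longrightarrow> 0 < r \<Longrightarrow> {r..s} \<subseteq> I"
  using I_lower by fastforce

lemma I_interval: "is_interval I"
  unfolding is_interval_1 using I_lower I_pos by (meson less_le_trans)

lemma u_le_1: "0 < r \<Longrightarrow> u r \<le> 1"
  by (rule ac_nonpos_le_limit[OF u g0 lim])

definition ut :: "real \<Rightarrow> real" where "ut r = indicator {0<..} r *\<^sub>R u r"

lemma ut_borel [measurable]: "ut \<in> borel_measurable borel"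
  unfolding ut_def[abs_def] by (rule ac_positive_borel[OF u])

lemma ut_eq: "0 < r \<Longrightarrow> ut r = u r" by (simp add: ut_def)

lemma W_continuous: "continuous_on I W" by (rule ac_continuous_open[OF W openI])

text \<open>The sign is known almost everywhere from the formula for the flux; continuity of
  \<open>W\<close> extends it to all of \<open>I\<close>.\<close>

lemma W_nonpos: "r \<in> I \<Longrightarrow> W r \<le> 0"
proof -
  assume r: "r \<in> I"
  have "W r = min 0 (W r)"
  proof (rule continuous_AE_eq[OF openI W_continuous _ _ r])
    show "continuous_on I (\<lambda>r. min 0 (W r))" by (intro continuous_intros W_continuous)
    show "AE r in lebesgue. r \<in> I \<longrightarrow> W r = min 0 (W r)"
      using Wg
    proof eventually_elim
      case (elim r)
      have "0 \<le> r ^ (d - 1) * \<bar>g r\<bar> powr (p - 1)" if "r \<in> I" using I_pos[OF that] by simp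
      then show ?case using elim by auto
    qed
  qed
  then show ?thesis by simp
qed

lemma W_mono: "r \<in> I \<Longrightarrow> s \<in> I \<Longrightarrow> r \<le> s \<Longrightarrow> W r \<le> W s"
proof -
  assume r: "r \<in> I" "s \<in> I" "r \<le> s"
  have "0 \<le> integral {r..s} (\<lambda>r. r ^ (d - 1) * u r powr q)"
    using I_pos[OF r(1)] by (intro integral_nonneg set_lebesgue_integral_eq_integral(1)[OF acD(1)[OF W r(3)]] Icc_subset r) auto
  then show ?thesis using acD(2)[OF W r(3)] Icc_subset[OF r(2) I_pos[OF r(1)]] by simp
qed

text \<open>Decreases to 0 from \<open>a 0 = b 0\<close>, so that the intervals
  \<open>{a n..b n}\<close> are never empty and exhaust \<open>I\<close>.\<close>

definition a :: "nat \<Rightarrow> real" where "a n = b 0 / real (Suc n)"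

lemma a_pos: "0 < a n" using b(2)[of 0] by (simp add: a_def)

lemma a_le: "a n \<le> b m"
proof -
  have "a n \<le> b 0" using b(2)[of 0] by (simp add: a_def field_simps)
  also have "b 0 \<le> b m" using b(1) by (simp add: incseq_def)
  finally show ?thesis .
qed

lemma a_in_I: "a n \<in> I" using I_lower[OF b_in_I a_pos a_le] .

lemma a_lim: "filterlim a (at_right 0) sequentially"
proof -
  have "(\<lambda>n. b 0 * inverse (real (Suc n))) \<longlonglongrightarrow> b 0 * 0" by (intro tendsto_intros LIMSEQ_inverse_real_of_nat)
  then have "a \<longlonglongrightarrow> 0" by (simp add: a_def[abs_def] divide_inverse)
  then show ?thesis using a_pos unfolding filterlim_at by (simp add: less_imp_neq[THEN not_sym])
qed

lemma exhaust: "\<forall>\<^sub>F n in sequentially. r \<in> {a n..b n}" if "r \<in> I"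
proof -
  obtain m where "r \<le> b m" using \<open>r \<in> I\<close> by (auto simp: I)
  then have "\<forall>\<^sub>F n in sequentially. r \<le> b n"
    using b(1) by (intro eventually_sequentiallyI[of m]) (meson incseqD order_trans)
  moreover have "\<forall>\<^sub>F n in sequentially. a n < r"
    using a_lim I_pos[OF that] unfolding filterlim_at by (intro order_tendstoD) auto
  ultimately show ?thesis by eventually_elim auto
qed

text \<open>\<open>W\<close> is monotone, and near 0 it is bounded below: as
  \<open>0 \<le> u \<le> 1\<close> and \<open>q \<ge> 0\<close>, its density is at most
  \<open>b 0 ^ (d - 1)\<close> on \<open>{0<..b 0}\<close>.\<close>

lemma W_limit: "\<exists>L. (\<lambda>n. W (a n)) \<longlonglongrightarrow> L \<and> (\<forall>r\<in>I. L \<le> W r)"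
proof -
  have dec: "decseq (\<lambda>n. W (a n))"
  proof (rule decseq_SucI)
    fix n
    have "a (Suc n) \<le> a n" using b(2)[of 0] by (simp add: a_def field_simps)
    then show "W (a (Suc n)) \<le> W (a n)" by (intro W_mono a_in_I)
  qed
  have "W (b 0) - b 0 ^ (d - 1) * b 0 \<le> W (a n)" for n
  proof -
    have an: "{a n..b 0} \<subseteq> I" by (intro Icc_subset b_in_I a_pos)
    have "integral {a n..b 0} (\<lambda>r. r ^ (d - 1) * u r powr q) \<le> integral {a n..b 0} (\<lambda>r. b 0 ^ (d - 1))"
    proof (rule integral_le)
      show "(\<lambda>r. r ^ (d - 1) * u r powr q) integrable_on {a n..b 0}"
        by (intro set_lebesgue_integral_eq_integral(1)[OF acD(1)[OF W a_le an]])
      fix r assume r: "r \<in> {a n..b 0}"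
      then have "0 < r" using a_pos[of n] by auto
      then have "u r powr q \<le> 1" using u0 u_le_1 q powr_mono2[of q "u r" 1] by auto
      then have "r ^ (d - 1) * u r powr q \<le> b 0 ^ (d - 1) * 1"
        using r \<open>0 < r\<close> b(2)[of 0] by (intro mult_mono power_mono) auto
      then show "r ^ (d - 1) * u r powr q \<le> b 0 ^ (d - 1)" by simp
    qed (rule integrable_const_ivl)
    also have "\<dots> = b 0 ^ (d - 1) * (b 0 - a n)" using a_le[of n 0] by simp
    also have "\<dots> \<le> b 0 ^ (d - 1) * b 0" using a_pos[of n] b(2)[of 0] by (intro mult_left_mono) auto
    finally show ?thesis using acD(2)[OF W a_le an] by simp
  qed
  then have "bdd_below (range (\<lambda>n. W (a n)))" by (auto intro!: bdd_belowI)
  from LIMSEQ_decseq_INF[OF this dec] obtain L where L: "(\<lambda>n. W (a n)) \<longlonglongrightarrow> L" by blast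
  moreover have "L \<le> W r" if "r \<in> I" for r
  proof -
    have "\<forall>\<^sub>F n in sequentially. W (a n) \<le> W r"
      using exhaust[OF that] by eventually_elim (use W_mono[OF a_in_I that] in auto)
    from tendsto_upperbound[OF L this] show ?thesis by simp
  qed
  ultimately show ?thesis by blast
qed

text \<open>This is W(0+). By monotonicity the sequence \<open>a\<close> determines the one-sided
  limit, and the lower bound is kept because it controls \<open>W\<close> at the right end.\<close>

definition W0 :: real where "W0 = (SOME L. (\<lambda>n. W (a n)) \<longlonglongrightarrow> L \<and> (\<forall>r\<in>I. L \<le> W r))"

lemma W0: "(\<lambda>n. W (a n)) \<longlonglongrightarrow> W0" "r \<in> I \<Longrightarrow> W0 \<le> W r"
  using someI_ex[OF W_limit] unfolding W0_def by auto

lemma W0_nonpos: "W0 \<le> 0" using W0(2)[OF b_in_I[of 0]] W_nonpos[OF b_in_I[of 0]] by simp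

text \<open>The energy density with its radial weight; \<open>ut\<close> in place of
  \<open>u\<close> makes it Borel on the whole line.\<close>

definition dens :: "real \<Rightarrow> real" where
  "dens r = (\<bar>ut r\<bar> powr (q + 1) + \<bar>g r\<bar> powr p) * r ^ (d - 1)"

lemma dens_borel: "dens \<in> borel_measurable borel"
  unfolding dens_def[abs_def] by measurable

lemma dens_integrable: "dens absolutely_integrable_on {0<..}"
  using set_integral_AE_eq(1)[OF energy, of dens] by (simp add: dens_def ut_eq)

lemma ac_energy: "ac I (\<lambda>r. u r * W r) dens"
proof (rule ac_cong_AE[OF ac_mult[OF ac_subset[OF u] W]])
  show "I \<subseteq> {0<..}" using I_pos by auto
  show "dens \<in> borel_measurable lebesgue" by (rule borel_measurable_lebesgueI[OF dens_borel])
  show "AE r in lebesgue. r \<in> I \<longrightarrow> u r * (r ^ (d - 1) * u r powr q) + g r * W r = dens r"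
    using Wg
  proof eventually_elim
    case (elim r)
    show ?case
    proof
      assume r: "r \<in> I"
      have "u r * (r ^ (d - 1) * u r powr q) = r ^ (d - 1) * u r powr (q + 1)"
        using powr_mult_self[OF u0[OF I_pos[OF r]], of q] by (simp add: mult_ac)
      moreover have "g r * W r = r ^ (d - 1) * \<bar>g r\<bar> powr p"
      proof -
        have "g r * W r = - (r ^ (d - 1) * (g r * (\<bar>g r\<bar> powr (p - 1))))"
          using elim r by simp
        then show ?thesis by (simp only: powr_flux(2)[OF g0])
      qed
      ultimately show "u r * (r ^ (d - 1) * u r powr q) + g r * W r = dens r"
        using u0[OF I_pos[OF r]] I_pos[OF r] by (simp add: dens_def ut_eq algebra_simps)
    qed
  qed
qed

text \<open>The increment of \<open>u W\<close> over \<open>[a n, b n]\<close> has explicit limits: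
  at the left end \<open>u\<close> tends to 1 and \<open>W\<close> to \<open>W0\<close>, at the
  right end \<open>u\<close> tends to 0 while \<open>W\<close> stays in
  \<open>[W0, 0]\<close>.\<close>

lemma energy_identity: "(LINT r:{0<..}|lebesgue. dens r) = - W0"
proof -
  have Isub: "I \<subseteq> {0<..}" using I_pos by auto
  have int: "dens absolutely_integrable_on I"
    by (rule set_integrable_subset[OF dens_integrable]) (use openI Isub in auto)
  have "(\<lambda>n. integral {a n..b n} dens) \<longlonglongrightarrow> (LINT r:I|lebesgue. dens r)"
    by (rule set_integral_exhaust[OF int]) (use Icc_subset[OF b_in_I a_pos] exhaust in auto)
  moreover have "integral {a n..b n} dens = u (b n) * W (b n) - u (a n) * W (a n)" for n
    using acD(2)[OF ac_energy a_le Icc_subset[OF b_in_I a_pos]] by simp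
  moreover have "(\<lambda>n. u (b n) * W (b n) - u (a n) * W (a n)) \<longlonglongrightarrow> 0 - 1 * W0"
  proof (intro tendsto_diff tendsto_mult W0 filterlim_compose[OF lim a_lim])
    show "(\<lambda>n. u (b n) * W (b n)) \<longlonglongrightarrow> 0"
    proof (rule Lim_null_comparison)
      show "(\<lambda>n. u (b n) * \<bar>W0\<bar>) \<longlonglongrightarrow> 0" using tendsto_mult_left_zero[OF ub] by simp
      have "norm (u (b n) * W (b n)) \<le> u (b n) * \<bar>W0\<bar>" for n
        using W0(2)[OF b_in_I[of n]] W_nonpos[OF b_in_I[of n]] u0[OF b(2)[of n]]
        by (simp add: abs_mult mult_left_mono)
      then show "\<forall>\<^sub>F n in sequentially. norm (u (b n) * W (b n)) \<le> u (b n) * \<bar>W0\<bar>" by simp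
    qed
  qed
  ultimately have "(LINT r:I|lebesgue. dens r) = - W0" using LIMSEQ_unique by fastforce
  moreover have "(LINT r:{0<..}|lebesgue. dens r) = (LINT r:{0<..}|lebesgue. indicator I r * dens r)"
  proof (rule set_integral_AE_eq(2)[OF dens_integrable])
    \<comment> \<open>At almost every positive radius off \<open>I\<close> both \<open>u\<close> and
      \<open>g\<close> vanish, and \<open>0 powr _ = 0\<close>.\<close>
    show "AE r in lebesgue. r \<in> {0<..} \<longrightarrow> dens r = indicator I r * dens r"
      using gI by eventually_elim (auto simp: dens_def ut_eq uI indicator_def)
  qed
  moreover have "(LINT r:{0<..}|lebesgue. indicator I r * dens r) = (LINT r:I|lebesgue. dens r)"
    using Isub unfolding set_lebesgue_integral_def
    by (intro Bochner_Integration.integral_cong) (auto simp: indicator_def)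
  ultimately show ?thesis by simp
qed

end

section \<open>The Thomas--Fermi equation\<close>


context radial_profile
begin

lemma gradient_part: "(\<lambda>r. r ^ (d - 1) * \<bar>g r\<bar> powr p) absolutely_integrable_on {0<..}" (is ?A)
  and u_part: "(\<lambda>r. r ^ (d - 1) * \<bar>ut r\<bar> powr (q + 1)) absolutely_integrable_on {0<..}" (is ?B)
proof -
  have m: "set_borel_measurable lebesgue {0<..} (\<lambda>r. r ^ (d - 1) * \<bar>g r\<bar> powr p)"
    "set_borel_measurable lebesgue {0<..} (\<lambda>r. r ^ (d - 1) * \<bar>ut r\<bar> powr (q + 1))"
    unfolding set_borel_measurable_def by (intro borel_measurable_lebesgueI; measurable)+
  show ?A by (rule set_integrable_bound[OF dens_integrable m(1)]) (auto simp: dens_def abs_mult mult.commute intro!: mult_right_mono)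
  show ?B by (rule set_integrable_bound[OF dens_integrable m(2)]) (auto simp: dens_def abs_mult mult.commute intro!: mult_right_mono)
qed

context
  fixes U :: "'a::euclidean_space \<Rightarrow> real"
  assumes dim: "DIM('a) = d" and U: "U = (\<lambda>x. u (norm x))"
begin

lemma
  shows U_weakly_differentiable: "weakly_differentiable_on UNIV U"
    and gradient_AE: "AE x in lebesgue. weak_gradient UNIV U x = (g (norm x) / norm x) *\<^sub>R x"
  using weak_gradient_eq[OF open_UNIV has_weak_gradient_radial[OF u g g0 lim, where 'a = 'a]] by (auto simp: U)

lemma gradient_measurable: "weak_gradient UNIV U \<in> borel_measurable lebesgue"
proof (rule borel_measurable_AE)
  show "(\<lambda>x::'a. (g (norm x) / norm x) *\<^sub>R x) \<in> borel_measurable lebesgue"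
    by (intro borel_measurable_lebesgueI) measurable
  show "AE x in lebesgue. (g (norm x) / norm x) *\<^sub>R x = weak_gradient UNIV U x"
    using gradient_AE by eventually_elim simp
qed

lemma gradient_norm_AE: "AE x in lebesgue. \<bar>g (norm x)\<bar> powr p = norm (weak_gradient UNIV U x) powr p"
  using gradient_AE AE_nonzero[where 'a = 'a] by eventually_elim simp

lemma U_AE: "AE x in lebesgue. \<bar>ut (norm x)\<bar> powr (q + 1) = \<bar>U x\<bar> powr (q + 1)"
  using AE_nonzero[where 'a = 'a] by eventually_elim (simp add: U ut_eq)

lemma radial_powr_measurable:
  "(\<lambda>x::'a. \<bar>g (norm x)\<bar> powr p) \<in> borel_measurable lebesgue"
  "(\<lambda>x::'a. \<bar>ut (norm x)\<bar> powr (q + 1)) \<in> borel_measurable lebesgue"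
  by (intro borel_measurable_lebesgueI; measurable)+

lemma U_measurable: "U \<in> borel_measurable lebesgue"
proof (rule borel_measurable_AE)
  show "(\<lambda>x::'a. ut (norm x)) \<in> borel_measurable lebesgue" by (intro borel_measurable_lebesgueI) measurable
  show "AE x in lebesgue. ut (norm x) = U x" using AE_nonzero[where 'a = 'a] by eventually_elim (simp add: U ut_eq)
qed

lemma gradient_in_Lp: "in_Lp p (weak_gradient UNIV U)"
  unfolding in_Lp_def
  using gradient_measurable integral_AE_eq(2)[OF radial_powr_measurable(1) gradient_norm_AE]
    radial_integral(1)[of "\<lambda>r. \<bar>g r\<bar> powr p", where 'a = 'a] gradient_part by (simp add: dim)

lemma U_in_Lp: "in_Lp (q + 1) U"
  unfolding in_Lp_def
  using U_measurable integral_AE_eq(2)[OF radial_powr_measurable(2) U_AE]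
    radial_integral(1)[of "\<lambda>r. \<bar>ut r\<bar> powr (q + 1)", where 'a = 'a] u_part by (simp add: dim)

lemma TF_const_eq: "TF_const p q U = - (sphere_area d * W0)"
proof -
  have "TF_const p q U = sphere_area d * (LINT r:{0<..}|lebesgue. r ^ (d - 1) * \<bar>g r\<bar> powr p)
      + sphere_area d * (LINT r:{0<..}|lebesgue. r ^ (d - 1) * \<bar>ut r\<bar> powr (q + 1))"
    unfolding TF_const_def integral_AE_eq(1)[OF radial_powr_measurable(1) gradient_norm_AE, symmetric]
      integral_AE_eq(1)[OF radial_powr_measurable(2) U_AE, symmetric]
    using radial_integral(2)[of "\<lambda>r. \<bar>g r\<bar> powr p", where 'a = 'a]
      radial_integral(2)[of "\<lambda>r. \<bar>ut r\<bar> powr (q + 1)", where 'a = 'a] by (simp add: dim)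
  also have "\<dots> = sphere_area d * (LINT r:{0<..}|lebesgue. r ^ (d - 1) * \<bar>g r\<bar> powr p + r ^ (d - 1) * \<bar>ut r\<bar> powr (q + 1))"
    unfolding set_integral_add(2)[OF gradient_part u_part] by (simp add: distrib_left)
  also have "(\<lambda>r. r ^ (d - 1) * \<bar>g r\<bar> powr p + r ^ (d - 1) * \<bar>ut r\<bar> powr (q + 1)) = dens"
    by (simp add: dens_def fun_eq_iff algebra_simps)
  finally show ?thesis using energy_identity by simp
qed

text \<open>In the radial variable the left side is \<open>sphere_area d\<close> times the integral
  of \<open>(F W)'\<close>, where \<open>F\<close> is the profile of \<open>\<phi>\<close> along an
  axis. The assumption \<open>cover\<close> puts the support of \<open>\<phi>\<close> inside some
  ball of radius \<open>b n\<close>, so the only boundary term is \<open>- F 0 * W0\<close>, and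
  \<open>TF_const_eq\<close> identifies it with the point mass.\<close>

lemma TF_identity:
  assumes \<phi>: "test_function S \<phi>" and rad: "radial \<phi>"
    and cover: "\<And>K. compact K \<Longrightarrow> K \<subseteq> S \<Longrightarrow> \<exists>n. \<forall>x\<in>K. norm x < b n"
  shows "(LINT x|lebesgue. grad \<phi> x \<bullet> (norm (weak_gradient UNIV U x) powr (p - 2) *\<^sub>R weak_gradient UNIV U x))
      + (LINT x|lebesgue. \<phi> x * U x powr q) = TF_const p q U * \<phi> 0"
proof -
  obtain e :: 'a where e: "e \<in> Basis" by (meson equals0I nonempty_Basis)
  define D where "D x = frechet_derivative \<phi> (at x) e" for x
  define F where "F r = \<phi> (r *\<^sub>R e)" for r
  define F' where "F' r = D (r *\<^sub>R e)" for r
  have D: "test_function S D" unfolding D_def[abs_def] by (rule test_function_deriv[OF \<phi> e])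
  note d\<phi> = test_function_props(5)[OF \<phi>]
  have \<phi>F: "\<phi> x = F (norm x)" for x
    using rad e unfolding radial_def F_def by (metis abs_norm_cancel mult.right_neutral norm_Basis norm_scaleR)
  have FD: "(F has_real_derivative F' r) (at r)" for r
  proof -
    have "((\<lambda>s. s *\<^sub>R e) has_derivative (\<lambda>t. t *\<^sub>R e)) (at r)" by (auto intro!: derivative_eq_intros)
    from has_derivative_compose[OF this d\<phi>]
    have "(F has_derivative (\<lambda>t. frechet_derivative \<phi> (at (r *\<^sub>R e)) (t *\<^sub>R e))) (at r)" by (simp add: F_def[abs_def])
    moreover have "frechet_derivative \<phi> (at y) (t *\<^sub>R e) = D y * t" for y t
      using linear_cmul[OF has_derivative_linear[OF d\<phi>], of y t e] by (simp add: D_def)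
    ultimately show ?thesis by (simp add: has_field_derivative_def F'_def)
  qed
  have F'c: "continuous_on A F'" for A
    unfolding F'_def[abs_def]
    by (rule continuous_on_compose2[OF test_function_props(1)[OF D, of UNIV]]) (auto intro!: continuous_intros)
  have Fc: "continuous_on A F" for A
    using FD by (meson DERIV_isCont continuous_at_imp_continuous_on)
  have [measurable]: "F \<in> borel_measurable borel" "F' \<in> borel_measurable borel"
    using Fc F'c by (auto intro: borel_measurable_continuous_onI)
  \<comment> \<open>The function \<open>\<phi> ((1 + s) x)\<close> is differentiated at
    \<open>s = 0\<close> in two ways; near 0 the factor \<open>1 + s\<close> is positive and can
    leave the norm.\<close>
  have radial_grad: "grad \<phi> x \<bullet> x = F' (norm x) * norm x" if "x \<noteq> 0" for x
  proof -
    have "((\<lambda>s. x + s *\<^sub>R x) has_derivative (\<lambda>t. t *\<^sub>R x)) (at 0)" by (auto intro!: derivative_eq_intros)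
    from has_derivative_compose[OF this, of \<phi> "frechet_derivative \<phi> (at x)"] d\<phi>[of x]
    have "((\<lambda>s. \<phi> (x + s *\<^sub>R x)) has_derivative (\<lambda>t. frechet_derivative \<phi> (at x) (t *\<^sub>R x))) (at 0)" by simp
    moreover have "frechet_derivative \<phi> (at x) (t *\<^sub>R x) = frechet_derivative \<phi> (at x) x * t" for t
      using linear_cmul[OF has_derivative_linear[OF d\<phi>], of x t x] by simp
    ultimately have "((\<lambda>s. \<phi> (x + s *\<^sub>R x)) has_real_derivative frechet_derivative \<phi> (at x) x) (at 0)"
      by (simp add: has_field_derivative_def)
    moreover have "((\<lambda>s. F ((1 + s) * norm x)) has_real_derivative F' (norm x) * norm x) (at 0)"
      by (rule DERIV_chain2[of F "F' (norm x)" "\<lambda>s. (1 + s) * norm x"]) (use FD[of "norm x"] in \<open>auto intro!: derivative_eq_intros\<close>)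
    then have "((\<lambda>s. \<phi> (x + s *\<^sub>R x)) has_real_derivative F' (norm x) * norm x) (at 0)"
    proof (rule has_field_derivative_transform_within_open[of _ _ _ "{-1<..}"])
      fix s :: real assume "s \<in> {-1<..}"
      moreover have "x + s *\<^sub>R x = (1 + s) *\<^sub>R x" by (simp add: scaleR_add_left)
      ultimately show "F ((1 + s) * norm x) = \<phi> (x + s *\<^sub>R x)" by (simp add: \<phi>F)
    qed auto
    ultimately have "frechet_derivative \<phi> (at x) x = F' (norm x) * norm x" by (rule DERIV_unique)
    then show ?thesis using grad_inner_frechet[OF d\<phi>] by simp
  qed
  \<comment> \<open>One radius serves the supports of \<open>\<phi>\<close> and of its derivative
    along \<open>e\<close>.\<close>
  obtain n where n: "\<And>r. b n \<le> r \<Longrightarrow> F r = 0" "\<And>r. b n \<le> r \<Longrightarrow> F' r = 0"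
  proof -
    obtain K where K: "compact K" "K \<subseteq> S" "\<And>x. x \<notin> K \<Longrightarrow> \<phi> x = 0" using test_functionE[OF \<phi>] by metis
    obtain K' where K': "compact K'" "K' \<subseteq> S" "\<And>x. x \<notin> K' \<Longrightarrow> D x = 0" using test_functionE[OF D] by metis
    obtain n where n: "\<forall>x\<in>K \<union> K'. norm x < b n" using cover[of "K \<union> K'"] K K' compact_Un by auto
    show ?thesis
    proof (rule that[of n])
      fix r assume "b n \<le> r"
      then have "\<not> norm (r *\<^sub>R e) < b n" using e b(2)[of n] by simp
      then have "r *\<^sub>R e \<notin> K \<union> K'" using n by blast
      then show "F r = 0" "F' r = 0" using K(3) K'(3) by (auto simp: F_def F'_def)
    qed
  qed
  define Wt where "Wt r = indicator I r *\<^sub>R W r" for r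
  have Wt[measurable]: "Wt \<in> borel_measurable borel"
    unfolding Wt_def[abs_def] using openI by (intro borel_measurable_continuous_on_indicator W_continuous) simp
  \<comment> \<open>The power removes the factor \<open>r^(d-1)\<close> contained in the flux, so
    that \<open>hh (norm x)\<close> is the integrand in space; the weight of radial integration puts
    it back.\<close>
  define hh where "hh r = F' r * Wt r * r powr (1 - real d)" for r
  define hq where "hq r = F r * ut r powr q" for r
  have [measurable]: "hh \<in> borel_measurable borel" "hq \<in> borel_measurable borel"
    unfolding hh_def[abs_def] hq_def[abs_def] by measurable
  have m: "(\<lambda>x::'a. hh (norm x)) \<in> borel_measurable lebesgue" "(\<lambda>x::'a. hq (norm x)) \<in> borel_measurable lebesgue"
    "hh \<in> borel_measurable borel" "hq \<in> borel_measurable borel"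
    by (auto intro!: borel_measurable_lebesgueI)
  have pw: "r powr (1 - real d) * r ^ (d - 1) = 1" if "0 < r" for r
  proof -
    have "r ^ (d - 1) = r powr (real d - 1)" using that d by (simp add: powr_realpow[symmetric] of_nat_diff)
    then show ?thesis using that by (simp add: powr_add[symmetric])
  qed
  have "AE r in lebesgue. 0 < r \<longrightarrow> (r \<in> I \<longrightarrow> W r = - (r ^ (d - 1) * \<bar>g r\<bar> powr (p - 1)))"
    using Wg by eventually_elim simp
  from AE_norm[OF this, where 'a = 'a]
  have AE1: "AE x in lebesgue. hh (norm x) = grad \<phi> x \<bullet> (norm (weak_gradient UNIV U x) powr (p - 2) *\<^sub>R weak_gradient UNIV U x)"
    using gradient_AE AE_nonzero[where 'a = 'a]
  proof eventually_elim
    case (elim x)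
    let ?r = "norm x"
    have r: "0 < ?r" using elim by simp
    have "grad \<phi> x \<bullet> (norm (weak_gradient UNIV U x) powr (p - 2) *\<^sub>R weak_gradient UNIV U x)
        = \<bar>g ?r\<bar> powr (p - 2) * (g ?r / ?r) * (grad \<phi> x \<bullet> x)"
      using elim by simp
    also have "\<dots> = F' ?r * (\<bar>g ?r\<bar> powr (p - 2) * g ?r)"
      using r radial_grad[of x] elim by simp
    also have "\<dots> = F' ?r * - (\<bar>g ?r\<bar> powr (p - 1))" by (simp only: powr_flux(1)[OF g0])
    also have "\<dots> = hh ?r"
    proof (cases "?r \<in> I")
      case True
      then have "hh ?r = F' ?r * - (\<bar>g ?r\<bar> powr (p - 1)) * (?r powr (1 - real d) * ?r ^ (d - 1))"
        using elim(1) by (simp add: hh_def Wt_def)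
      then show ?thesis using pw[OF r] by simp
    next
      \<comment> \<open>Since \<open>{0<..b n}\<close> lies in \<open>I\<close>, a radius off
        \<open>I\<close> exceeds \<open>b n\<close>, where \<open>F'\<close> vanishes.\<close>
      case False
      then have "\<not> ?r \<le> b n" using r by (auto simp: I)
      then have "b n \<le> ?r" by simp
      then show ?thesis using n(2) by (simp add: hh_def)
    qed
    finally show ?case ..
  qed
  have AE2: "AE x in lebesgue. hq (norm x) = \<phi> x * U x powr q"
    using AE_nonzero[where 'a = 'a] by eventually_elim (simp add: hq_def ut_eq U \<phi>F)
  define A where "A r = F' r * Wt r" for r
  define B where "B r = F r * (r ^ (d - 1) * ut r powr q)" for r
  have AB: "A \<in> borel_measurable borel" "B \<in> borel_measurable borel"
    unfolding A_def[abs_def] B_def[abs_def] by measurable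
  have L1: "(LINT x::'a|lebesgue. hh (norm x)) = sphere_area d * (LINT r:{0<..}|lebesgue. A r)"
  proof -
    have "(LINT r:{0<..}|lebesgue. r ^ (d - 1) * hh r) = (LINT r:{0<..}|lebesgue. A r)"
    proof (rule set_lebesgue_integral_cong)
      show "\<forall>r. r \<in> {0<..} \<longrightarrow> r ^ (d - 1) * hh r = A r"
      proof (intro allI impI)
        fix r :: real assume "r \<in> {0<..}"
        have "r ^ (d - 1) * hh r = A r * (r powr (1 - real d) * r ^ (d - 1))" by (simp add: hh_def A_def)
        also have "r powr (1 - real d) * r ^ (d - 1) = 1" using \<open>r \<in> {0<..}\<close> by (intro pw) simp
        finally show "r ^ (d - 1) * hh r = A r" by simp
      qed
    qed simp
    then show ?thesis using radial_integral(2)[OF m(3), where 'a = 'a] by (simp add: dim)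
  qed
  have L2: "(LINT x::'a|lebesgue. hq (norm x)) = sphere_area d * (LINT r:{0<..}|lebesgue. B r)"
    using radial_integral(2)[OF m(4), where 'a = 'a] by (simp add: dim hq_def B_def mult_ac)
  obtain C where C: "\<And>r. \<bar>F r\<bar> \<le> C" using test_function_props(4)[OF \<phi>] by (auto simp: F_def)
  obtain C' where C': "\<And>r. \<bar>F' r\<bar> \<le> C'" using test_function_props(4)[OF D] by (auto simp: F'_def)
  have bnd: "bounded {0<..b n}" by (rule bounded_subset[of "{0..b n}"]) auto
  have "A absolutely_integrable_on {0<..b n}"
  proof (rule bounded_measurable_absolutely_integrable[OF AB(1) _ _ bnd])
    show "\<bar>A r\<bar> \<le> C' * \<bar>W0\<bar>" for r
    proof -
      have "\<bar>Wt r\<bar> \<le> \<bar>W0\<bar>" using W0(2)[of r] W_nonpos[of r] by (auto simp: Wt_def indicator_def)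
      then show ?thesis unfolding A_def abs_mult using C'[of r] by (intro mult_mono) auto
    qed
  qed simp
  moreover have "A r = 0" if "r \<notin> {0<..b n}" for r
    using that n(2)[of r] I_pos[of r] by (auto simp: A_def Wt_def indicator_def)
  ultimately have Ai: "A absolutely_integrable_on {0<..}"
    by (subst set_lebesgue_restrict(1)[of "{0<..b n}"]) auto
  have "B absolutely_integrable_on {0<..b n}"
  proof (rule bounded_measurable_absolutely_integrable[OF AB(2) _ _ bnd])
    show "\<bar>B r\<bar> \<le> C * (b n ^ (d - 1) * 1)" if "r \<in> {0<..b n}" for r
    proof -
      have "ut r powr q \<le> 1" using that u0 u_le_1 q powr_mono2[of q "u r" 1] by (auto simp: ut_eq)
      then have "r ^ (d - 1) * ut r powr q \<le> b n ^ (d - 1) * 1" using that by (intro mult_mono power_mono) auto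
      moreover have "0 \<le> r ^ (d - 1) * ut r powr q" using that by simp
      ultimately have "\<bar>r ^ (d - 1) * ut r powr q\<bar> \<le> b n ^ (d - 1) * 1" by (simp only: abs_of_nonneg)
      then show ?thesis unfolding B_def abs_mult[of "F r"] using C[of r] by (intro mult_mono[OF C]) simp_all
    qed
  qed simp
  moreover have "B r = 0" if "r \<notin> {0<..b n}" for r
    using that n(1)[of r] by (auto simp: B_def ut_def indicator_def)
  ultimately have Bi: "B absolutely_integrable_on {0<..}"
    by (subst set_lebesgue_restrict(1)[of "{0<..b n}"]) auto
  have acAB: "ac I (\<lambda>r. F r * W r) (\<lambda>r. A r + B r)"
  proof (rule ac_cong_AE[OF ac_mult[OF ac_deriv[OF FD F'c] W]])
    show "AE r in lebesgue. r \<in> I \<longrightarrow> F r * (r ^ (d - 1) * u r powr q) + F' r * W r = A r + B r"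
      by (intro AE_I2) (simp add: A_def B_def Wt_def ut_eq I_pos)
    show "(\<lambda>r. A r + B r) \<in> borel_measurable lebesgue"
      using AB by (intro borel_measurable_lebesgueI borel_measurable_add)
  qed
  have sub: "{0<..b n} \<subseteq> I" by (auto simp: I)
  \<comment> \<open>Only the left end moves; the right end stays at \<open>b n\<close>, where
    \<open>F\<close> is 0.\<close>
  have "(\<lambda>m. integral {a m..b n} (\<lambda>r. A r + B r)) \<longlonglongrightarrow> (LINT r:{0<..b n}|lebesgue. A r + B r)"
  proof (rule set_integral_exhaust)
    show "(\<lambda>r. A r + B r) absolutely_integrable_on {0<..b n}"
      by (rule set_integrable_subset[OF set_integral_add(1)[OF Ai Bi]]) auto
    show "{a m..b n} \<subseteq> {0<..b n}" for m using a_pos[of m] by auto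
    show "\<forall>\<^sub>F m in sequentially. x \<in> {a m..b n}" if "x \<in> {0<..b n}" for x
      using exhaust[of x] sub that by (auto elim!: eventually_mono)
  qed
  moreover have "integral {a m..b n} (\<lambda>r. A r + B r) = - (F (a m) * W (a m))" for m
    using acD(2)[OF acAB a_le Icc_subset[OF b_in_I a_pos], of n m] n(1)[of "b n"] by simp
  moreover have "(\<lambda>m. - (F (a m) * W (a m))) \<longlonglongrightarrow> - (F 0 * W0)"
  proof (intro tendsto_intros W0)
    have "a \<longlonglongrightarrow> 0" using a_lim unfolding filterlim_at by simp
    then show "(\<lambda>m. F (a m)) \<longlonglongrightarrow> F 0"
      using FD[of 0] DERIV_isCont isCont_tendsto_compose by blast
  qed
  ultimately have "(LINT r:{0<..b n}|lebesgue. A r + B r) = - (F 0 * W0)" using LIMSEQ_unique by fastforce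
  moreover have "(LINT r:{0<..}|lebesgue. A r + B r) = (LINT r:{0<..b n}|lebesgue. A r + B r)"
    using \<open>\<And>r. r \<notin> {0<..b n} \<Longrightarrow> A r = 0\<close> \<open>\<And>r. r \<notin> {0<..b n} \<Longrightarrow> B r = 0\<close>
    by (intro set_lebesgue_restrict(2)) auto
  ultimately have "(LINT r:{0<..}|lebesgue. A r) + (LINT r:{0<..}|lebesgue. B r) = - (F 0 * W0)"
    using set_integral_add(2)[OF Ai Bi] by simp
  then have "sphere_area d * (LINT r:{0<..}|lebesgue. A r) + sphere_area d * (LINT r:{0<..}|lebesgue. B r) = - (sphere_area d * W0) * F 0"
    by (simp add: distrib_left[symmetric])
  moreover have "F 0 = \<phi> 0" by (simp add: F_def)
  ultimately show ?thesis
    unfolding integral_AE_eq(1)[OF m(1) AE1, symmetric] integral_AE_eq(1)[OF m(2) AE2, symmetric] L1 L2 TF_const_eq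
    by simp
qed

lemma TF_weak:
  assumes "\<And>K. compact K \<Longrightarrow> K \<subseteq> S \<Longrightarrow> \<exists>n. \<forall>x\<in>K. norm x < b n"
  shows "TF_weak_on p q S U"
  unfolding TF_weak_on_def using U_weakly_differentiable gradient_in_Lp U_in_Lp TF_identity[OF _ _ assms] by blast

end

end

section \<open>The radial equation\<close>


text \<open>The inequality \<open>t powr (p - 1) \<le> 1 + t powr p\<close> for
  \<open>t \<ge> 0\<close> transfers local integrability from the energy to the flux.\<close>

lemma flux_locally_integrable:
  fixes g :: "real \<Rightarrow> real"
  assumes p: "1 < p" and g[measurable]: "g \<in> borel_measurable borel"
    and gp: "(\<lambda>r. r ^ (d - 1) * \<bar>g r\<bar> powr p) absolutely_integrable_on {0<..}"
    and I: "is_interval I" "I \<subseteq> {0<..}"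
  shows "locally_integrable_on I (\<lambda>r. - (r ^ (d - 1) * \<bar>g r\<bar> powr (p - 1)))"
proof (rule locally_integrable_on_realI[OF I(1)])
  fix a b :: real assume ab: "{a..b} \<subseteq> I"
  have "(\<lambda>r. r ^ (d - 1) * \<bar>g r\<bar> powr p) absolutely_integrable_on {a..b}"
    by (rule set_integrable_subset[OF gp]) (use ab I in auto)
  moreover have "(\<lambda>r::real. r ^ (d - 1)) absolutely_integrable_on {a..b}"
    by (intro absolutely_integrable_continuous_real continuous_intros)
  ultimately have "(\<lambda>r. r ^ (d - 1) + r ^ (d - 1) * \<bar>g r\<bar> powr p) absolutely_integrable_on {a..b}"
    by (rule set_integral_add(1)[rotated])
  then show "(\<lambda>r. - (r ^ (d - 1) * \<bar>g r\<bar> powr (p - 1))) absolutely_integrable_on {a..b}"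
  proof (rule set_integrable_bound)
    show "set_borel_measurable lebesgue {a..b} (\<lambda>r. - (r ^ (d - 1) * \<bar>g r\<bar> powr (p - 1)))"
      unfolding set_borel_measurable_def by (intro borel_measurable_lebesgueI) measurable
    have "norm (- (r ^ (d - 1) * \<bar>g r\<bar> powr (p - 1))) \<le> norm (r ^ (d - 1) + r ^ (d - 1) * \<bar>g r\<bar> powr p)"
      if "r \<in> {a..b}" for r
    proof -
      have r: "0 < r" using that ab I by auto
      have "\<bar>g r\<bar> powr (p - 1) \<le> 1 + \<bar>g r\<bar> powr p"
      proof (cases "\<bar>g r\<bar> \<le> 1")
        case True
        then have "\<bar>g r\<bar> powr (p - 1) \<le> 1" using p powr_mono2[of "p - 1" "\<bar>g r\<bar>" 1] by simp
        then show ?thesis by (simp add: add_increasing2)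
      next
        case False
        then have "\<bar>g r\<bar> powr (p - 1) \<le> \<bar>g r\<bar> powr p" by (intro powr_mono) auto
        then show ?thesis by simp
      qed
      then have "r ^ (d - 1) * \<bar>g r\<bar> powr (p - 1) \<le> r ^ (d - 1) * (1 + \<bar>g r\<bar> powr p)"
        using r by (intro mult_left_mono) auto
      then show ?thesis using r by (simp add: abs_mult distrib_left)
    qed
    then show "AE r in lebesgue. r \<in> {a..b} \<longrightarrow> norm (- (r ^ (d - 1) * \<bar>g r\<bar> powr (p - 1)))
        \<le> norm (r ^ (d - 1) + r ^ (d - 1) * \<bar>g r\<bar> powr p)" by simp
  qed
qed

text \<open>The assumption \<open>weak\<close> is the divergence form shared by the two problems:
  \<open>radial_ode_flux\<close> derives it from the radial equation and \<open>TF_flux\<close> from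
  the equation in space.\<close>

lemma flux_exists:
  fixes u g :: "real \<Rightarrow> real"
  assumes p: "1 < p" and q: "0 \<le> q" and u: "ac {0<..} u g" and g[measurable]: "g \<in> borel_measurable borel"
    and u01: "\<And>r. 0 < r \<Longrightarrow> 0 \<le> u r" "\<And>r. 0 < r \<Longrightarrow> u r \<le> 1"
    and gp: "(\<lambda>r. r ^ (d - 1) * \<bar>g r\<bar> powr p) absolutely_integrable_on {0<..}"
    and I: "open I" "is_interval I" "I \<noteq> {}" "I \<subseteq> {0<..}"
    and weak: "\<And>\<psi>. test_on I \<psi> \<Longrightarrow> (LINT r:I|lebesgue. deriv \<psi> r * - (r ^ (d - 1) * \<bar>g r\<bar> powr (p - 1)))
      = - (LINT r:I|lebesgue. \<psi> r * (r ^ (d - 1) * u r powr q))"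
  obtains W where "ac I W (\<lambda>r. r ^ (d - 1) * u r powr q)"
    "AE r in lebesgue. r \<in> I \<longrightarrow> W r = - (r ^ (d - 1) * \<bar>g r\<bar> powr (p - 1))"
proof (rule du_bois_reymond[OF I(1-3) flux_locally_integrable[OF p g gp I(2,4)] _ weak])
  define ut where "ut r = indicator {0<..} r *\<^sub>R u r" for r
  have ut[measurable]: "ut \<in> borel_measurable borel"
    unfolding ut_def[abs_def] by (rule ac_positive_borel[OF u])
  show "locally_integrable_on I (\<lambda>r. r ^ (d - 1) * u r powr q)"
  proof (rule locally_integrable_on_realI[OF I(2)])
    fix a b :: real assume ab: "{a..b} \<subseteq> I"
    have "(\<lambda>r. r ^ (d - 1) * ut r powr q) absolutely_integrable_on {a..b}"
    proof (rule bounded_measurable_absolutely_integrable)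
      fix r assume r: "r \<in> {a..b}"
      then have "0 < r" using ab I by auto
      then have "ut r powr q \<le> 1" using u01[of r] q powr_mono2[of q "u r" 1] by (auto simp: ut_def)
      then have "r ^ (d - 1) * ut r powr q \<le> b ^ (d - 1) * 1"
        using r \<open>0 < r\<close> by (intro mult_mono power_mono) auto
      then show "\<bar>r ^ (d - 1) * ut r powr q\<bar> \<le> b ^ (d - 1)" using \<open>0 < r\<close> by simp
    qed auto
    note int = this
    have eq: "ut r = u r" if "r \<in> {a..b}" for r
    proof -
      have "r \<in> {0<..}" using that ab I(4) by blast
      then show ?thesis by (simp add: ut_def)
    qed
    show "(\<lambda>r. r ^ (d - 1) * u r powr q) absolutely_integrable_on {a..b}"
      by (rule set_integral_AE_eq(1)[OF int]) (intro AE_I2, simp add: eq)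
  qed
qed (use that in auto)

lemma test_on_powr_has_derivative:
  assumes "test_on I f" "0 < r"
  shows "((\<lambda>r. f r * r powr m) has_real_derivative deriv f r * r powr m + m * (f r * r powr (m - 1))) (at r)"
  using assms(2) by (auto intro!: derivative_eq_intros test_on_deriv(1)[OF assms(1)] simp: powr_diff)

lemma powr_nat_shift: "0 < r \<Longrightarrow> 1 \<le> d \<Longrightarrow> (r::real) ^ (d - 1) = r powr (real d - 1)"
  by (simp add: powr_realpow[symmetric] of_nat_diff)

text \<open>Multiplying the test function by \<open>r\<^sup>d\<^sup>-\<^sup>1\<close> turns the radial equation into divergence form.\<close>

lemma radial_ode_flux:
  fixes u g :: "real \<Rightarrow> real"
  assumes d: "1 \<le> d" and p: "1 < p" and g[measurable]: "g \<in> borel_measurable borel" and g0: "\<And>r. g r \<le> 0"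
    and gp: "(\<lambda>r. r ^ (d - 1) * \<bar>g r\<bar> powr p) absolutely_integrable_on {0<..}"
    and rd: "AE r in lebesgue. r \<in> {0<..} \<longrightarrow> radial_deriv u r = g r"
    and I: "is_interval I" "I \<noteq> {}" "I \<subseteq> {0<..}"
    and ode: "radial_ode_weak d p q I u" and \<psi>: "test_on I \<psi>"
  shows "(LINT r:I|lebesgue. deriv \<psi> r * - (r ^ (d - 1) * \<bar>g r\<bar> powr (p - 1)))
      = - (LINT r:I|lebesgue. \<psi> r * (r ^ (d - 1) * u r powr q))"
proof -
  define Z where "Z r = - (r ^ (d - 1) * \<bar>g r\<bar> powr (p - 1))" for r
  have Z: "locally_integrable_on I Z" unfolding Z_def[abs_def] by (rule flux_locally_integrable[OF p g gp I(1,3)])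
  define w where "w r = \<bar>radial_deriv u r\<bar> powr (p - 2) * radial_deriv u r" for r
  define \<phi> where "\<phi> r = \<psi> r * r powr (real d - 1)" for r
  have \<phi>: "test_on I \<phi>" unfolding \<phi>_def[abs_def] by (rule test_on_powr[OF \<psi> I(3)])
  have d\<phi>: "deriv \<phi> r = deriv \<psi> r * r powr (real d - 1) + (real d - 1) * (\<psi> r * r powr (real d - 2))" if "0 < r" for r
  proof (rule DERIV_imp_deriv)
    show "(\<phi> has_real_derivative deriv \<psi> r * r powr (real d - 1) + (real d - 1) * (\<psi> r * r powr (real d - 2))) (at r)"
      using test_on_powr_has_derivative[OF \<psi> that, of "real d - 1"] by (simp add: \<phi>_def[abs_def])
  qed
  \<comment> \<open>The product \<open>\<eta> Z\<close> arises twice, from differentiating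
    \<open>r^(d-1)\<close> in the test function and from the term \<open>(d - 1) / r\<close> of the
    equation. The two contributions cancel.\<close>
  define \<eta> where "\<eta> r = (real d - 1) * (\<psi> r * r powr (- 1))" for r
  have \<eta>: "test_on I \<eta>"
    unfolding \<eta>_def[abs_def] by (intro test_on_mult[where g = "\<lambda>_. real d - 1"] test_on_powr[OF \<psi> I(3)] Ck_const)
  have iX: "set_integrable lebesgue I (\<lambda>r. deriv \<psi> r * Z r)" by (rule set_integrable_test_on[OF Z test_on_deriv(2)[OF \<psi>]])
  have iY: "set_integrable lebesgue I (\<lambda>r. \<eta> r * Z r)" by (rule set_integrable_test_on[OF Z \<eta>])
  have wZ: "AE r in lebesgue. r \<in> I \<longrightarrow> Z r = r powr (real d - 1) * w r"
    using rd
  proof eventually_elim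
    case (elim r)
    then show ?case using I(3) powr_nat_shift[OF _ d, of r] powr_flux(1)[OF g0, of r p]
      by (auto simp: w_def Z_def subset_iff)
  qed
  have "AE r in lebesgue. r \<in> I \<longrightarrow> deriv \<psi> r * Z r + \<eta> r * Z r = w r * deriv \<phi> r"
    using wZ
  proof eventually_elim
    case (elim r)
    show ?case
    proof
      assume r: "r \<in> I"
      then have "0 < r" using I(3) by auto
      moreover have "r powr (real d - 2) = r powr (- 1) * r powr (real d - 1)"
      proof -
        have "real d - 2 = - 1 + (real d - 1)" by simp
        then show ?thesis by (simp only: powr_add)
      qed
      ultimately show "deriv \<psi> r * Z r + \<eta> r * Z r = w r * deriv \<phi> r"
        using elim r by (simp add: d\<phi> \<eta>_def algebra_simps)
    qed
  qed
  from set_integral_AE_eq(2)[OF set_integral_add(1)[OF iX iY] this]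
  have E1: "(LINT r:I|lebesgue. w r * deriv \<phi> r) = (LINT r:I|lebesgue. deriv \<psi> r * Z r) + (LINT r:I|lebesgue. \<eta> r * Z r)"
    using set_integral_add(2)[OF iX iY] by simp
  have "AE r in lebesgue. r \<in> I \<longrightarrow> \<eta> r * Z r = (real d - 1) / r * w r * \<phi> r"
    using wZ by eventually_elim (use I(3) in \<open>auto simp: \<eta>_def \<phi>_def powr_minus divide_inverse\<close>)
  from set_integral_AE_eq(2)[OF iY this]
  have E2: "(LINT r:I|lebesgue. (real d - 1) / r * w r * \<phi> r) = (LINT r:I|lebesgue. \<eta> r * Z r)" by simp
  have E3: "(LINT r:I|lebesgue. u r powr q * \<phi> r) = (LINT r:I|lebesgue. \<psi> r * (r ^ (d - 1) * u r powr q))"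
  proof -
    have "indicator I r *\<^sub>R (u r powr q * \<phi> r) = indicator I r *\<^sub>R (\<psi> r * (r ^ (d - 1) * u r powr q))" for r
      using I(3) powr_nat_shift[OF _ d, of r] by (auto simp: indicator_def \<phi>_def)
    then show ?thesis by (simp only: set_lebesgue_integral_def)
  qed
  have "test_function I \<phi>" using \<phi> test_function_iff_test_on[OF I(1,2)] by simp
  then have "- (LINT r:I|lebesgue. w r * deriv \<phi> r) + (LINT r:I|lebesgue. (real d - 1) / r * w r * \<phi> r)
      = (LINT r:I|lebesgue. u r powr q * \<phi> r)"
    using ode unfolding radial_ode_weak_def Let_def w_def by blast
  then show ?thesis unfolding E1 E2 E3 Z_def by simp
qed

text \<open>The radial test function built from \<open>\<psi>\<close> vanishes at the origin, so the
  point mass drops out. The right side is then 0, and the common factor \<open>sphere_area d\<close>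
  can be divided out.\<close>

lemma TF_flux:
  fixes u g :: "real \<Rightarrow> real" and S :: "'a::euclidean_space set"
  assumes dim: "DIM('a) = d" and u: "ac {0<..} u g" and g[measurable]: "g \<in> borel_measurable borel" and g0: "\<And>r. g r \<le> 0"
    and lim: "(u \<longlongrightarrow> 1) (at_right 0)" and I: "open I" "I \<subseteq> {0<..}" "\<And>x::'a. norm x \<in> I \<Longrightarrow> x \<in> S"
    and TF: "TF_weak_on p q S (\<lambda>x::'a. u (norm x))" and \<psi>: "test_on I \<psi>"
  shows "(LINT r:I|lebesgue. deriv \<psi> r * - (r ^ (d - 1) * \<bar>g r\<bar> powr (p - 1)))
      = - (LINT r:I|lebesgue. \<psi> r * (r ^ (d - 1) * u r powr q))"
proof -
  define U where "U x = u (norm x)" for x :: 'a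
  define \<phi> where "\<phi> x = \<psi> (norm x)" for x :: 'a
  have \<psi>p: "test_on {0<..} \<psi>" by (rule test_on_subset[OF \<psi> I(2)])
  have "test_function S (\<lambda>x::'a. 1 * \<psi> (norm x))" using I by (intro test_function_radial[OF \<psi>] Ck_const) auto
  then have \<phi>: "test_function S \<phi>" by (simp add: \<phi>_def[abs_def])
  have z: "\<psi> r = 0" "deriv \<psi> r = 0" if "r \<notin> I" for r
  proof -
    obtain a b where "{a..b} \<subseteq> I" "\<And>x. x \<notin> {a..b} \<Longrightarrow> \<psi> x = 0" using test_onE[OF \<psi>] by metis
    then show "\<psi> r = 0" using that by blast
    obtain a b where "{a..b} \<subseteq> I" "\<And>x. x \<notin> {a..b} \<Longrightarrow> deriv \<psi> x = 0" using test_onE[OF test_on_deriv(2)[OF \<psi>]] by metis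
    then show "deriv \<psi> r = 0" using that by blast
  qed
  have grad: "AE x in lebesgue. weak_gradient UNIV U x = (g (norm x) / norm x) *\<^sub>R x"
    using weak_gradient_eq(2)[OF open_UNIV has_weak_gradient_radial[OF u g g0 lim, where 'a = 'a]]
    by (simp add: U_def[abs_def])
  define ut where "ut r = indicator {0<..} r *\<^sub>R u r" for r
  have ut[measurable]: "ut \<in> borel_measurable borel"
    unfolding ut_def[abs_def] by (rule ac_positive_borel[OF u])
  have [measurable]: "\<psi> \<in> borel_measurable borel" "deriv \<psi> \<in> borel_measurable borel"
    using test_on_deriv(3,4)[OF \<psi>] by (auto intro: borel_measurable_continuous_onI)
  define hh where "hh r = deriv \<psi> r * - (\<bar>g r\<bar> powr (p - 1))" for r
  define hq where "hq r = \<psi> r * ut r powr q" for r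
  have m[measurable]: "hh \<in> borel_measurable borel" "hq \<in> borel_measurable borel"
    unfolding hh_def[abs_def] hq_def[abs_def] by measurable
  have m': "(\<lambda>x::'a. hh (norm x)) \<in> borel_measurable lebesgue" "(\<lambda>x::'a. hq (norm x)) \<in> borel_measurable lebesgue"
    by (auto intro!: borel_measurable_lebesgueI)
  have AE1: "AE x in lebesgue. hh (norm x) = grad \<phi> x \<bullet> (norm (weak_gradient UNIV U x) powr (p - 2) *\<^sub>R weak_gradient UNIV U x)"
    using grad AE_nonzero[where 'a = 'a]
  proof eventually_elim
    case (elim x)
    have "(\<phi> has_derivative (\<lambda>h. deriv \<psi> (norm x) * norm x powr (-1) * (h \<bullet> x))) (at x)"
      unfolding \<phi>_def[abs_def] by (rule has_derivative_radial[OF \<psi>p])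
    from frechet_derivative_at[OF this] have "frechet_derivative \<phi> (at x) x = deriv \<psi> (norm x) * norm x powr (-1) * (x \<bullet> x)"
      by metis
    then have "grad \<phi> x \<bullet> x = deriv \<psi> (norm x) * norm x powr (-1) * (x \<bullet> x)"
      using grad_inner_frechet[OF test_function_props(5)[OF \<phi>]] by simp
    also have "\<dots> = deriv \<psi> (norm x) * norm x"
      using elim by (simp add: powr_minus power2_norm_eq_inner[symmetric] power2_eq_square)
    finally have "grad \<phi> x \<bullet> (norm (weak_gradient UNIV U x) powr (p - 2) *\<^sub>R weak_gradient UNIV U x)
        = deriv \<psi> (norm x) * (\<bar>g (norm x)\<bar> powr (p - 2) * g (norm x))"
      using elim by simp
    then show ?case by (simp only: powr_flux(1)[OF g0] hh_def)
  qed
  have AE2: "AE x in lebesgue. hq (norm x) = \<phi> x * U x powr q"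
    using AE_nonzero[where 'a = 'a] by eventually_elim (simp add: hq_def ut_def U_def \<phi>_def)
  have "radial \<phi>" unfolding radial_def \<phi>_def by blast
  then have "(LINT x|lebesgue. grad \<phi> x \<bullet> (norm (weak_gradient UNIV U x) powr (p - 2) *\<^sub>R weak_gradient UNIV U x))
      + (LINT x|lebesgue. \<phi> x * U x powr q) = TF_const p q U * \<phi> 0"
    using TF \<phi> unfolding TF_weak_on_def U_def[symmetric] by blast
  moreover have "\<phi> 0 = 0" using z(1)[of 0] I(2) by (auto simp: \<phi>_def)
  ultimately have "(LINT x::'a|lebesgue. hh (norm x)) + (LINT x::'a|lebesgue. hq (norm x)) = 0"
    unfolding integral_AE_eq(1)[OF m'(1) AE1] integral_AE_eq(1)[OF m'(2) AE2] by simp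
  then have E: "(LINT r:{0<..}|lebesgue. r ^ (d - 1) * hh r) + (LINT r:{0<..}|lebesgue. r ^ (d - 1) * hq r) = 0"
  proof -
    assume *: "(LINT x::'a|lebesgue. hh (norm x)) + (LINT x::'a|lebesgue. hq (norm x)) = 0"
    have "sphere_area d * ((LINT r:{0<..}|lebesgue. r ^ (d - 1) * hh r) + (LINT r:{0<..}|lebesgue. r ^ (d - 1) * hq r)) = 0"
      using * radial_integral(2)[OF m(1), where 'a = 'a] radial_integral(2)[OF m(2), where 'a = 'a]
      by (simp add: dim distrib_left)
    moreover have "sphere_area d \<noteq> 0" using sphere_area_pos[OF DIM_positive[where 'a = 'a]] unfolding dim by simp
    ultimately show "(LINT r:{0<..}|lebesgue. r ^ (d - 1) * hh r) + (LINT r:{0<..}|lebesgue. r ^ (d - 1) * hq r) = 0" by simp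
  qed
  have "(LINT r:{0<..}|lebesgue. r ^ (d - 1) * hh r) = (LINT r:I|lebesgue. deriv \<psi> r * - (r ^ (d - 1) * \<bar>g r\<bar> powr (p - 1)))"
    unfolding set_lebesgue_integral_def using I(2) z(2)
    by (intro Bochner_Integration.integral_cong) (auto simp: indicator_def hh_def)
  moreover have "(LINT r:{0<..}|lebesgue. r ^ (d - 1) * hq r) = (LINT r:I|lebesgue. \<psi> r * (r ^ (d - 1) * u r powr q))"
    unfolding set_lebesgue_integral_def using I(2) z(1)
    by (intro Bochner_Integration.integral_cong) (auto simp: indicator_def hq_def ut_def)
  ultimately show ?thesis using E by simp
qed

context radial_profile
begin

lemma
  shows u_weakly_differentiable: "weakly_differentiable_on {0<..} u"
    and radial_deriv_AE: "AE r in lebesgue. r \<in> {0<..} \<longrightarrow> radial_deriv u r = g r"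
proof -
  have "has_weak_gradient {0<..} u g" by (rule has_weak_gradient_ac[OF _ _ u]) (auto simp: is_interval_1)
  from weak_gradient_eq[OF _ this]
  show "weakly_differentiable_on {0<..} u" "AE r in lebesgue. r \<in> {0<..} \<longrightarrow> radial_deriv u r = g r" by auto
qed

lemma in_Ystar: "u \<in> Ystar_rad d p q"
proof -
  have "AE r in lebesgue. 0 < r \<longrightarrow> radial_deriv u r \<le> 0"
    using radial_deriv_AE by eventually_elim (use g0 in auto)
  moreover have "(\<lambda>r. (\<bar>u r\<bar> powr (q + 1) + \<bar>radial_deriv u r\<bar> powr p) * r ^ (d - 1)) absolutely_integrable_on {0<..}"
    by (rule set_integral_AE_eq(1)[OF energy]) (use radial_deriv_AE in \<open>eventually_elim, auto\<close>)
  ultimately show ?thesis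
    using u0 lim u_weakly_differentiable ac_continuous_open[OF u] by (simp add: Ystar_rad_def)
qed

text \<open>The converse of \<open>radial_ode_flux\<close>: \<open>W\<close> is tested with
  \<open>r^(1-d) \<phi>\<close>, and differentiating the power produces the term with
  \<open>(d - 1) / r\<close>.\<close>

lemma ode_weak: "radial_ode_weak d p q I u"
  unfolding radial_ode_weak_def Let_def
proof (intro allI impI)
  fix \<phi> :: "real \<Rightarrow> real" assume "test_function I \<phi>"
  moreover have "I \<noteq> {}" using b_in_I by auto
  ultimately have \<phi>: "test_on I \<phi>" using test_function_iff_test_on[OF I_interval] by simp
  have Ip: "I \<subseteq> {0<..}" using I_pos by auto
  define w where "w r = \<bar>radial_deriv u r\<bar> powr (p - 2) * radial_deriv u r" for r
  define \<psi> where "\<psi> r = \<phi> r * r powr (1 - real d)" for r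
  have \<psi>: "test_on I \<psi>" unfolding \<psi>_def[abs_def] by (rule test_on_powr[OF \<phi> Ip])
  have d\<psi>: "deriv \<psi> r = deriv \<phi> r * r powr (1 - real d) - (real d - 1) * (\<phi> r * r powr (- real d))" if "0 < r" for r
  proof (rule DERIV_imp_deriv)
    show "(\<psi> has_real_derivative deriv \<phi> r * r powr (1 - real d) - (real d - 1) * (\<phi> r * r powr (- real d))) (at r)"
      using test_on_powr_has_derivative[OF \<phi> that, of "1 - real d"] by (simp add: \<psi>_def[abs_def] algebra_simps)
  qed
  have Wl: "locally_integrable_on I W" by (rule ac_locally_integrable(1)[OF W I_interval])
  have iX: "set_integrable lebesgue I (\<lambda>r. deriv \<phi> r * r powr (1 - real d) * W r)"
    by (rule set_integrable_test_on[OF Wl test_on_powr[OF test_on_deriv(2)[OF \<phi>] Ip]])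
  have iY: "set_integrable lebesgue I (\<lambda>r. (real d - 1) * (\<phi> r * r powr (- real d)) * W r)"
    by (intro set_integrable_test_on[OF Wl] test_on_mult[where g = "\<lambda>_. real d - 1"] test_on_powr[OF \<phi> Ip] Ck_const)
  have wW: "AE r in lebesgue. r \<in> I \<longrightarrow> r powr (1 - real d) * W r = w r"
    using radial_deriv_AE Wg
  proof eventually_elim
    case (elim r)
    show ?case
    proof
      assume r: "r \<in> I"
      have r0: "0 < r" using I_pos[OF r] .
      have "r powr (1 - real d) * W r = - (\<bar>g r\<bar> powr (p - 1)) * (r powr (1 - real d) * r powr (real d - 1))"
        using elim r powr_nat_shift[OF r0 d] by simp
      also have "r powr (1 - real d) * r powr (real d - 1) = 1" using r0 by (simp add: powr_add[symmetric])
      finally show "r powr (1 - real d) * W r = w r"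
        using elim r0 powr_flux(1)[OF g0, of r p] by (simp add: w_def)
    qed
  qed
  have "AE r in lebesgue. r \<in> I \<longrightarrow> deriv \<phi> r * r powr (1 - real d) * W r = w r * deriv \<phi> r"
    using wW by eventually_elim (auto simp: mult_ac)
  from set_integral_AE_eq(2)[OF iX this]
  have E1: "(LINT r:I|lebesgue. w r * deriv \<phi> r) = (LINT r:I|lebesgue. deriv \<phi> r * r powr (1 - real d) * W r)" by simp
  have "AE r in lebesgue. r \<in> I \<longrightarrow> (real d - 1) * (\<phi> r * r powr (- real d)) * W r = (real d - 1) / r * w r * \<phi> r"
    using wW
  proof eventually_elim
    case (elim r)
    show ?case
    proof
      assume r: "r \<in> I"
      have "r powr (- real d) = r powr (1 - real d) / r" using I_pos[OF r] by (simp add: powr_diff powr_minus field_simps)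
      then show "(real d - 1) * (\<phi> r * r powr (- real d)) * W r = (real d - 1) / r * w r * \<phi> r"
        using elim r by (simp add: mult_ac flip: elim)
    qed
  qed
  from set_integral_AE_eq(2)[OF iY this]
  have E2: "(LINT r:I|lebesgue. (real d - 1) / r * w r * \<phi> r) = (LINT r:I|lebesgue. (real d - 1) * (\<phi> r * r powr (- real d)) * W r)"
    by simp
  have "(LINT r:I|lebesgue. deriv \<psi> r * W r) =
      (LINT r:I|lebesgue. deriv \<phi> r * r powr (1 - real d) * W r - (real d - 1) * (\<phi> r * r powr (- real d)) * W r)"
    unfolding set_lebesgue_integral_def using I_pos
    by (intro Bochner_Integration.integral_cong) (auto simp: indicator_def d\<psi> left_diff_distrib)
  also have "\<dots> = (LINT r:I|lebesgue. w r * deriv \<phi> r) - (LINT r:I|lebesgue. (real d - 1) / r * w r * \<phi> r)"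
    unfolding E1 E2 by (rule set_integral_diff(2)[OF iX iY])
  finally have "(LINT r:I|lebesgue. w r * deriv \<phi> r) - (LINT r:I|lebesgue. (real d - 1) / r * w r * \<phi> r)
      = - (LINT r:I|lebesgue. \<psi> r * (r ^ (d - 1) * u r powr q))"
    using ac_weak(1)[OF W \<psi>] by simp
  moreover have "(LINT r:I|lebesgue. \<psi> r * (r ^ (d - 1) * u r powr q)) = (LINT r:I|lebesgue. u r powr q * \<phi> r)"
  proof -
    have "\<psi> r * (r ^ (d - 1) * u r powr q) = u r powr q * \<phi> r" if "r \<in> I" for r
    proof -
      have "r powr (1 - real d) * r powr (real d - 1) = 1" using I_pos[OF that] by (simp add: powr_add[symmetric])
      then have "\<phi> r * u r powr q * (r powr (1 - real d) * r ^ (d - 1)) = \<phi> r * u r powr q"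
        using powr_nat_shift[OF I_pos[OF that] d] by simp
      then show ?thesis by (simp add: \<psi>_def mult_ac)
    qed
    then show ?thesis
      unfolding set_lebesgue_integral_def by (intro Bochner_Integration.integral_cong) (auto simp: indicator_def)
  qed
  ultimately show "- (LINT r:I|lebesgue. \<bar>radial_deriv u r\<bar> powr (p - 2) * radial_deriv u r * deriv \<phi> r)
      + (LINT r:I|lebesgue. (real d - 1) / r * (\<bar>radial_deriv u r\<bar> powr (p - 2) * radial_deriv u r) * \<phi> r)
      = (LINT r:I|lebesgue. u r powr q * \<phi> r)"
    unfolding w_def by linarith
qed

end

section \<open>The one-dimensional constant\<close>


context radial_profile
begin

definition Wt :: "real \<Rightarrow> real" where "Wt r = indicator I r *\<^sub>R W r"

lemma Wt_borel [measurable]: "Wt \<in> borel_measurable borel"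
  unfolding Wt_def[abs_def] using openI by (intro borel_measurable_continuous_on_indicator W_continuous) simp

lemma Wt_eq: "r \<in> I \<Longrightarrow> Wt r = W r" by (simp add: Wt_def)

lemma p_gt_1: "1 < p" using d p by linarith

text \<open>For \<open>d = 1\<close> the flux carries no weight, and
  \<open>|W| = |g| powr (p - 1)\<close> can be solved for \<open>g\<close>. This gives
  \<open>u'\<close> as a continuous function of \<open>W\<close>, so that \<open>u\<close> is
  continuously differentiable on \<open>I\<close>.\<close>

lemma one_dim_u_derivative:
  assumes "d = 1"
  shows "ac I u (\<lambda>r. - (\<bar>Wt r\<bar> powr (1 / (p - 1))))"
proof (rule ac_cong_AE[OF ac_subset[OF u]])
  show "I \<subseteq> {0<..}" using I_pos by auto
  show "(\<lambda>r. - (\<bar>Wt r\<bar> powr (1 / (p - 1)))) \<in> borel_measurable lebesgue"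
    by (intro borel_measurable_lebesgueI) measurable
  show "AE r in lebesgue. r \<in> I \<longrightarrow> g r = - (\<bar>Wt r\<bar> powr (1 / (p - 1)))"
    using Wg
  proof eventually_elim
    case (elim r)
    have "(\<bar>g r\<bar> powr (p - 1)) powr (1 / (p - 1)) = \<bar>g r\<bar>" using p_gt_1 by (simp add: powr_powr)
    then show ?case using elim g0[of r] assms by (auto simp: Wt_eq)
  qed
qed

text \<open>\<open>W\<close> increases to some limit \<open>L \<le> 0\<close> at the right end. If
  \<open>L < 0\<close>, then \<open>W \<le> L\<close> on \<open>I\<close> and
  \<open>|u'| \<ge> (- L) powr (1 / (p - 1))\<close>, hence the linear decrease. The second
  alternative is refuted separately for the half-line and for a bounded interval.\<close>

lemma W_end:
  assumes "d = 1"
  shows "(\<lambda>n. W (b n)) \<longlonglongrightarrow> 0 \<or> (\<exists>k>0. \<forall>s t. s \<in> I \<longrightarrow> t \<in> I \<longrightarrow> s \<le> t \<longrightarrow> u t \<le> u s - k * (t - s))"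
proof -
  have inc: "incseq (\<lambda>n. W (b n))"
    using b(1) by (intro incseq_SucI W_mono b_in_I) (simp add: incseq_Suc_iff)
  have "bdd_above (range (\<lambda>n. W (b n)))" using W_nonpos[OF b_in_I] by (auto intro!: bdd_aboveI)
  from LIMSEQ_incseq_SUP[OF this inc] obtain L where L: "(\<lambda>n. W (b n)) \<longlonglongrightarrow> L" by blast
  have le: "W (b n) \<le> L" for n by (rule incseq_le[OF inc L])
  have "L \<le> 0" by (rule tendsto_upperbound[OF L]) (use W_nonpos[OF b_in_I] in auto)
  show ?thesis
  proof (cases "L = 0")
    case False
    then have L0: "L < 0" using \<open>L \<le> 0\<close> by simp
    have WL: "W r \<le> L" if "r \<in> I" for r
    proof -
      obtain n where "r \<le> b n" using \<open>r \<in> I\<close> by (auto simp: I)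
      then show ?thesis using W_mono[OF that b_in_I] le[of n] by force
    qed
    define k where "k = (- L) powr (1 / (p - 1))"
    have "0 < k" using L0 by (simp add: k_def)
    moreover have "u t \<le> u s - k * (t - s)" if st: "s \<in> I" "t \<in> I" "s \<le> t" for s t
    proof -
      note acu = one_dim_u_derivative[OF assms]
      have sub: "{s..t} \<subseteq> I" by (rule Icc_subset[OF st(2) I_pos[OF st(1)]])
      have "integral {s..t} (\<lambda>r. - (\<bar>Wt r\<bar> powr (1 / (p - 1)))) \<le> integral {s..t} (\<lambda>_. - k)"
      proof (rule integral_le)
        show "(\<lambda>r. - (\<bar>Wt r\<bar> powr (1 / (p - 1)))) integrable_on {s..t}"
          by (rule set_lebesgue_integral_eq_integral(1)[OF acD(1)[OF acu st(3) sub]])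
        fix r assume "r \<in> {s..t}"
        then have "r \<in> I" using sub by auto
        then have "k \<le> \<bar>Wt r\<bar> powr (1 / (p - 1))"
          unfolding k_def using WL[OF \<open>r \<in> I\<close>] L0 p_gt_1 by (intro powr_mono2) (auto simp: Wt_eq)
        then show "- (\<bar>Wt r\<bar> powr (1 / (p - 1))) \<le> - k" by simp
      qed (rule integrable_const_ivl)
      then show ?thesis using acD(2)[OF acu st(3) sub] st(3) by (simp add: mult.commute)
    qed
    ultimately show ?thesis by blast
  qed (use L in simp)
qed

text \<open>The first integral \<open>|W|\<^sup>p\<^sup>/\<^sup>(\<^sup>p\<^sup>-\<^sup>1\<^sup>) - p / ((p - 1) (q + 1)) u\<^sup>q\<^sup>+\<^sup>1\<close> of the one-dimensional equation is
  evaluated at both ends.\<close>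

lemma one_dim_W0:
  assumes d1: "d = 1" and pos: "\<And>r. r \<in> I \<Longrightarrow> 0 < q \<or> 0 < u r" and Wb: "(\<lambda>n. W (b n)) \<longlonglongrightarrow> 0"
  shows "- W0 = (p / ((q + 1) * (p - 1))) powr ((p - 1) / p)"
proof -
  \<comment> \<open>\<open>s\<close> is the exponent conjugate to \<open>p\<close>, and
    \<open>c\<close> is determined by \<open>c * (q + 1) = s\<close>, which makes the derivative of
    \<open>E\<close> vanish.\<close>
  define s where "s = p / (p - 1)"
  define c where "c = p / ((q + 1) * (p - 1))"
  define E where "E r = \<bar>W r\<bar> powr s - c * \<bar>u r\<bar> powr (q + 1)" for r
  have nz: "p - 1 \<noteq> 0" "q + 1 \<noteq> 0" using p_gt_1 q by auto
  have s: "1 < s" "s - 1 = 1 / (p - 1)" "c * (q + 1) = s"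
  proof -
    show "1 < s" using p_gt_1 by (simp add: s_def)
    have "s - 1 = p / (p - 1) - (p - 1) / (p - 1)" using nz by (simp add: s_def)
    also have "\<dots> = (p - (p - 1)) / (p - 1)" by (rule diff_divide_distrib[symmetric])
    finally show "s - 1 = 1 / (p - 1)" by simp
    show "c * (q + 1) = s" using nz by (simp add: c_def s_def)
  qed
  have cu: "continuous_on I u"
    by (rule continuous_on_subset[OF ac_continuous_open[OF u]]) (use I_pos in auto)
  have DW: "(W has_real_derivative u r powr q) (at r)" if "r \<in> I" for r
  proof (rule ac_has_derivative[OF _ openI _ that])
    show "ac I W (\<lambda>r. u r powr q)" using W d1 by simp
    \<comment> \<open>For \<open>q = 0\<close> the power jumps from 1 to \<open>0 powr 0 = 0\<close>
      at a zero of \<open>u\<close>; the assumption \<open>pos\<close> rules this out.\<close>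
    show "continuous_on I (\<lambda>r. u r powr q)"
      using pos u0[OF I_pos] by (intro continuous_on_powr' cu continuous_intros) force
  qed
  have Du: "(u has_real_derivative - (\<bar>W r\<bar> powr (1 / (p - 1)))) (at r)" if "r \<in> I" for r
  proof -
    have "continuous_on I (\<lambda>r. - (\<bar>W r\<bar> powr (1 / (p - 1))))"
      using p_gt_1 by (intro continuous_intros continuous_on_powr' W_continuous) auto
    then have "continuous_on I (\<lambda>r. - (\<bar>Wt r\<bar> powr (1 / (p - 1))))"
      by (rule continuous_on_cong[THEN iffD1, rotated 2]) (simp_all add: Wt_eq)
    from ac_has_derivative[OF one_dim_u_derivative[OF d1] openI this that] show ?thesis using that by (simp add: Wt_eq)
  qed
  have "(E has_real_derivative 0) (at r)" if r: "r \<in> I" for r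
  proof -
    have D1: "((\<lambda>r. \<bar>W r\<bar> powr s) has_real_derivative s * \<bar>W r\<bar> powr (s - 1) * sgn (W r) * u r powr q) (at r)"
      by (rule DERIV_chain2[OF has_real_derivative_abs_powr DW[OF r]]) (use s in simp)
    have D2: "((\<lambda>r. \<bar>u r\<bar> powr (q + 1)) has_real_derivative
        (q + 1) * \<bar>u r\<bar> powr (q + 1 - 1) * sgn (u r) * - (\<bar>W r\<bar> powr (1 / (p - 1)))) (at r)"
      by (rule DERIV_chain2[OF has_real_derivative_abs_powr Du[OF r]]) (use pos[OF r] in auto)
    have "(E has_real_derivative s * \<bar>W r\<bar> powr (s - 1) * sgn (W r) * u r powr q
        - c * ((q + 1) * \<bar>u r\<bar> powr (q + 1 - 1) * sgn (u r) * - (\<bar>W r\<bar> powr (1 / (p - 1))))) (at r)"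
      unfolding E_def[abs_def] by (intro DERIV_diff DERIV_cmult D1 D2)
    moreover have "s * \<bar>W r\<bar> powr (s - 1) * sgn (W r) * u r powr q
        - c * ((q + 1) * \<bar>u r\<bar> powr (q + 1 - 1) * sgn (u r) * - (\<bar>W r\<bar> powr (1 / (p - 1)))) = 0"
    proof -
      have "\<bar>W r\<bar> powr (s - 1) * sgn (W r) = - (\<bar>W r\<bar> powr (s - 1))" using W_nonpos[OF r] by (cases "W r = 0") auto
      moreover have "\<bar>u r\<bar> powr (q + 1 - 1) * sgn (u r) = u r powr q" using u0[OF I_pos[OF r]] by (cases "u r = 0") auto
      ultimately have "s * (\<bar>W r\<bar> powr (s - 1) * sgn (W r)) * u r powr q
        - (c * (q + 1)) * (\<bar>u r\<bar> powr (q + 1 - 1) * sgn (u r)) * - (\<bar>W r\<bar> powr (1 / (p - 1))) = 0"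
        by (simp only: s(2,3)) simp
      then show ?thesis by (simp only: mult.assoc)
    qed
    ultimately show ?thesis by simp
  qed
  then have "\<exists>k. \<forall>r\<in>I. E r = k"
    using I_interval by (intro has_field_derivative_zero_constant)
      (auto simp: is_interval_convex intro: has_field_derivative_at_within)
  then obtain k where k: "\<And>r. r \<in> I \<Longrightarrow> E r = k" by blast
  \<comment> \<open>At the right end \<open>W\<close> and \<open>u\<close> both tend to 0, so the
    conserved quantity is 0. At the left end \<open>u\<close> tends to 1, which leaves
    \<open>|W0| powr s = c\<close>.\<close>
  have "(\<lambda>n. E (b n)) \<longlonglongrightarrow> \<bar>0\<bar> powr s - c * \<bar>0\<bar> powr (q + 1)"
    unfolding E_def using s q by (intro tendsto_intros tendsto_powr' Wb ub) auto
  then have "k = 0" using k[OF b_in_I] by (simp add: LIMSEQ_const_iff)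
  have "(\<lambda>n. u (a n)) \<longlonglongrightarrow> 1" by (rule filterlim_compose[OF lim a_lim])
  then have "(\<lambda>n. E (a n)) \<longlonglongrightarrow> \<bar>W0\<bar> powr s - c * \<bar>1\<bar> powr (q + 1)"
    unfolding E_def using s q by (intro tendsto_intros tendsto_powr' W0) auto
  then have "\<bar>W0\<bar> powr s = c" using k[OF a_in_I] \<open>k = 0\<close> by (simp add: LIMSEQ_const_iff)
  then have "c powr ((p - 1) / p) = (\<bar>W0\<bar> powr s) powr ((p - 1) / p)" by simp
  also have "\<dots> = \<bar>W0\<bar>" using p_gt_1 by (simp add: powr_powr s_def)
  finally show ?thesis using W0_nonpos by (simp add: c_def)
qed

end

section \<open>Borel derivatives extracted from the given solutions\<close>

lemma Ystar_rad_profile: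
  assumes "u \<in> Ystar_rad d p q"
  obtains g where "g \<in> borel_measurable borel" "\<And>r. g r \<le> 0" "ac {0<..} u g"
    "AE r in lebesgue. r \<in> {0<..} \<longrightarrow> radial_deriv u r = g r"
    "(\<lambda>r. (\<bar>u r\<bar> powr (q + 1) + \<bar>g r\<bar> powr p) * r ^ (d - 1)) absolutely_integrable_on {0<..}"
proof -
  let ?h = "radial_deriv u"
  have cont: "continuous_on {0<..} u" and wd: "weakly_differentiable_on {0<..} u"
    and neg: "AE r in lebesgue. 0 < r \<longrightarrow> ?h r \<le> 0"
    and en: "(\<lambda>r. (\<bar>u r\<bar> powr (q + 1) + \<bar>?h r\<bar> powr p) * r ^ (d - 1)) absolutely_integrable_on {0<..}"
    using assms by (auto simp: Ystar_rad_def)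
  have int: "is_interval {0::real<..}" by (auto simp: is_interval_1)
  have wg: "locally_integrable_on {0<..} u" "locally_integrable_on {0<..} ?h"
    "\<And>\<phi>. test_on {0<..} \<phi> \<Longrightarrow> (LINT x:{0<..}|lebesgue. deriv \<phi> x * u x) = - (LINT x:{0<..}|lebesgue. \<phi> x * ?h x)"
    using weakly_differentiableD[OF wd] has_weak_gradient_real_iff[OF int] by auto
  obtain F where F: "ac {0<..} F ?h" "AE r in lebesgue. r \<in> {0<..} \<longrightarrow> F r = u r"
    by (rule du_bois_reymond[of "{0<..}" u ?h]) (use int wg in auto)
  \<comment> \<open>\<open>Ystar_rad\<close> contains continuous representatives, hence equality at
    every point.\<close>
  have "F r = u r" if "r \<in> {0<..}" for r
    by (rule continuous_AE_eq[of "{0<..}", OF _ ac_continuous_open[OF F(1)] cont F(2) that]) auto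
  then have uh: "ac {0<..} u ?h" by (rule ac_cong[OF F(1)])
  \<comment> \<open>Local integrability yields measurability of the weak derivative on compact
    subintervals only; the half-line is reached as a limit.\<close>
  have "(\<lambda>r. indicator {0<..} r *\<^sub>R ?h r) \<in> borel_measurable lebesgue"
  proof (rule borel_measurable_LIMSEQ_metric)
    fix n
    have "{1 / real (Suc n)..real (Suc n)} \<subseteq> {0<..}" by (auto intro: less_le_trans[rotated])
    then have "?h absolutely_integrable_on {1 / real (Suc n)..real (Suc n)}"
      using wg(2) by (auto simp: locally_integrable_on_def)
    then show "(\<lambda>r. indicator {1 / real (Suc n)..real (Suc n)} r *\<^sub>R ?h r) \<in> borel_measurable lebesgue"
      unfolding set_integrable_def by (rule borel_measurable_integrable)
  next
    fix r :: real
    show "(\<lambda>n. indicator {1 / real (Suc n)..real (Suc n)} r *\<^sub>R ?h r) \<longlonglongrightarrow> indicator {0<..} r *\<^sub>R ?h r"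
    proof (rule tendsto_eventually, cases "0 < r")
      case True
      obtain N where "r \<le> real N" using real_arch_simple by blast
      then have "\<forall>\<^sub>F n in sequentially. r \<le> real (Suc n)" by (intro eventually_sequentiallyI[of N]) simp
      with reciprocal_exhaust[OF True]
      show "\<forall>\<^sub>F n in sequentially. indicator {1 / real (Suc n)..real (Suc n)} r *\<^sub>R ?h r = indicator {0<..} r *\<^sub>R ?h r"
        by eventually_elim (use True in \<open>simp add: indicator_def\<close>)
    next
      case False
      then have "r \<notin> {1 / real (Suc n)..real (Suc n)}" for n
      proof -
        have "0 < 1 / real (Suc n)" by simp
        then show ?thesis using False order.strict_trans2[of 0 "1 / real (Suc n)" r] by auto
      qed
      then show "\<forall>\<^sub>F n in sequentially. indicator {1 / real (Suc n)..real (Suc n)} r *\<^sub>R ?h r = indicator {0<..} r *\<^sub>R ?h r"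
        using False by (simp add: indicator_def)
    qed
  qed
  then obtain g' where g': "g' \<in> borel_measurable lborel" "AE r in lborel. indicator {0<..} r *\<^sub>R ?h r = g' r"
    using completion_ex_borel_measurable_real by blast
  define g where "g r = min 0 (g' r)" for r
  have g: "g \<in> borel_measurable borel" unfolding g_def[abs_def] using g'(1) by simp
  have hg: "AE r in lebesgue. r \<in> {0<..} \<longrightarrow> ?h r = g r"
    using AE_completion[OF g'(2)] neg by eventually_elim (auto simp: g_def)
  show ?thesis
  proof (rule that[OF g _ _ hg])
    show "g r \<le> 0" for r by (simp add: g_def)
    show "ac {0<..} u g" by (rule ac_cong_AE[OF uh hg borel_measurable_lebesgueI[OF g]])
    show "(\<lambda>r. (\<bar>u r\<bar> powr (q + 1) + \<bar>g r\<bar> powr p) * r ^ (d - 1)) absolutely_integrable_on {0<..}"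
      by (rule set_integral_AE_eq(1)[OF en]) (use hg in \<open>eventually_elim, auto\<close>)
  qed
qed

lemma energy_gradient_part:
  fixes u g :: "real \<Rightarrow> real"
  assumes g[measurable]: "g \<in> borel_measurable borel"
    and en: "(\<lambda>r. (\<bar>u r\<bar> powr (q + 1) + \<bar>g r\<bar> powr p) * r ^ (d - 1)) absolutely_integrable_on {0<..}"
  shows "(\<lambda>r. r ^ (d - 1) * \<bar>g r\<bar> powr p) absolutely_integrable_on {0<..}"
proof (rule set_integrable_bound[OF en])
  show "set_borel_measurable lebesgue {0<..} (\<lambda>r. r ^ (d - 1) * \<bar>g r\<bar> powr p)"
    unfolding set_borel_measurable_def by (intro borel_measurable_lebesgueI) measurable
qed (auto simp: abs_mult mult.commute intro!: mult_right_mono)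

text \<open>Restriction to a ray along a basis vector transfers monotonicity and the limit at the
  origin. By uniqueness of weak gradients the norm of the gradient is \<open>|g (norm x)|\<close>
  almost everywhere, so the integrability conditions in space become weighted conditions in
  \<open>r\<close>.\<close>

lemma TF_weak_profile:
  fixes u :: "real \<Rightarrow> real"
  assumes p: "1 \<le> p" and TF: "TF_weak_on p q S (\<lambda>x::'a::euclidean_space. u (norm x))"
    and mono: "radial_nonincreasing (\<lambda>x::'a. u (norm x))" and lim0: "((\<lambda>x::'a. u (norm x)) \<longlongrightarrow> 1) (at 0)"
  obtains g where "g \<in> borel_measurable borel" "\<And>r. g r \<le> 0" "ac {0<..} u g" "(u \<longlongrightarrow> 1) (at_right 0)"
    "(\<lambda>r. (\<bar>u r\<bar> powr (q + 1) + \<bar>g r\<bar> powr p) * r ^ (DIM('a) - 1)) absolutely_integrable_on {0<..}"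
proof -
  obtain e :: 'a where e: "e \<in> Basis" by (meson equals0I nonempty_Basis)
  let ?U = "\<lambda>x::'a. u (norm x)" and ?d = "DIM('a)"
  have anti: "u s \<le> u r" if "0 < r" "r \<le> s" for r s
  proof -
    have "r *\<^sub>R e \<noteq> 0" "norm (r *\<^sub>R e) \<le> norm (s *\<^sub>R e)" using that e by auto
    then have "?U (s *\<^sub>R e) \<le> ?U (r *\<^sub>R e)" using mono unfolding radial_nonincreasing_def by blast
    then show ?thesis using that e by simp
  qed
  have lim: "(u \<longlongrightarrow> 1) (at_right 0)"
  proof -
    have "filterlim (\<lambda>r. r *\<^sub>R e) (at 0) (at_right 0)"
      unfolding filterlim_at using nonzero_Basis[OF e] by (auto simp: eventually_at_filter intro!: tendsto_eq_intros)
    from filterlim_compose[OF lim0 this] show ?thesis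
      by (rule Lim_transform_eventually) (use e in \<open>auto simp: eventually_at_filter\<close>)
  qed
  have wd: "weakly_differentiable_on UNIV ?U" and Gp: "in_Lp p (weak_gradient UNIV ?U)" and Uq: "in_Lp (q + 1) ?U"
    using TF by (auto simp: TF_weak_on_def)
  obtain g where g: "g \<in> borel_measurable borel" "\<And>r. g r \<le> 0" "ac {0<..} u g"
    using radial_weak_gradient_profile[OF anti weakly_differentiableD[OF wd] _ _ p] Gp
    unfolding in_Lp_def by blast
  note [measurable] = g(1)
  have "AE x in lebesgue. weak_gradient UNIV ?U x = (g (norm x) / norm x) *\<^sub>R x"
    using weak_gradient_eq(2)[OF open_UNIV has_weak_gradient_radial[OF g(3,1,2) lim, where 'a = 'a]] by simp
  then have "AE x in lebesgue. \<bar>g (norm x)\<bar> powr p = norm (weak_gradient UNIV ?U x) powr p"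
    using AE_nonzero[where 'a = 'a] by eventually_elim simp
  from integral_AE_eq(2)[OF _ this]
  have "integrable lebesgue (\<lambda>x::'a. \<bar>g (norm x)\<bar> powr p)"
    using Gp by (simp add: in_Lp_def borel_measurable_lebesgueI)
  then have gp: "(\<lambda>r. r ^ (?d - 1) * \<bar>g r\<bar> powr p) absolutely_integrable_on {0<..}"
    using radial_integral(1)[of "\<lambda>r. \<bar>g r\<bar> powr p", where 'a = 'a] by simp
  define ut where "ut r = indicator {0<..} r *\<^sub>R u r" for r
  have ut[measurable]: "ut \<in> borel_measurable borel"
    unfolding ut_def[abs_def] by (rule ac_positive_borel[OF g(3)])
  have "AE x::'a in lebesgue. \<bar>ut (norm x)\<bar> powr (q + 1) = norm (?U x) powr (q + 1)"
    using AE_nonzero[where 'a = 'a] by eventually_elim (simp add: ut_def)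
  from integral_AE_eq(2)[OF _ this]
  have "integrable lebesgue (\<lambda>x::'a. \<bar>ut (norm x)\<bar> powr (q + 1))"
    using Uq by (simp add: in_Lp_def borel_measurable_lebesgueI)
  then have "(\<lambda>r. r ^ (?d - 1) * \<bar>ut r\<bar> powr (q + 1)) absolutely_integrable_on {0<..}"
    using radial_integral(1)[of "\<lambda>r. \<bar>ut r\<bar> powr (q + 1)", where 'a = 'a] by simp
  from set_integral_add(1)[OF this gp]
  have "(\<lambda>r. (\<bar>u r\<bar> powr (q + 1) + \<bar>g r\<bar> powr p) * r ^ (?d - 1)) absolutely_integrable_on {0<..}"
    by (rule set_integral_AE_eq(1)) (intro AE_I2, simp add: ut_def algebra_simps)
  with g lim that show ?thesis by blast
qed

section \<open>Equivalence of the two problems\<close>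


lemma radial_profile_half_line:
  fixes u g W :: "real \<Rightarrow> real"
  assumes "1 \<le> d" "real d < p" "0 \<le> q" "ac {0<..} u g" "g \<in> borel_measurable borel" "\<And>r. g r \<le> 0"
    "\<And>r. 0 < r \<Longrightarrow> 0 \<le> u r" "(u \<longlongrightarrow> 1) (at_right 0)"
    "(\<lambda>r. (\<bar>u r\<bar> powr (q + 1) + \<bar>g r\<bar> powr p) * r ^ (d - 1)) absolutely_integrable_on {0<..}"
    "(u \<longlongrightarrow> 0) at_top" "ac {0<..} W (\<lambda>r. r ^ (d - 1) * u r powr q)"
    "AE r in lebesgue. r \<in> {0<..} \<longrightarrow> W r = - (r ^ (d - 1) * \<bar>g r\<bar> powr (p - 1))"
  shows "radial_profile d p q {0<..} (\<lambda>n. real (Suc n)) u g W"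
proof
  show "{0<..} = (\<Union>n. {0<..real (Suc n)})"
  proof (intro equalityI subsetI)
    fix r :: real assume "r \<in> {0<..}"
    moreover obtain n where "r \<le> real n" using real_arch_simple by blast
    ultimately show "r \<in> (\<Union>n. {0<..real (Suc n)})" by (intro UN_I[of n]) auto
  qed auto
  have "filterlim (\<lambda>n. real (Suc n)) at_top sequentially"
    by (rule filterlim_compose[OF filterlim_real_sequentially filterlim_Suc])
  then show "(\<lambda>n. u (real (Suc n))) \<longlonglongrightarrow> 0" by (rule filterlim_compose[OF assms(10)])
qed (use assms in \<open>auto simp: incseq_Suc_iff\<close>)

lemma radial_profile_bounded:
  fixes u g W :: "real \<Rightarrow> real"
  assumes R: "0 < R" and u: "ac {0<..} u g" and g: "g \<in> borel_measurable borel" "\<And>r. g r \<le> 0"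
    and uR: "\<And>r. R \<le> r \<Longrightarrow> u r = 0" and
    "1 \<le> d" "real d < p" "0 \<le> q"
    "\<And>r. 0 < r \<Longrightarrow> 0 \<le> u r" "(u \<longlongrightarrow> 1) (at_right 0)"
    "(\<lambda>r. (\<bar>u r\<bar> powr (q + 1) + \<bar>g r\<bar> powr p) * r ^ (d - 1)) absolutely_integrable_on {0<..}"
    "ac {0<..<R} W (\<lambda>r. r ^ (d - 1) * u r powr q)"
    "AE r in lebesgue. r \<in> {0<..<R} \<longrightarrow> W r = - (r ^ (d - 1) * \<bar>g r\<bar> powr (p - 1))"
  shows "radial_profile d p q {0<..<R} (\<lambda>n. R * (1 - 1 / real (Suc (Suc n)))) u g W"
proof
  \<comment> \<open>Two successors make the first value \<open>R / 2\<close>; with only one it would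
    be 0.\<close>
  define b where "b n = R * (1 - 1 / real (Suc (Suc n)))" for n
  have blim: "b \<longlonglongrightarrow> R"
  proof -
    have "(\<lambda>n. R * (1 - inverse (real (Suc (Suc n))))) \<longlonglongrightarrow> R * (1 - 0)"
      by (intro tendsto_intros LIMSEQ_Suc[OF LIMSEQ_inverse_real_of_nat])
    then show ?thesis by (simp add: b_def[abs_def] inverse_eq_divide)
  qed
  have b: "0 < b n" "b n < R" for n
  proof -
    have f: "0 < 1 - 1 / real (Suc (Suc n))" "1 - 1 / real (Suc (Suc n)) < 1" by simp_all
    show "0 < b n" unfolding b_def by (rule mult_pos_pos[OF R f(1)])
    show "b n < R" using mult_strict_left_mono[OF f(2) R] by (simp only: b_def mult_1_right)
  qed
  show "0 < R * (1 - 1 / real (Suc (Suc n)))" for n using b(1) by (simp add: b_def)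
  show "{0<..<R} = (\<Union>n. {0<..R * (1 - 1 / real (Suc (Suc n)))})"
    unfolding b_def[symmetric]
  proof (intro equalityI subsetI)
    fix r assume r: "r \<in> {0<..<R}"
    have "\<forall>\<^sub>F n in sequentially. r < b n" by (rule order_tendstoD(1)[OF blim]) (use r in auto)
    then obtain n where "r < b n" by (metis eventually_sequentially order_refl)
    then show "r \<in> (\<Union>n. {0<..b n})" using r by (intro UN_I[of n]) auto
  next
    fix r assume "r \<in> (\<Union>n. {0<..b n})"
    then show "r \<in> {0<..<R}" using b(2) by (auto intro: le_less_trans)
  qed
  show "incseq (\<lambda>n. R * (1 - 1 / real (Suc (Suc n))))"
    using R by (intro incseq_SucI mult_left_mono) (auto simp: field_simps)
  have "isCont u R"
    by (rule continuous_on_interior[OF ac_continuous_open[OF u]]) (use R in \<open>simp_all add: interior_open\<close>)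
  then have "(\<lambda>n. u (b n)) \<longlonglongrightarrow> u R" by (rule isCont_tendsto_compose[OF _ blim])
  then show "(\<lambda>n. u (R * (1 - 1 / real (Suc (Suc n))))) \<longlonglongrightarrow> 0" using uR[of R] by (simp add: b_def)
  show "u r = 0" if "0 < r" "r \<notin> {0<..<R}" for r using uR that by auto
  \<comment> \<open>Beyond \<open>R\<close> the function \<open>u\<close> is 0, so
    \<open>- u\<close> is non-increasing too. Hence \<open>g \<ge> 0\<close> almost everywhere
    there, and with \<open>g \<le> 0\<close> this gives \<open>g = 0\<close>.\<close>
  have "ac {R<..} (\<lambda>r. - 1 * u r) (\<lambda>r. - 1 * g r)"
    by (rule ac_cmult[OF ac_subset[OF u]]) (use R in auto)
  then have "AE r in lebesgue. r \<in> {R<..} \<longrightarrow> - 1 * g r \<le> 0"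
    by (rule ac_antimono_AE_nonpos) (auto simp: uR)
  moreover have "AE r in lebesgue. r \<noteq> R" using AE_lborel_singleton[of R] by (rule AE_completion)
  ultimately show "AE r in lebesgue. 0 < r \<longrightarrow> r \<notin> {0<..<R} \<longrightarrow> g r = 0"
  proof eventually_elim
    case (elim r)
    then show ?case using g(2)[of r] by (cases "r < R") auto
  qed
qed (use assms in auto)

lemma filterlim_norm_at_right: "filterlim norm (at_right 0) (at (0::'a::euclidean_space))"
  unfolding filterlim_at by (auto simp: eventually_at_filter intro!: tendsto_eq_intros)

lemma radial_nonincreasingI:
  assumes "\<And>r s. 0 < r \<Longrightarrow> r \<le> s \<Longrightarrow> u s \<le> (u r :: real)"
  shows "radial_nonincreasing (\<lambda>x::'a::euclidean_space. u (norm x))"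
  unfolding radial_nonincreasing_def radial_def using assms by auto

text \<open>The norm attains its maximum on \<open>K\<close>, which is therefore strictly below
  \<open>R\<close> and is passed by some \<open>b n\<close>.\<close>

lemma compact_norm_less:
  fixes K :: "'a::euclidean_space set"
  assumes K: "compact K" "\<And>x. x \<in> K \<Longrightarrow> norm x < R" and b: "b \<longlonglongrightarrow> R" "incseq b" "0 < R"
  shows "\<exists>n. \<forall>x\<in>K. norm x < b n"
proof (cases "K = {}")
  case False
  obtain y where y: "y \<in> K" "\<And>x. x \<in> K \<Longrightarrow> norm x \<le> norm y"
    using continuous_attains_sup[OF K(1) False continuous_on_norm_id] by auto
  have "\<forall>\<^sub>F n in sequentially. norm y < b n" by (rule order_tendstoD(1)[OF b(1) K(2)[OF y(1)]])
  then obtain n where "norm y < b n" by (metis eventually_sequentially order_refl)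
  then show ?thesis using y(2) by (auto intro: le_less_trans)
qed auto

text \<open>Along the normal line through \<open>x\<close> the norm is exactly \<open>R + t\<close>
  as long as the origin is not reached, so the two derivatives differ by a translation.\<close>

lemma normal_derivative_iff:
  fixes x :: "'a::euclidean_space"
  assumes x: "norm x = R" and R: "0 < R"
  shows "((\<lambda>t. u (norm (x + t *\<^sub>R (x /\<^sub>R R)))) has_real_derivative 0) (at_left 0)
    \<longleftrightarrow> (u has_real_derivative 0) (at_left R)"
proof -
  have norm: "norm (x + t *\<^sub>R (x /\<^sub>R R)) = R + t" if "- R < t" for t
  proof -
    have "x + t *\<^sub>R (x /\<^sub>R R) = (1 + t / R) *\<^sub>R x" by (simp add: scaleR_add_left divide_inverse)
    moreover have "0 < 1 + t / R" using that R by (simp add: field_simps)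
    ultimately have "norm (x + t *\<^sub>R (x /\<^sub>R R)) = (1 + t / R) * R" using x by (simp only: norm_scaleR abs_of_pos)
    also have "(1 + t / R) * R = R + t" using R by (simp add: distrib_right)
    finally show ?thesis .
  qed
  have ev: "\<forall>\<^sub>F t in at_left 0. - R < t" using R by (intro eventually_at_leftI[of "- R"]) auto
  have "((\<lambda>t. u (norm (x + t *\<^sub>R (x /\<^sub>R R)))) has_real_derivative 0) (at_left 0)
      \<longleftrightarrow> ((\<lambda>t. u (R + t)) has_real_derivative 0) (at_left 0)"
  proof (rule has_field_derivative_cong_eventually)
    show "\<forall>\<^sub>F t in at_left 0. u (norm (x + t *\<^sub>R (x /\<^sub>R R))) = u (R + t)"
      using ev by eventually_elim (simp only: norm)
    show "u (norm (x + 0 *\<^sub>R (x /\<^sub>R R))) = u (R + 0)" using norm[of 0] R by simp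
  qed
  also have "\<dots> \<longleftrightarrow> (u has_real_derivative 0) (at_left R)"
  proof
    assume *: "((\<lambda>t. u (R + t)) has_real_derivative 0) (at_left 0)"
    have im: "(\<lambda>r. r - R) ` {..<R} = {..<0}" by (auto simp: image_iff intro!: bexI[of _ "_ + R"])
    have "((\<lambda>t. u (R + t)) \<circ> (\<lambda>r. r - R) has_real_derivative 0 * 1) (at R within {..<R})"
      by (rule DERIV_image_chain) (use * in \<open>auto simp: im intro!: derivative_eq_intros\<close>)
    then show "(u has_real_derivative 0) (at_left R)" by (simp add: o_def)
  next
    assume *: "(u has_real_derivative 0) (at_left R)"
    have im: "(\<lambda>t. R + t) ` {..<0} = {..<R}" by (auto simp: image_iff intro!: bexI[of _ "_ - R"])
    have "(u \<circ> (\<lambda>t. R + t) has_real_derivative 0 * 1) (at 0 within {..<0})"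
      by (rule DERIV_image_chain) (use * in \<open>auto simp: im intro!: derivative_eq_intros\<close>)
    then show "((\<lambda>t. u (R + t)) has_real_derivative 0) (at_left 0)" by (simp add: o_def)
  qed
  finally show ?thesis .
qed

lemma (in radial_profile) u_antimono: "0 < r \<Longrightarrow> r \<le> s \<Longrightarrow> u s \<le> u r"
  by (rule ac_nonpos_antimono[OF u g0]) auto

lemma P_imp_TF:
  fixes u :: "real \<Rightarrow> real"
  assumes p: "real DIM('a::euclidean_space) < p" and q: "0 \<le> q"
    and Y: "u \<in> Ystar_rad DIM('a) p q" and P: "solves_P DIM('a) p q u"
  shows "TF_solution p q (\<lambda>x::'a. u (norm x))"
proof -
  let ?d = "DIM('a)"
  have p1: "1 < p" using p DIM_positive[where 'a = 'a] by linarith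
  have d1: "1 \<le> ?d" using DIM_positive[where 'a = 'a] by linarith
  obtain g where g: "g \<in> borel_measurable borel" "\<And>r. g r \<le> 0" "ac {0<..} u g"
    "AE r in lebesgue. r \<in> {0<..} \<longrightarrow> radial_deriv u r = g r"
    "(\<lambda>r. (\<bar>u r\<bar> powr (q + 1) + \<bar>g r\<bar> powr p) * r ^ (?d - 1)) absolutely_integrable_on {0<..}"
    using Ystar_rad_profile[OF Y] by blast
  have lims: "(u \<longlongrightarrow> 1) (at_right 0)" "(u \<longlongrightarrow> 0) at_top" and u0: "\<And>r. 0 < r \<Longrightarrow> 0 \<le> u r"
    and ode: "radial_ode_weak ?d p q {0<..} u"
    using Y P by (auto simp: Ystar_rad_def solves_P_def)
  have int: "is_interval {0::real<..}" "open {0::real<..}" "{0::real<..} \<noteq> {}"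
    by (auto simp: is_interval_1 intro: exI[of _ 1])
  note gp = energy_gradient_part[OF g(1,5)]
  obtain W where W: "ac {0<..} W (\<lambda>r. r ^ (?d - 1) * u r powr q)"
    "AE r in lebesgue. r \<in> {0<..} \<longrightarrow> W r = - (r ^ (?d - 1) * \<bar>g r\<bar> powr (p - 1))"
    by (rule flux_exists[OF p1 q g(3,1) u0 ac_nonpos_le_limit[OF g(3,2) lims(1)] gp int(2,1,3) order_refl
          radial_ode_flux[OF d1 p1 g(1,2) gp g(4) int(1,3) order_refl ode]])
  interpret radial_profile ?d p q "{0<..}" "\<lambda>n. real (Suc n)" u g W
    by (rule radial_profile_half_line[OF d1 p q g(3,1,2) u0 lims(1) g(5) lims(2) W])
  have "TF_weak_on p q UNIV (\<lambda>x::'a. u (norm x))"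
  proof (rule TF_weak[OF refl refl])
    fix K :: "'a set" assume "compact K"
    then obtain M where M: "\<And>x. x \<in> K \<Longrightarrow> norm x \<le> M" using compact_imp_bounded[of K] by (auto simp: bounded_iff)
    obtain n where "M \<le> real n" using real_arch_simple by blast
    then show "\<exists>n. \<forall>x\<in>K. norm x < real (Suc n)" using M by (intro exI[of _ n]) force
  qed
  show ?thesis
    unfolding TF_solution_def
  proof (intro conjI)
    show "radial_nonincreasing (\<lambda>x::'a. u (norm x))" by (rule radial_nonincreasingI) (rule u_antimono)
    show "((\<lambda>x::'a. u (norm x)) \<longlongrightarrow> 1) (at 0)" by (rule filterlim_compose[OF lims(1) filterlim_norm_at_right])
    show "((\<lambda>x::'a. u (norm x)) \<longlongrightarrow> 0) at_infinity" by (rule filterlim_compose[OF lims(2) filterlim_norm_at_top])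
  qed fact
qed

text \<open>The conclusion is an instance of \<open>radial_profile\<close>: membership in
  \<open>Ystar_rad\<close>, the radial equation and the value of the constant are all available
  inside that locale.\<close>

lemma TF_imp_profile:
  fixes u :: "real \<Rightarrow> real"
  assumes p: "real DIM('a::euclidean_space) < p" and q: "0 \<le> q"
    and TF: "TF_solution p q (\<lambda>x::'a. u (norm x))"
  obtains g W where "radial_profile DIM('a) p q {0<..} (\<lambda>n. real (Suc n)) u g W" "(u \<longlongrightarrow> 0) at_top"
proof -
  let ?d = "DIM('a)" and ?U = "\<lambda>x::'a. u (norm x)"
  have p1: "1 < p" using p DIM_positive[where 'a = 'a] by linarith
  have d1: "1 \<le> ?d" using DIM_positive[where 'a = 'a] by linarith
  have weak: "TF_weak_on p q UNIV ?U" and mono: "radial_nonincreasing ?U"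
    and lim0: "(?U \<longlongrightarrow> 1) (at 0)" and lim_inf: "(?U \<longlongrightarrow> 0) at_infinity"
    using TF by (auto simp: TF_solution_def)
  obtain g where g: "g \<in> borel_measurable borel" "\<And>r. g r \<le> 0" "ac {0<..} u g" "(u \<longlongrightarrow> 1) (at_right 0)"
    "(\<lambda>r. (\<bar>u r\<bar> powr (q + 1) + \<bar>g r\<bar> powr p) * r ^ (?d - 1)) absolutely_integrable_on {0<..}"
    using TF_weak_profile[OF less_imp_le[OF p1] weak mono lim0] by blast
  obtain e :: 'a where e: "e \<in> Basis" by (meson equals0I nonempty_Basis)
  have lim: "(u \<longlongrightarrow> 0) at_top"
  proof -
    have "filterlim (\<lambda>r. norm (r *\<^sub>R e)) at_top at_top"
      using filterlim_abs_real e by simp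
    then have "filterlim (\<lambda>r. r *\<^sub>R e) at_infinity at_top" by (rule filterlim_norm_at_top_imp_at_infinity)
    from filterlim_compose[OF lim_inf this] show ?thesis
      by (rule Lim_transform_eventually) (use e in \<open>auto intro: eventually_mono[OF eventually_gt_at_top[of 0]]\<close>)
  qed
  \<comment> \<open>\<open>TF_solution\<close> does not state a sign; it follows from monotonicity
    and the limit 0 at infinity.\<close>
  have u0: "0 \<le> u r" if "0 < r" for r
  proof (rule tendsto_upperbound[OF lim])
    show "\<forall>\<^sub>F s in at_top. u s \<le> u r"
      using eventually_ge_at_top[of r]
      by eventually_elim (rule ac_nonpos_antimono[OF g(3,2)], use that in auto)
  qed simp
  have int: "is_interval {0::real<..}" "open {0::real<..}" "{0::real<..} \<noteq> {}"
    by (auto simp: is_interval_1 intro: exI[of _ 1])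
  obtain W where W: "ac {0<..} W (\<lambda>r. r ^ (?d - 1) * u r powr q)"
    "AE r in lebesgue. r \<in> {0<..} \<longrightarrow> W r = - (r ^ (?d - 1) * \<bar>g r\<bar> powr (p - 1))"
    by (rule flux_exists[OF p1 q g(3,1) u0 ac_nonpos_le_limit[OF g(3,2,4)] energy_gradient_part[OF g(1,5)] int(2,1,3) order_refl
          TF_flux[OF refl g(3,1,2,4) int(2) order_refl UNIV_I weak]])
  show ?thesis
    by (rule that[OF radial_profile_half_line[OF d1 p q g(3,1,2) u0 g(4,5) lim W] lim])
qed

lemma FBP_imp_TF_ball:
  fixes u :: "real \<Rightarrow> real"
  assumes p: "real DIM('a::euclidean_space) < p" and q: "0 \<le> q"
    and Y: "u \<in> Ystar_rad DIM('a) p q" and P: "solves_FBP DIM('a) p q R u"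
  shows "TF_ball_solution p q R (\<lambda>x::'a. u (norm x))"
proof -
  let ?d = "DIM('a)"
  have p1: "1 < p" using p DIM_positive[where 'a = 'a] by linarith
  have d1: "1 \<le> ?d" using DIM_positive[where 'a = 'a] by linarith
  obtain g where g: "g \<in> borel_measurable borel" "\<And>r. g r \<le> 0" "ac {0<..} u g"
    "AE r in lebesgue. r \<in> {0<..} \<longrightarrow> radial_deriv u r = g r"
    "(\<lambda>r. (\<bar>u r\<bar> powr (q + 1) + \<bar>g r\<bar> powr p) * r ^ (?d - 1)) absolutely_integrable_on {0<..}"
    using Ystar_rad_profile[OF Y] by blast
  have lim1: "(u \<longlongrightarrow> 1) (at_right 0)" and u0: "\<And>r. 0 < r \<Longrightarrow> 0 \<le> u r"
    and R: "0 < R" "\<And>r. 0 < r \<Longrightarrow> r < R \<Longrightarrow> 0 < u r" "\<And>r. R \<le> r \<Longrightarrow> u r = 0"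
    and ode: "radial_ode_weak ?d p q {0<..<R} u" and dR: "(u has_real_derivative 0) (at_left R)"
    using Y P by (auto simp: Ystar_rad_def solves_FBP_def)
  have int: "is_interval {0<..<R}" "open {0<..<R}" "{0<..<R} \<noteq> {}" "{0<..<R} \<subseteq> {0<..}"
    using R(1) by (auto simp: is_interval_1)
  note gp = energy_gradient_part[OF g(1,5)]
  obtain W where W: "ac {0<..<R} W (\<lambda>r. r ^ (?d - 1) * u r powr q)"
    "AE r in lebesgue. r \<in> {0<..<R} \<longrightarrow> W r = - (r ^ (?d - 1) * \<bar>g r\<bar> powr (p - 1))"
    by (rule flux_exists[OF p1 q g(3,1) u0 ac_nonpos_le_limit[OF g(3,2) lim1] gp int(2,1,3,4)
          radial_ode_flux[OF d1 p1 g(1,2) gp g(4) int(1,3,4) ode]])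
  let ?b = "\<lambda>n. R * (1 - 1 / real (Suc (Suc n)))"
  interpret radial_profile ?d p q "{0<..<R}" ?b u g W
    by (rule radial_profile_bounded[OF R(1) g(3,1,2) R(3) d1 p q u0 lim1 g(5) W])
  have blim: "?b \<longlonglongrightarrow> R"
  proof -
    have "(\<lambda>n. R * (1 - inverse (real (Suc (Suc n))))) \<longlonglongrightarrow> R * (1 - 0)"
      by (intro tendsto_intros LIMSEQ_Suc[OF LIMSEQ_inverse_real_of_nat])
    then show ?thesis by (simp add: inverse_eq_divide)
  qed
  have "TF_weak_on p q (ball 0 R) (\<lambda>x::'a. u (norm x))"
    by (rule TF_weak[OF refl refl], rule compact_norm_less[OF _ _ blim b(1) R(1)]) auto
  moreover have "((\<lambda>t. u (norm (x + t *\<^sub>R (x /\<^sub>R R)))) has_real_derivative 0) (at_left 0)" if "norm x = R" for x :: 'a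
    using normal_derivative_iff[OF that R(1)] dR by blast
  moreover have "radial_nonincreasing (\<lambda>x::'a. u (norm x))" by (rule radial_nonincreasingI) (rule u_antimono)
  moreover have "((\<lambda>x::'a. u (norm x)) \<longlongrightarrow> 1) (at 0)" by (rule filterlim_compose[OF lim1 filterlim_norm_at_right])
  ultimately show ?thesis
    unfolding TF_ball_solution_def using R by simp
qed

lemma TF_ball_imp_profile:
  fixes u :: "real \<Rightarrow> real"
  assumes p: "real DIM('a::euclidean_space) < p" and q: "0 \<le> q"
    and TF: "TF_ball_solution p q R (\<lambda>x::'a. u (norm x))"
  obtains g W where "radial_profile DIM('a) p q {0<..<R} (\<lambda>n. R * (1 - 1 / real (Suc (Suc n)))) u g W"
    "0 < R" "\<And>r. 0 < r \<Longrightarrow> r < R \<Longrightarrow> 0 < u r" "\<And>r. R \<le> r \<Longrightarrow> u r = 0" "(u has_real_derivative 0) (at_left R)"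
proof -
  let ?d = "DIM('a)" and ?U = "\<lambda>x::'a. u (norm x)"
  have p1: "1 < p" using p DIM_positive[where 'a = 'a] by linarith
  have d1: "1 \<le> ?d" using DIM_positive[where 'a = 'a] by linarith
  have R: "0 < R" and pos: "\<And>x::'a. x \<noteq> 0 \<Longrightarrow> norm x < R \<Longrightarrow> 0 < ?U x" and zero: "\<And>x::'a. R \<le> norm x \<Longrightarrow> ?U x = 0"
    and weak: "TF_weak_on p q (ball 0 R) ?U" and mono: "radial_nonincreasing ?U"
    and lim0: "(?U \<longlongrightarrow> 1) (at 0)"
    and dR: "\<And>x::'a. norm x = R \<Longrightarrow> ((\<lambda>t. ?U (x + t *\<^sub>R (x /\<^sub>R R))) has_real_derivative 0) (at_left 0)"
    using TF by (auto simp: TF_ball_solution_def)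
  obtain e :: 'a where e: "e \<in> Basis" by (meson equals0I nonempty_Basis)
  have upos: "0 < u r" if "0 < r" "r < R" for r using pos[of "r *\<^sub>R e"] that e nonzero_Basis[OF e] by simp
  have uR: "u r = 0" if "R \<le> r" for r using zero[of "r *\<^sub>R e"] that e R by simp
  have dR': "(u has_real_derivative 0) (at_left R)"
    using dR[of "R *\<^sub>R e"] normal_derivative_iff[of "R *\<^sub>R e" R u] e R by simp
  have u0: "0 \<le> u r" if "0 < r" for r using upos[OF that] uR[of r] by (cases "r < R") auto
  obtain g where g: "g \<in> borel_measurable borel" "\<And>r. g r \<le> 0" "ac {0<..} u g" "(u \<longlongrightarrow> 1) (at_right 0)"
    "(\<lambda>r. (\<bar>u r\<bar> powr (q + 1) + \<bar>g r\<bar> powr p) * r ^ (?d - 1)) absolutely_integrable_on {0<..}"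
    using TF_weak_profile[OF less_imp_le[OF p1] weak mono lim0] by blast
  have int: "is_interval {0<..<R}" "open {0<..<R}" "{0<..<R} \<noteq> {}" "{0<..<R} \<subseteq> {0<..}"
    using R by (auto simp: is_interval_1)
  have S: "x \<in> ball 0 R" if "norm x \<in> {0<..<R}" for x :: 'a using that by simp
  obtain W where W: "ac {0<..<R} W (\<lambda>r. r ^ (?d - 1) * u r powr q)"
    "AE r in lebesgue. r \<in> {0<..<R} \<longrightarrow> W r = - (r ^ (?d - 1) * \<bar>g r\<bar> powr (p - 1))"
    by (rule flux_exists[OF p1 q g(3,1) u0 ac_nonpos_le_limit[OF g(3,2,4)] energy_gradient_part[OF g(1,5)] int(2,1,3,4)
          TF_flux[OF refl g(3,1,2,4) int(2,4) S weak]])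
  show ?thesis
    by (rule that[OF radial_profile_bounded[OF R g(3,1,2) uR d1 p q u0 g(4,5) W] R upos uR dR'])
qed

section \<open>The value of the constant in dimension one\<close>

lemma sphere_area_1: "sphere_area (Suc 0) = 2"
  by (simp add: sphere_area_def)

text \<open>On an unbounded interval a linear rate of decrease would make \<open>u\<close> negative,
  so \<open>W_end\<close> yields that \<open>W\<close> tends to 0.\<close>

lemma one_dim_half_line:
  assumes "radial_profile 1 p q {0<..} (\<lambda>n. real (Suc n)) u g W" and q_pos: "0 < q"
  shows "- radial_profile.W0 {0<..} (\<lambda>n. real (Suc n)) W = (p / ((q + 1) * (p - 1))) powr ((p - 1) / p)"
proof -
  interpret radial_profile 1 p q "{0<..}" "\<lambda>n. real (Suc n)" u g W by fact
  have "\<not> (\<exists>k>0. \<forall>s t. s \<in> {0<..} \<longrightarrow> t \<in> {0<..} \<longrightarrow> s \<le> t \<longrightarrow> u t \<le> u s - k * (t - s))"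
  proof safe
    fix k :: real assume k: "k > 0" "\<forall>s t. s \<in> {0<..} \<longrightarrow> t \<in> {0<..} \<longrightarrow> s \<le> t \<longrightarrow> u t \<le> u s - k * (t - s)"
    \<comment> \<open>The distance \<open>2 / k\<close> forces a loss of 2, more than the bound
      \<open>u \<le> 1\<close> permits.\<close>
    have "u (1 + 2 / k) \<le> u 1 - k * (1 + 2 / k - 1)"
      using k(1) by (intro k(2)[rule_format]) (simp_all add: add_pos_pos)
    also have "k * (1 + 2 / k - 1) = 2" using k(1) by simp
    finally have "u (1 + 2 / k) \<le> u 1 - 2" .
    moreover have "0 \<le> u (1 + 2 / k)" using k(1) by (intro u0) (simp add: add_pos_pos)
    ultimately show False using u_le_1[of 1] by simp
  qed
  then have "(\<lambda>n. W (real (Suc n))) \<longlonglongrightarrow> 0" using W_end by blast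
  then show ?thesis by (intro one_dim_W0) (use q_pos in auto)
qed

text \<open>A linear rate \<open>k\<close> of decrease would give a difference quotient of at most
  \<open>- k\<close> at \<open>R\<close>, against \<open>u'(R) = 0\<close>.\<close>

lemma one_dim_bounded:
  assumes "radial_profile 1 p q {0<..<R} b u g W" and R: "0 < R" "u R = 0"
    and pos: "\<And>r. 0 < r \<Longrightarrow> r < R \<Longrightarrow> 0 < u r" and dR: "(u has_real_derivative 0) (at_left R)"
  shows "- radial_profile.W0 {0<..<R} b W = (p / ((q + 1) * (p - 1))) powr ((p - 1) / p)"
proof -
  interpret radial_profile 1 p q "{0<..<R}" b u g W by fact
  have "\<not> (\<exists>k>0. \<forall>s t. s \<in> {0<..<R} \<longrightarrow> t \<in> {0<..<R} \<longrightarrow> s \<le> t \<longrightarrow> u t \<le> u s - k * (t - s))"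
  proof safe
    fix k :: real assume k: "k > 0" "\<forall>s t. s \<in> {0<..<R} \<longrightarrow> t \<in> {0<..<R} \<longrightarrow> s \<le> t \<longrightarrow> u t \<le> u s - k * (t - s)"
    \<comment> \<open>From \<open>0 \<le> u t \<le> u s - k * (t - s)\<close> by letting
      \<open>t\<close> tend to \<open>R\<close>; the decrease is known only inside the open
      interval.\<close>
    have lin: "k * (R - s) \<le> u s" if s: "0 < s" "s < R" for s
    proof (rule tendsto_upperbound)
      show "((\<lambda>t. k * (t - s)) \<longlongrightarrow> k * (R - s)) (at_left R)" by (intro tendsto_intros)
      have "k * (t - s) \<le> u s" if "t \<in> {s<..<R}" for t
        using k(2)[rule_format, of s t] that s u0[of t] by auto
      then show "\<forall>\<^sub>F t in at_left R. k * (t - s) \<le> u s"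
        using s(2) by (intro eventually_at_leftI[of s]) auto
    qed simp
    have "((\<lambda>s. (u s - u R) / (s - R)) \<longlongrightarrow> 0) (at_left R)"
      using dR by (simp add: has_field_derivative_iff)
    from order_tendstoD(1)[OF this, of "- k"] k(1)
    have "\<forall>\<^sub>F s in at_left R. - k < (u s - u R) / (s - R)" by simp
    moreover have "\<forall>\<^sub>F s in at_left R. s \<in> {0<..<R}" using R(1) by (intro eventually_at_leftI[of 0]) auto
    ultimately have "\<forall>\<^sub>F s in at_left R. False"
    proof eventually_elim
      case (elim s)
      then have "u s / (s - R) \<le> - k" using lin[of s] by (simp add: field_simps)
      then show ?case using elim R(2) by simp
    qed
    then show False by simp
  qed
  then have "(\<lambda>n. W (b n)) \<longlonglongrightarrow> 0" using W_end by blast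
  then show ?thesis by (intro one_dim_W0) (use pos in auto)
qed

theorem proposition3p2:
  fixes p q :: real
  assumes "real DIM('a::euclidean_space) < p" and "0 \<le> q"
  shows
    "(p - 1 \<le> q \<longrightarrow>
        (\<forall>u. u \<in> Ystar_rad DIM('a) p q \<and> solves_P DIM('a) p q u \<longrightarrow>
           TF_solution p q (\<lambda>x::'a. u (norm x))) \<and>
        (\<forall>u. in_W1p p (\<lambda>x::'a. u (norm x)) \<and> TF_solution p q (\<lambda>x::'a. u (norm x)) \<longrightarrow>
           solves_P DIM('a) p q u \<and> u \<in> Ystar_rad DIM('a) p q)) \<and>
     (q < p - 1 \<longrightarrow>
        (\<forall>R>0. \<forall>u. u \<in> Ystar_rad DIM('a) p q \<and> solves_FBP DIM('a) p q R u \<longrightarrow>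
           TF_ball_solution p q R (\<lambda>x::'a. u (norm x))) \<and>
        (\<forall>R>0. \<forall>u. in_W1p p (\<lambda>x::'a. u (norm x)) \<and>
             TF_ball_solution p q R (\<lambda>x::'a. u (norm x)) \<longrightarrow>
           solves_FBP DIM('a) p q R u \<and> u \<in> Ystar_rad DIM('a) p q)) \<and>
     (DIM('a) = 1 \<longrightarrow>
        (\<forall>u. (p - 1 \<le> q \<and> TF_solution p q (\<lambda>x::'a. u (norm x))) \<or>
             (q < p - 1 \<and> (\<exists>R>0. TF_ball_solution p q R (\<lambda>x::'a. u (norm x)))) \<longrightarrow>
           TF_const p q (\<lambda>x::'a. u (norm x)) =
             2 * (p / ((q + 1) * (p - 1))) powr ((p - 1) / p)))"
proof (intro conjI impI allI; (elim conjE)?)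
  fix u assume "u \<in> Ystar_rad DIM('a) p q" "solves_P DIM('a) p q u"
  then show "TF_solution p q (\<lambda>x::'a. u (norm x))" by (intro P_imp_TF assms)
next
  fix u assume TF: "TF_solution p q (\<lambda>x::'a. u (norm x))"
  obtain g W where prof: "radial_profile DIM('a) p q {0<..} (\<lambda>n. real (Suc n)) u g W" and lim: "(u \<longlongrightarrow> 0) at_top"
    by (rule TF_imp_profile[OF assms TF])
  show "solves_P DIM('a) p q u"
    unfolding solves_P_def using radial_profile.ode_weak[OF prof] radial_profile.lim[OF prof] lim by blast
  show "u \<in> Ystar_rad DIM('a) p q" by (rule radial_profile.in_Ystar[OF prof])
next
  fix R :: real and u assume "u \<in> Ystar_rad DIM('a) p q" "solves_FBP DIM('a) p q R u"
  then show "TF_ball_solution p q R (\<lambda>x::'a. u (norm x))" by (intro FBP_imp_TF_ball assms)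
next
  fix R :: real and u assume TF: "TF_ball_solution p q R (\<lambda>x::'a. u (norm x))"
  obtain g W where prof: "radial_profile DIM('a) p q {0<..<R} (\<lambda>n. R * (1 - 1 / real (Suc (Suc n)))) u g W"
    and R: "0 < R" "\<And>r. 0 < r \<Longrightarrow> r < R \<Longrightarrow> 0 < u r" "\<And>r. R \<le> r \<Longrightarrow> u r = 0" "(u has_real_derivative 0) (at_left R)"
    using TF_ball_imp_profile[OF assms TF] by blast
  show "solves_FBP DIM('a) p q R u"
    unfolding solves_FBP_def using radial_profile.ode_weak[OF prof] radial_profile.lim[OF prof] R by blast
  show "u \<in> Ystar_rad DIM('a) p q" by (rule radial_profile.in_Ystar[OF prof])
next
  fix u
  assume d: "DIM('a) = 1" and TF: "(p - 1 \<le> q \<and> TF_solution p q (\<lambda>x::'a. u (norm x))) \<or>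
             (q < p - 1 \<and> (\<exists>R>0. TF_ball_solution p q R (\<lambda>x::'a. u (norm x))))"
  from TF show "TF_const p q (\<lambda>x::'a. u (norm x)) = 2 * (p / ((q + 1) * (p - 1))) powr ((p - 1) / p)"
  proof (elim disjE conjE exE)
    assume "p - 1 \<le> q" and TF: "TF_solution p q (\<lambda>x::'a. u (norm x))"
    \<comment> \<open>Here \<open>q \<ge> p - 1 > d - 1 = 0\<close>. On the half-line
      \<open>u\<close> may have zeros, and \<open>one_dim_W0\<close> then asks for a positive
      exponent.\<close>
    then have "0 < q" using assms(1) d by simp
    obtain g W where prof: "radial_profile DIM('a) p q {0<..} (\<lambda>n. real (Suc n)) u g W"
      by (rule TF_imp_profile[OF assms TF])
    show ?thesis
      using radial_profile.TF_const_eq[OF prof refl refl] one_dim_half_line[OF prof[unfolded d] \<open>0 < q\<close>]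
      by (simp add: d sphere_area_1)
  next
    fix R assume TF: "TF_ball_solution p q R (\<lambda>x::'a. u (norm x))"
    obtain g W where prof: "radial_profile DIM('a) p q {0<..<R} (\<lambda>n. R * (1 - 1 / real (Suc (Suc n)))) u g W"
      and R: "0 < R" "\<And>r. 0 < r \<Longrightarrow> r < R \<Longrightarrow> 0 < u r" "\<And>r. R \<le> r \<Longrightarrow> u r = 0" "(u has_real_derivative 0) (at_left R)"
      using TF_ball_imp_profile[OF assms TF] by blast
    show ?thesis
      using radial_profile.TF_const_eq[OF prof refl refl] one_dim_bounded[OF prof[unfolded d] R(1) R(3)[OF order_refl] R(2,4)]
      by (simp add: d sphere_area_1)
  qed
qed

end
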